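(* Let $H$ be a Hopf algebra and $\delta$ a character on $H$ such that $S_\delta^2=\mathrm{Id}$. Then there are isomorphisms $$C^{*}_{\lambda,\delta}(H)\cong T(H)_{\natural,\delta},\qquad CC^{*}_{\delta}(H)\cong X_\delta(T(H)),$$ of complexes, respectively of super-complexes of complexes (cyclic bicomplexes), up to a degree shift by one: degree $n$ of $C^*_{\lambda,\delta}(H)$, respectively of the columns of $CC^*_\delta(H)$, corresponds to tensor degree $n+1$ in $T(H)$.
   Context: $H$ is a Hopf algebra over $\mathbb{C}$ with counit $\epsilon$, antipode $S$, coproduct $\Delta(h)=\sum h_0\otimes h_1$; a character is a non-zero algebra map $\delta:H\to\mathbb{C}$; $S_\delta(h)=\sum\delta(h_0)S(h_1)$. $H$ acts diagonally on tensor products of $H$-modules. "Coinvariants" of an $H$-module $V$ means the linear span of the elements $hv-\delta(h)v$; $V_\delta$ is the quotient of $V$ by it. The cyclic (i.e. cocyclic) module $H^\sharp_\delta$ has $H^{\otimes n}$ in degree $n$, with $d^0(h^1,\dots,h^n)=(1,h^1,\dots,h^n)$, $d^i(h^1,\dots,h^n)=(h^1,\dots,\Delta h^i,\dots,h^n)$ for $1\le i\le n$, $d^{n+1}(h^1,\dots,h^n)=(h^1,\dots,h^n,1)$, $s^i(h^1,\dots,h^n)=(h^1,\dots,\epsilon(h^{i+1}),\dots,h^n)$, $t(h^1,\dots,h^n)=S_\delta(h^1)\cdot(h^2,\dots,h^n,1)$ (it is cyclic because $S_\delta^2=\mathrm{Id}$). For a cocyclic module $C$, let on $C^n$: $b=\sum_{i=0}^{n+1}(-1)^id^i$,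 $b'=\sum_{i=0}^{n}(-1)^id^i$, $\lambda=(-1)^nt$, $N=\sum_{i=0}^n\lambda^i$. The cyclic complex is $C_\lambda=(\mathrm{Ker}(1-\lambda),b)$ (isomorphic via $N$ to $(C/\mathrm{Im}(1-\lambda),b')$). The cyclic (upper half plane) bicomplex has columns alternately $(C,b)$ and $(C,-b')$, with horizontal maps $1-\lambda$ from the $b$-columns to the $b'$-columns and $N$ from the $b'$-columns to the $b$-columns. For $C=H^\sharp_\delta$ these are denoted $C^*_{\lambda,\delta}(H)$ and $CC^*_\delta(H)$. $T(H)$ is the (non-unital) DG tensor algebra: $H^{\otimes n}$ in degree $n\ge1$, $0$ otherwise, with differential the derivation determined by $h\mapsto\Delta(h)$, and with diagonal $H$-action ($H$ acting on itself by left multiplication). For a DG algebra $R$ with an $H$-action compatible with grading and differential and flat, i.e. $h(xy)=\sum h_0(x)h_1(y)$: $R_{\natural,\delta}=R/([R,R]+\text{coinvariants})$ (graded commutators); $\Omega^1(R)=\tilde R\otimes R$ ($\tilde R$ is $R$ with a unit adjoined) is the bimodule of non-commutative 1-forms $x\,dy$ with diagonal $H$-action ($h\cdot 1=\epsilon(h)1$); $\Omega^1(R)_{\natural,\delta}=\Omega^1(R)/([\Omega^1(R),R]+\text{coinvariants})$. The localized $X$-complex $X_\delta(R)$ is the super-complex $R_\delta\rightleftarrows\Omega^1(R)_{\natural,\delta}$ with $d(x)=dx$ and $b(x\,dy)=[x,y]$; in the graded setting it is a 2-periodic cyclic bicomplex with the induced vertical differentials (the vertical differential on the even columns $R_\delta$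 taken with a minus sign so that differentials anticommute). *)

theory Defs
  imports Complex_Main "HOL-Library.Poly_Mapping" "HOL-Library.Product_Plus"
begin

section \<open>Complex vector spaces and algebras\<close>

class complex_vector = ab_group_add +
  fixes scaleC :: "complex \<Rightarrow> 'a \<Rightarrow> 'a"  (infixr \<open>*\<^sub>C\<close> 75)
  assumes scaleC_add_right: "a *\<^sub>C (x + y) = a *\<^sub>C x + a *\<^sub>C y"
    and scaleC_add_left: "(a + b) *\<^sub>C x = a *\<^sub>C x + b *\<^sub>C x"
    and scaleC_scaleC [simp]: "a *\<^sub>C b *\<^sub>C x = (a * b) *\<^sub>C x"
    and scaleC_one [simp]: "1 *\<^sub>C x = x"

class complex_algebra = complex_vector + ring +
  assumes scaleC_mult_left [simp]: "(a *\<^sub>C x) * y = a *\<^sub>C (x * y)"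
    and scaleC_mult_right [simp]: "x * (a *\<^sub>C y) = a *\<^sub>C (x * y)"

class complex_algebra_1 = complex_algebra + ring_1

global_interpretation complex_vector: vector_space "scaleC :: complex \<Rightarrow> 'a \<Rightarrow> 'a::complex_vector"
  by unfold_locales (simp_all add: scaleC_add_right scaleC_add_left)

global_interpretation complex_vector: vector_space_pair
  "scaleC :: complex \<Rightarrow> 'a \<Rightarrow> 'a::complex_vector" "scaleC :: complex \<Rightarrow> 'b \<Rightarrow> 'b::complex_vector"
  by unfold_locales

abbreviation clinear :: "('a::complex_vector \<Rightarrow> 'b::complex_vector) \<Rightarrow> bool"
  where "clinear \<equiv> Vector_Spaces.linear scaleC scaleC"

abbreviation cspan :: "'a::complex_vector set \<Rightarrow> 'a set"
  where "cspan \<equiv> module.span scaleC"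

lemma clinear_iff:
  "clinear f \<longleftrightarrow> (\<forall>x y. f (x + y) = f x + f y) \<and> (\<forall>c x. f (c *\<^sub>C x) = c *\<^sub>C f x)"
  by (simp add: Vector_Spaces.linear_iff complex_vector.vector_space_axioms)

lemma clinear_add: "clinear f \<Longrightarrow> f (x + y) = f x + f y"
  and clinear_scale: "clinear f \<Longrightarrow> f (c *\<^sub>C x) = c *\<^sub>C f x"
  and clinear_diff: "clinear f \<Longrightarrow> f (x - y) = f x - f y"
  and clinear_zero: "clinear f \<Longrightarrow> f 0 = 0"
  by (simp_all add: clinear_iff complex_vector.linear_diff complex_vector.linear_0)

lemma clinear_eq_on_span:
  assumes "clinear f" "clinear g" "\<And>b. b \<in> B \<Longrightarrow> f b = g b" "x \<in> cspan B"
  shows "f x = g x"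
  using complex_vector.linear_eq_on_span [OF assms(1,2)] assms(3,4) by blast

lemma clinear_zero_on_span:
  assumes "clinear f" "\<And>b. b \<in> B \<Longrightarrow> f b = 0" "x \<in> cspan B"
  shows "f x = 0"
  by (rule complex_vector.linear_eq_0_on_span [OF assms(1)]) (use assms in auto)

instantiation complex :: complex_algebra_1
begin
definition scaleC_complex :: "complex \<Rightarrow> complex \<Rightarrow> complex" where "scaleC_complex = (*)"
instance by standard (simp_all add: scaleC_complex_def algebra_simps)
end

instantiation prod :: (complex_vector, complex_vector) complex_vector
begin
definition scaleC_prod :: "complex \<Rightarrow> 'a \<times> 'b \<Rightarrow> 'a \<times> 'b"
  where "scaleC_prod c x = (c *\<^sub>C fst x, c *\<^sub>C snd x)"
instance by standard (simp_all add: scaleC_prod_def scaleC_add_right scaleC_add_left)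
end

instantiation poly_mapping :: (type, complex_vector) complex_vector
begin
definition scaleC_poly_mapping :: "complex \<Rightarrow> ('a \<Rightarrow>\<^sub>0 'b) \<Rightarrow> ('a \<Rightarrow>\<^sub>0 'b)"
  where "scaleC_poly_mapping c p = Poly_Mapping.map (scaleC c) p"
lemma lookup_scaleC: "Poly_Mapping.lookup (c *\<^sub>C p) k = c *\<^sub>C Poly_Mapping.lookup p k" for p :: "'a \<Rightarrow>\<^sub>0 'b"
  by (simp add: scaleC_poly_mapping_def Poly_Mapping.map.rep_eq when_def)
instance
  by standard (rule poly_mapping_eqI,
      simp add: lookup_scaleC lookup_add scaleC_add_right scaleC_add_left)+
end

section \<open>Tensor products and the tensor algebra\<close>

text \<open>The type \<open>'x \<Rightarrow>\<^sub>0 complex\<close> is the vector space freely generated by \<open>'x\<close>.\<close>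

definition free_ext :: "('x \<Rightarrow> 'b::complex_vector) \<Rightarrow> ('x \<Rightarrow>\<^sub>0 complex) \<Rightarrow> 'b"
  where "free_ext f p = (\<Sum>x\<in>Poly_Mapping.keys p. Poly_Mapping.lookup p x *\<^sub>C f x)"

lemma free_ext_superset:
  assumes "finite A" "Poly_Mapping.keys p \<subseteq> A"
  shows "free_ext f p = (\<Sum>x\<in>A. Poly_Mapping.lookup p x *\<^sub>C f x)"
  unfolding free_ext_def using assms
  by (intro sum.mono_neutral_left) (auto simp: in_keys_iff)

lemma clinear_free_ext: "clinear (free_ext f)"
  unfolding clinear_iff
proof (intro conjI allI)
  fix p q :: "'a \<Rightarrow>\<^sub>0 complex"
  let ?A = "Poly_Mapping.keys p \<union> Poly_Mapping.keys q"
  have "free_ext f (p + q) = (\<Sum>x\<in>?A. Poly_Mapping.lookup (p + q) x *\<^sub>C f x)"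
    by (rule free_ext_superset) (use Poly_Mapping.keys_add [of p q] in auto)
  also have "\<dots> = (\<Sum>x\<in>?A. Poly_Mapping.lookup p x *\<^sub>C f x) + (\<Sum>x\<in>?A. Poly_Mapping.lookup q x *\<^sub>C f x)"
    by (simp add: lookup_add scaleC_add_left sum.distrib)
  also have "\<dots> = free_ext f p + free_ext f q"
    by (simp add: free_ext_superset [of ?A])
  finally show "free_ext f (p + q) = free_ext f p + free_ext f q" .
next
  fix c and p :: "'a \<Rightarrow>\<^sub>0 complex"
  have "free_ext f (c *\<^sub>C p) = (\<Sum>x\<in>Poly_Mapping.keys p. Poly_Mapping.lookup (c *\<^sub>C p) x *\<^sub>C f x)"
    by (rule free_ext_superset) (auto simp: in_keys_iff lookup_scaleC)
  also have "\<dots> = c *\<^sub>C free_ext f p"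
    by (simp add: free_ext_def lookup_scaleC scaleC_complex_def complex_vector.scale_sum_right)
  finally show "free_ext f (c *\<^sub>C p) = c *\<^sub>C free_ext f p" .
qed

lemma free_ext_single [simp]: "free_ext f (Poly_Mapping.single x c) = c *\<^sub>C f x"
  by (cases "c = 0") (simp_all add: free_ext_def)

lemma free_span: "p \<in> cspan (range (\<lambda>x. Poly_Mapping.single x (1::complex)))"
proof -
  have "p = free_ext (\<lambda>x. Poly_Mapping.single x 1) p"
  proof (rule poly_mapping_eqI)
    fix k
    have "Poly_Mapping.lookup (free_ext (\<lambda>x. Poly_Mapping.single x 1) p) k
        = (\<Sum>x\<in>Poly_Mapping.keys p. if x = k then Poly_Mapping.lookup p x else 0)"
      unfolding free_ext_def lookup_sum
      by (intro sum.cong) (auto simp: lookup_scaleC lookup_single when_def scaleC_complex_def)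
    then show "Poly_Mapping.lookup p k = Poly_Mapping.lookup (free_ext (\<lambda>x. Poly_Mapping.single x 1) p) k"
      by (simp add: in_keys_iff)
  qed
  also have "\<dots> \<in> cspan (range (\<lambda>x. Poly_Mapping.single x 1))"
    unfolding free_ext_def
    by (intro complex_vector.span_sum complex_vector.span_scale complex_vector.span_base) auto
  finally show ?thesis .
qed

subsection \<open>The tensor product of two spaces\<close>

definition tensor_rels :: "('a::complex_vector \<times> 'b::complex_vector \<Rightarrow>\<^sub>0 complex) set" where
  "tensor_rels =
     {Poly_Mapping.single (x + x', y) 1 - Poly_Mapping.single (x, y) 1
        - Poly_Mapping.single (x', y) 1 | x x' y. True}
   \<union> {Poly_Mapping.single (x, y + y') 1 - Poly_Mapping.single (x, y) 1
        - Poly_Mapping.single (x, y') 1 | x y y'. True}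
   \<union> {Poly_Mapping.single (c *\<^sub>C x, y) 1 - Poly_Mapping.single (x, y) c | c x y. True}
   \<union> {Poly_Mapping.single (x, c *\<^sub>C y) 1 - Poly_Mapping.single (x, y) c | c x y. True}"

definition tensor_eq ::
    "('a::complex_vector \<times> 'b::complex_vector \<Rightarrow>\<^sub>0 complex) \<Rightarrow> ('a \<times> 'b \<Rightarrow>\<^sub>0 complex) \<Rightarrow> bool"
  where "tensor_eq p q \<longleftrightarrow> p - q \<in> cspan tensor_rels"

lemma cspan_congs:
  fixes W :: "'a::complex_vector set"
  shows "x - x \<in> cspan W"
    and "x - y \<in> cspan W \<Longrightarrow> y - x \<in> cspan W"
    and "x - y \<in> cspan W \<Longrightarrow> y - z \<in> cspan W \<Longrightarrow> x - z \<in> cspan W"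
    and "x - y \<in> cspan W \<Longrightarrow> x' - y' \<in> cspan W \<Longrightarrow> (x + x') - (y + y') \<in> cspan W"
    and "x - y \<in> cspan W \<Longrightarrow> x' - y' \<in> cspan W \<Longrightarrow> (x - x') - (y - y') \<in> cspan W"
    and "x - y \<in> cspan W \<Longrightarrow> - x - (- y) \<in> cspan W"
    and "x - y \<in> cspan W \<Longrightarrow> c *\<^sub>C x - c *\<^sub>C y \<in> cspan W"
proof -
  show "x - x \<in> cspan W" by (simp add: complex_vector.span_zero)
  show s: "y - x \<in> cspan W" if "x - y \<in> cspan W" for x y
    using complex_vector.span_neg [OF that] by simp
  show "x - z \<in> cspan W" if "x - y \<in> cspan W" "y - z \<in> cspan W"
    using complex_vector.span_add [OF that] by simp
  show "(x + x') - (y + y') \<in> cspan W" if "x - y \<in> cspan W" "x' - y' \<in> cspan W"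
    using complex_vector.span_add [OF that] by (simp add: algebra_simps)
  show "(x - x') - (y - y') \<in> cspan W" if "x - y \<in> cspan W" "x' - y' \<in> cspan W"
    using complex_vector.span_diff [OF that] by (simp add: algebra_simps)
  show "- x - (- y) \<in> cspan W" if "x - y \<in> cspan W"
    using s [OF that] by simp
  show "c *\<^sub>C x - c *\<^sub>C y \<in> cspan W" if "x - y \<in> cspan W"
    using complex_vector.span_scale [OF that, of c]
    by (simp add: complex_vector.scale_right_diff_distrib)
qed

quotient_type (overloaded) ('a, 'b) tensor =
  "'a::complex_vector \<times> 'b::complex_vector \<Rightarrow>\<^sub>0 complex" / tensor_eq
  by (rule equivpI; unfold reflp_def symp_def transp_def tensor_eq_def; blast intro: cspan_congs)

instantiation tensor :: (complex_vector, complex_vector) complex_vector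
begin
lift_definition zero_tensor :: "('a, 'b) tensor" is 0 .
lift_definition plus_tensor :: "('a, 'b) tensor \<Rightarrow> ('a, 'b) tensor \<Rightarrow> ('a, 'b) tensor" is "(+)"
  unfolding tensor_eq_def by (rule cspan_congs)
lift_definition minus_tensor :: "('a, 'b) tensor \<Rightarrow> ('a, 'b) tensor \<Rightarrow> ('a, 'b) tensor" is "(-)"
  unfolding tensor_eq_def by (rule cspan_congs)
lift_definition uminus_tensor :: "('a, 'b) tensor \<Rightarrow> ('a, 'b) tensor" is "uminus"
  unfolding tensor_eq_def by (rule cspan_congs)
lift_definition scaleC_tensor :: "complex \<Rightarrow> ('a, 'b) tensor \<Rightarrow> ('a, 'b) tensor" is "scaleC"
  unfolding tensor_eq_def by (rule cspan_congs)
instance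
  by standard (transfer; simp add: tensor_eq_def algebra_simps scaleC_add_left scaleC_add_right
      complex_vector.span_zero)+
end

lift_definition tensor_of :: "'a::complex_vector \<Rightarrow> 'b::complex_vector \<Rightarrow> ('a, 'b) tensor"
  (infix \<open>\<otimes>\<^sub>t\<close> 70) is "\<lambda>x y. Poly_Mapping.single (x, y) 1" .

definition cbilinear :: "('a::complex_vector \<Rightarrow> 'b::complex_vector \<Rightarrow> 'c::complex_vector) \<Rightarrow> bool"
  where "cbilinear f \<longleftrightarrow> (\<forall>x. clinear (f x)) \<and> (\<forall>y. clinear (\<lambda>x. f x y))"

definition tensor_lift ::
    "('a::complex_vector \<Rightarrow> 'b::complex_vector \<Rightarrow> 'c::complex_vector) \<Rightarrow> ('a, 'b) tensor \<Rightarrow> 'c"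
  where "tensor_lift f = (THE g. clinear g \<and> (\<forall>x y. g (x \<otimes>\<^sub>t y) = f x y))"

subsection \<open>Tensor powers and the tensor algebra\<close>

text \<open>
  \<open>'h tens\<close> is the direct sum of all tensor powers of \<open>'h\<close>: the space freely generated by the
  lists over \<open>'h\<close>, modulo multilinearity in each entry. The class of the list
  \<open>[h1, \<dots>, hn]\<close> is the pure tensor \<open>pure [h1, \<dots>, hn]\<close>.
\<close>

definition tens_rels :: "('h::complex_vector list \<Rightarrow>\<^sub>0 complex) set" where
  "tens_rels =
     {Poly_Mapping.single (xs @ (x + y) # ys) 1 - Poly_Mapping.single (xs @ x # ys) 1
        - Poly_Mapping.single (xs @ y # ys) 1 | xs x y ys. True}
   \<union> {Poly_Mapping.single (xs @ (c *\<^sub>C x) # ys) 1 - Poly_Mapping.single (xs @ x # ys) c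
        | xs c x ys. True}"

definition tens_eq :: "('h::complex_vector list \<Rightarrow>\<^sub>0 complex) \<Rightarrow> ('h list \<Rightarrow>\<^sub>0 complex) \<Rightarrow> bool"
  where "tens_eq p q \<longleftrightarrow> p - q \<in> cspan tens_rels"

quotient_type (overloaded) 'h tens = "'h::complex_vector list \<Rightarrow>\<^sub>0 complex" / tens_eq
  by (rule equivpI; unfold reflp_def symp_def transp_def tens_eq_def; blast intro: cspan_congs)

instantiation tens :: (complex_vector) complex_vector
begin
lift_definition zero_tens :: "'a tens" is 0 .
lift_definition plus_tens :: "'a tens \<Rightarrow> 'a tens \<Rightarrow> 'a tens" is "(+)"
  unfolding tens_eq_def by (rule cspan_congs)
lift_definition minus_tens :: "'a tens \<Rightarrow> 'a tens \<Rightarrow> 'a tens" is "(-)"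
  unfolding tens_eq_def by (rule cspan_congs)
lift_definition uminus_tens :: "'a tens \<Rightarrow> 'a tens" is "uminus"
  unfolding tens_eq_def by (rule cspan_congs)
lift_definition scaleC_tens :: "complex \<Rightarrow> 'a tens \<Rightarrow> 'a tens" is "scaleC"
  unfolding tens_eq_def by (rule cspan_congs)
instance
  by standard (transfer; simp add: tens_eq_def algebra_simps scaleC_add_left scaleC_add_right
      complex_vector.span_zero)+
end

lift_definition pure :: "'h::complex_vector list \<Rightarrow> 'h tens"
  is "\<lambda>xs. Poly_Mapping.single xs 1" .

definition multilinear :: "('h::complex_vector list \<Rightarrow> 'b::complex_vector) \<Rightarrow> bool" where
  "multilinear f \<longleftrightarrow> (\<forall>xs ys. clinear (\<lambda>x. f (xs @ x # ys)))"

definition tens_lift :: "('h::complex_vector list \<Rightarrow> 'b::complex_vector) \<Rightarrow> 'h tens \<Rightarrow> 'b"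
  where "tens_lift f = (THE g. clinear g \<and> (\<forall>xs. g (pure xs) = f xs))"

lemma single_scaleC: "c *\<^sub>C Poly_Mapping.single x (d::complex) = Poly_Mapping.single x (c * d)"
  by (rule poly_mapping_eqI) (auto simp: lookup_scaleC lookup_single when_def scaleC_complex_def)

lemma clinear_abs_tens: "clinear abs_tens"
  by (auto simp: clinear_iff plus_tens.abs_eq scaleC_tens.abs_eq)

lemma clinear_abs_tensor: "clinear abs_tensor"
  by (auto simp: clinear_iff plus_tensor.abs_eq scaleC_tensor.abs_eq)

lemma tens_span: "t \<in> cspan (range pure)"
proof (induction t rule: tens.abs_induct)
  fix p :: "'a list \<Rightarrow>\<^sub>0 complex"
  have "abs_tens p \<in> cspan (abs_tens ` range (\<lambda>x. Poly_Mapping.single x 1))"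
    using free_span [of p] complex_vector.linear_span_image [OF clinear_abs_tens] by blast
  then show "abs_tens p \<in> cspan (range pure)"
    by (simp add: image_image pure.abs_eq)
qed

lemma tensor_span: "t \<in> cspan {x \<otimes>\<^sub>t y | x y. True}"
proof (induction t rule: tensor.abs_induct)
  fix p :: "'a \<times> 'b \<Rightarrow>\<^sub>0 complex"
  have "abs_tensor p \<in> cspan (abs_tensor ` range (\<lambda>x. Poly_Mapping.single x 1))"
    using free_span [of p] complex_vector.linear_span_image [OF clinear_abs_tensor] by blast
  moreover have "abs_tensor ` range (\<lambda>x::'a \<times> 'b. Poly_Mapping.single x 1) = {x \<otimes>\<^sub>t y | x y. True}"
    by (auto simp: image_image tensor_of.abs_eq)
  ultimately show "abs_tensor p \<in> cspan {x \<otimes>\<^sub>t y | x y. True}" by simp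
qed

lemma tens_lift_exists:
  assumes "multilinear f"
  shows "\<exists>g. clinear g \<and> (\<forall>xs. g (pure xs) = f xs)"
proof -
  have van: "free_ext f p = 0" if "p \<in> cspan tens_rels" for p
    by (rule clinear_zero_on_span [OF clinear_free_ext _ that])
      (use assms in \<open>auto simp: tens_rels_def multilinear_def clinear_iff
          clinear_diff [OF clinear_free_ext]\<close>)
  define g where "g t = free_ext f (rep_tens t)" for t
  have g: "g (abs_tens p) = free_ext f p" for p
  proof -
    have "tens_eq (rep_tens (abs_tens p)) p"
      using Quotient_rep_abs [OF Quotient_tens] tens.abs_eq_iff Quotient_abs_rep [OF Quotient_tens]
      by metis
    then have "free_ext f (rep_tens (abs_tens p) - p) = 0"
      unfolding tens_eq_def by (rule van)
    then show ?thesis by (simp add: g_def clinear_diff [OF clinear_free_ext])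
  qed
  have "clinear g"
    unfolding clinear_iff
  proof (intro conjI allI)
    show "g (x + y) = g x + g y" for x y
      by (induction x rule: tens.abs_induct, induction y rule: tens.abs_induct)
        (simp add: g plus_tens.abs_eq clinear_add [OF clinear_free_ext])
    show "g (c *\<^sub>C x) = c *\<^sub>C g x" for c x
      by (induction x rule: tens.abs_induct)
        (simp add: g scaleC_tens.abs_eq clinear_scale [OF clinear_free_ext])
  qed
  moreover have "g (pure xs) = f xs" for xs
    by (simp add: pure.abs_eq g)
  ultimately show ?thesis by blast
qed

lemma tens_lift_ex1:
  assumes "multilinear f"
  shows "\<exists>!g. clinear g \<and> (\<forall>xs. g (pure xs) = f xs)"
proof -
  have "g = h" if "clinear g" "\<forall>xs. g (pure xs) = f xs" "clinear h" "\<forall>xs. h (pure xs) = f xs" for g h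
    by (rule ext, rule clinear_eq_on_span [OF that(1,3) _ tens_span]) (use that in auto)
  then show ?thesis using tens_lift_exists [OF assms] by blast
qed

lemma clinear_tens_lift: "multilinear f \<Longrightarrow> clinear (tens_lift f)"
  and tens_lift_pure: "multilinear f \<Longrightarrow> tens_lift f (pure xs) = f xs"
  using theI' [OF tens_lift_ex1] unfolding tens_lift_def by blast+

lemma tensor_lift_exists:
  assumes "cbilinear f"
  shows "\<exists>g. clinear g \<and> (\<forall>x y. g (x \<otimes>\<^sub>t y) = f x y)"
proof -
  let ?f = "\<lambda>z. f (fst z) (snd z)"
  have van: "free_ext ?f p = 0" if "p \<in> cspan tensor_rels" for p
    by (rule clinear_zero_on_span [OF clinear_free_ext _ that])
      (use assms in \<open>auto simp: tensor_rels_def cbilinear_def clinear_iff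
          clinear_diff [OF clinear_free_ext]\<close>)
  define g where "g t = free_ext ?f (rep_tensor t)" for t
  have g: "g (abs_tensor p) = free_ext ?f p" for p
  proof -
    have "tensor_eq (rep_tensor (abs_tensor p)) p"
      using tensor.abs_eq_iff Quotient_abs_rep [OF Quotient_tensor] by metis
    then have "free_ext ?f (rep_tensor (abs_tensor p) - p) = 0"
      unfolding tensor_eq_def by (rule van)
    then show ?thesis by (simp add: g_def clinear_diff [OF clinear_free_ext])
  qed
  have "clinear g"
    unfolding clinear_iff
  proof (intro conjI allI)
    show "g (x + y) = g x + g y" for x y
      by (induction x rule: tensor.abs_induct, induction y rule: tensor.abs_induct)
        (simp add: g plus_tensor.abs_eq clinear_add [OF clinear_free_ext])
    show "g (c *\<^sub>C x) = c *\<^sub>C g x" for c x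
      by (induction x rule: tensor.abs_induct)
        (simp add: g scaleC_tensor.abs_eq clinear_scale [OF clinear_free_ext])
  qed
  moreover have "g (x \<otimes>\<^sub>t y) = f x y" for x y
    by (simp add: tensor_of.abs_eq g)
  ultimately show ?thesis by blast
qed

lemma tensor_lift_ex1:
  assumes "cbilinear f"
  shows "\<exists>!g. clinear g \<and> (\<forall>x y. g (x \<otimes>\<^sub>t y) = f x y)"
proof -
  have "g = h" if "clinear g" "\<forall>x y. g (x \<otimes>\<^sub>t y) = f x y"
      "clinear h" "\<forall>x y. h (x \<otimes>\<^sub>t y) = f x y" for g h
    by (rule ext, rule clinear_eq_on_span [OF that(1,3) _ tensor_span]) (use that in auto)
  then show ?thesis using tensor_lift_exists [OF assms] by blast
qed

lemma clinear_tensor_lift: "cbilinear f \<Longrightarrow> clinear (tensor_lift f)"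
  and tensor_lift_tensor_of: "cbilinear f \<Longrightarrow> tensor_lift f (x \<otimes>\<^sub>t y) = f x y"
  using theI' [OF tensor_lift_ex1] unfolding tensor_lift_def by blast+

lemma multilinear_pure: "multilinear pure"
  unfolding multilinear_def clinear_iff
proof (intro allI conjI)
  fix xs ys :: "'a list" and x y :: 'a and c
  show "pure (xs @ (x + y) # ys) = pure (xs @ x # ys) + pure (xs @ y # ys)"
    unfolding pure.abs_eq plus_tens.abs_eq tens.abs_eq_iff tens_eq_def
    by (rule complex_vector.span_base) (force simp: tens_rels_def diff_diff_eq)
  show "pure (xs @ (c *\<^sub>C x) # ys) = c *\<^sub>C pure (xs @ x # ys)"
    unfolding pure.abs_eq scaleC_tens.abs_eq tens.abs_eq_iff tens_eq_def
    by (rule complex_vector.span_base) (force simp: tens_rels_def single_scaleC)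
qed

lemma cbilinear_tensor_of: "cbilinear (\<otimes>\<^sub>t)"
  unfolding cbilinear_def clinear_iff
proof (intro conjI allI)
  fix x x' :: 'a and y y' :: 'b and c
  note abs = tensor_of.abs_eq plus_tensor.abs_eq scaleC_tensor.abs_eq tensor.abs_eq_iff
    tensor_eq_def single_scaleC mult_1_right diff_diff_eq [symmetric]
  show "x \<otimes>\<^sub>t (y + y') = x \<otimes>\<^sub>t y + x \<otimes>\<^sub>t y'" unfolding abs
    by (rule complex_vector.span_base) (unfold tensor_rels_def, blast)
  show "(x + x') \<otimes>\<^sub>t y = x \<otimes>\<^sub>t y + x' \<otimes>\<^sub>t y" unfolding abs
    by (rule complex_vector.span_base) (unfold tensor_rels_def, blast)
  show "x \<otimes>\<^sub>t (c *\<^sub>C y) = c *\<^sub>C (x \<otimes>\<^sub>t y)" unfolding abs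
    by (rule complex_vector.span_base) (unfold tensor_rels_def, blast)
  show "(c *\<^sub>C x) \<otimes>\<^sub>t y = c *\<^sub>C (x \<otimes>\<^sub>t y)" unfolding abs
    by (rule complex_vector.span_base) (unfold tensor_rels_def, blast)
qed

lemma clinear_compose: "clinear f \<Longrightarrow> clinear g \<Longrightarrow> clinear (\<lambda>x. g (f x))"
  by (auto simp: clinear_iff)

lemma multilinear_concat_right: "multilinear (\<lambda>ys. pure (xs @ ys))"
  unfolding multilinear_def
proof (intro allI)
  show "clinear (\<lambda>x. pure (xs @ ys @ x # zs))" for ys zs
    using multilinear_pure [unfolded multilinear_def, rule_format, of "xs @ ys" zs] by simp
qed

lemma multilinear_concat_left: "multilinear (\<lambda>xs. tens_lift (\<lambda>ys. pure (xs @ ys)) t)"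
proof -
  let ?f = "\<lambda>xs. tens_lift (\<lambda>ys. pure (xs @ ys))"
  have lin: "clinear (?f xs)" and f_pure: "?f xs (pure ys) = pure (xs @ ys)" for xs ys :: "'a list"
    by (simp_all add: clinear_tens_lift tens_lift_pure multilinear_concat_right)
  have p: "pure (xs @ (x + y) # ys) = pure (xs @ x # ys) + pure (xs @ y # ys)"
    "pure (xs @ (c *\<^sub>C x) # ys) = c *\<^sub>C pure (xs @ x # ys)" for xs ys :: "'a list" and x y c
    using multilinear_pure unfolding multilinear_def clinear_iff by blast+
  have "?f (xs @ (x + y) # ys) t = ?f (xs @ x # ys) t + ?f (xs @ y # ys) t" for xs ys x y
  proof (rule clinear_eq_on_span [OF lin _ _ tens_span])
    show "clinear (\<lambda>t. ?f (xs @ x # ys) t + ?f (xs @ y # ys) t)"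
      by (intro complex_vector.linear_compose_add lin)
    show "?f (xs @ (x + y) # ys) b = ?f (xs @ x # ys) b + ?f (xs @ y # ys) b"
      if "b \<in> range pure" for b
    proof -
      from that obtain zs where b: "b = pure zs" by blast
      show ?thesis unfolding b f_pure by (simp only: append_assoc append_Cons p)
    qed
  qed
  moreover have "?f (xs @ (c *\<^sub>C x) # ys) t = c *\<^sub>C ?f (xs @ x # ys) t" for xs ys x c
  proof (rule clinear_eq_on_span [OF lin _ _ tens_span])
    show "clinear (\<lambda>t. c *\<^sub>C ?f (xs @ x # ys) t)"
      by (intro complex_vector.linear_compose_scale_right lin)
    show "?f (xs @ (c *\<^sub>C x) # ys) b = c *\<^sub>C ?f (xs @ x # ys) b" if "b \<in> range pure" for b
    proof -
      from that obtain zs where b: "b = pure zs" by blast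
      show ?thesis unfolding b f_pure by (simp only: append_assoc append_Cons p)
    qed
  qed
  ultimately show ?thesis unfolding multilinear_def clinear_iff by blast
qed

instantiation tens :: (complex_vector) "{times, one}"
begin
definition times_tens :: "'a tens \<Rightarrow> 'a tens \<Rightarrow> 'a tens"
  where "times_tens s t = tens_lift (\<lambda>xs. tens_lift (\<lambda>ys. pure (xs @ ys)) t) s"
definition one_tens :: "'a tens" where "one_tens = pure []"
instance ..
end

lemma pure_times: "pure xs * t = tens_lift (\<lambda>ys. pure (xs @ ys)) t"
  unfolding times_tens_def by (rule tens_lift_pure [OF multilinear_concat_left])

lemma pure_mult [simp]: "pure xs * pure ys = pure (xs @ ys)"
  unfolding pure_times by (rule tens_lift_pure [OF multilinear_concat_right])

lemma clinear_tens_mult_left: "clinear (\<lambda>s. s * t)" for t :: "'a::complex_vector tens"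
  unfolding times_tens_def by (rule clinear_tens_lift [OF multilinear_concat_left])

lemma clinear_tens_mult_right: "clinear ((*) s)" for s :: "'a::complex_vector tens"
proof -
  have "s * (t + t') = s * t + s * t'" for t t'
  proof (rule clinear_eq_on_span [OF _ _ _ tens_span, where f = "\<lambda>s. s * (t + t')"])
    show "clinear (\<lambda>s. s * t + s * t')"
      by (intro complex_vector.linear_compose_add clinear_tens_mult_left)
  qed (auto intro: clinear_tens_mult_left
      simp: pure_times clinear_add [OF clinear_tens_lift [OF multilinear_concat_right]])
  moreover have "s * (c *\<^sub>C t) = c *\<^sub>C (s * t)" for c t
  proof (rule clinear_eq_on_span [OF _ _ _ tens_span, where f = "\<lambda>s. s * (c *\<^sub>C t)"])
    show "clinear (\<lambda>s. c *\<^sub>C (s * t))"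
      by (intro complex_vector.linear_compose_scale_right clinear_tens_mult_left)
  qed (auto intro: clinear_tens_mult_left
      simp: pure_times clinear_scale [OF clinear_tens_lift [OF multilinear_concat_right]])
  ultimately show ?thesis unfolding clinear_iff by blast
qed

lemma tens_mult_assoc: "r * s * t = r * (s * t)" for r s t :: "'a::complex_vector tens"
proof -
  note L = clinear_tens_mult_left and R = clinear_tens_mult_right
  have 1: "pure xs * pure ys * t = pure xs * (pure ys * t)" for xs ys :: "'a list"
  proof (rule clinear_eq_on_span [OF R clinear_compose [OF R R] _ tens_span])
    fix b :: "'a tens" assume "b \<in> range pure"
    then obtain zs where "b = pure zs" by blast
    then show "pure xs * pure ys * b = pure xs * (pure ys * b)" by simp
  qed
  have 2: "pure xs * s * t = pure xs * (s * t)" for xs :: "'a list"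
  proof (rule clinear_eq_on_span [OF clinear_compose [OF R L] clinear_compose [OF L R] _ tens_span])
    fix b :: "'a tens" assume "b \<in> range pure"
    then obtain ys where "b = pure ys" by blast
    then show "pure xs * b * t = pure xs * (b * t)" by (simp only: 1)
  qed
  show ?thesis
  proof (rule clinear_eq_on_span [OF clinear_compose [OF L L] L _ tens_span])
    fix b :: "'a tens" assume "b \<in> range pure"
    then obtain xs where "b = pure xs" by blast
    then show "b * s * t = b * (s * t)" by (simp only: 2)
  qed
qed

instance tens :: (complex_vector) complex_algebra_1
proof
  fix a b c :: "'a tens" and k :: complex
  note L = clinear_tens_mult_left and R = clinear_tens_mult_right
  show "a * b * c = a * (b * c)" by (rule tens_mult_assoc)
  show "(a + b) * c = a * c + b * c" by (rule clinear_add [OF L])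
  show "a * (b + c) = a * b + a * c" by (rule clinear_add [OF R])
  show "(k *\<^sub>C a) * b = k *\<^sub>C (a * b)" by (rule clinear_scale [OF L])
  show "a * (k *\<^sub>C b) = k *\<^sub>C (a * b)" by (rule clinear_scale [OF R])
  have id: "clinear (\<lambda>x::'a tens. x)" by (simp add: clinear_iff)
  show "1 * a = a"
    by (rule clinear_eq_on_span [OF R id _ tens_span]) (auto simp: one_tens_def)
  show "a * 1 = a"
    by (rule clinear_eq_on_span [OF L id _ tens_span]) (auto simp: one_tens_def)
  let ?e = "\<lambda>xs::'a list. if xs = [] then 1 else (0::complex)"
  have m: "multilinear ?e" by (simp add: multilinear_def clinear_iff)
  have "tens_lift ?e 1 = 1" unfolding one_tens_def by (simp add: tens_lift_pure [OF m])
  then show "(0::'a tens) \<noteq> 1" using clinear_zero [OF clinear_tens_lift [OF m]] by auto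
qed

definition tpow :: "nat \<Rightarrow> 'h::complex_vector tens set"
  where "tpow n = cspan {pure xs | xs. length xs = n}"

typedef (overloaded) 'h tens_pos =
  "cspan {pure xs | xs. xs \<noteq> []} :: 'h::complex_vector tens set"
  by (rule exI [of _ 0]) (rule complex_vector.span_zero)

setup_lifting type_definition_tens_pos

lemma tens_pos_mult_closed:
  fixes s t :: "'h::complex_vector tens"
  assumes "s \<in> cspan {pure xs | xs. xs \<noteq> []}" "t \<in> cspan {pure xs | xs. xs \<noteq> []}"
  shows "s * t \<in> cspan {pure xs | xs. xs \<noteq> []}"
proof -
  let ?P = "{pure xs | xs. xs \<noteq> []} :: 'h tens set"
  have "pure xs * t \<in> cspan ?P" if "xs \<noteq> []" for xs :: "'h list"
    using assms(2)
  proof (induction rule: complex_vector.span_induct_alt)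
    case (step c x y)
    have "pure xs * x \<in> ?P" using step(1) that by force
    then have "c *\<^sub>C (pure xs * x) + pure xs * y \<in> cspan ?P"
      by (intro complex_vector.span_add complex_vector.span_scale complex_vector.span_base step(2))
    then show ?case by (simp only: distrib_left scaleC_mult_right)
  qed (simp add: complex_vector.span_zero)
  note pure_closed = this
  show ?thesis
    using assms(1)
  proof (induction rule: complex_vector.span_induct_alt)
    case (step c x y)
    have "x * t \<in> cspan ?P" using step(1) pure_closed by blast
    then have "c *\<^sub>C (x * t) + y * t \<in> cspan ?P"
      by (intro complex_vector.span_add complex_vector.span_scale step(2))
    then show ?case by (simp only: distrib_right scaleC_mult_left)
  qed (simp add: complex_vector.span_zero)
qed

instantiation tens_pos :: (complex_vector) complex_algebra
begin
lift_definition zero_tens_pos :: "'a tens_pos" is 0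
  by (rule complex_vector.span_zero)
lift_definition plus_tens_pos :: "'a tens_pos \<Rightarrow> 'a tens_pos \<Rightarrow> 'a tens_pos" is "(+)"
  by (rule complex_vector.span_add)
lift_definition minus_tens_pos :: "'a tens_pos \<Rightarrow> 'a tens_pos \<Rightarrow> 'a tens_pos" is "(-)"
  by (rule complex_vector.span_diff)
lift_definition uminus_tens_pos :: "'a tens_pos \<Rightarrow> 'a tens_pos" is "uminus"
  by (rule complex_vector.span_neg)
lift_definition scaleC_tens_pos :: "complex \<Rightarrow> 'a tens_pos \<Rightarrow> 'a tens_pos" is "scaleC"
  by (rule complex_vector.span_scale)
lift_definition times_tens_pos :: "'a tens_pos \<Rightarrow> 'a tens_pos \<Rightarrow> 'a tens_pos" is "(*)"
  by (rule tens_pos_mult_closed)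
instance
  by standard (transfer; simp add: algebra_simps scaleC_add_left scaleC_add_right)+
end

section \<open>Hopf algebras\<close>

text \<open>
  The tensor square is the degree 2 part of \<open>'h tens\<close>; \<open>lift2 f\<close> is the linear map on it
  induced by a bilinear map \<open>f\<close>, and \<open>sweedler H f h\<close> is the sum of \<open>f h0 h1\<close> over
  the coproduct of \<open>h\<close>.
\<close>

definition lift2 ::
    "('h::complex_vector \<Rightarrow> 'h \<Rightarrow> 'b::complex_vector) \<Rightarrow> 'h tens \<Rightarrow> 'b"
  where "lift2 f = tens_lift (\<lambda>xs. case xs of [a, b] \<Rightarrow> f a b | _ \<Rightarrow> 0)"

definition tens2_mult :: "'h::complex_algebra tens \<Rightarrow> 'h tens \<Rightarrow> 'h tens"
  where "tens2_mult s t = lift2 (\<lambda>a b. lift2 (\<lambda>c d. pure [a * c, b * d]) t) s"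

record (overloaded) 'h hopf =
  comult :: "'h \<Rightarrow> 'h tens"
  counit :: "'h \<Rightarrow> complex"
  antipode :: "'h \<Rightarrow> 'h"

definition sweedler ::
    "'h::complex_vector hopf \<Rightarrow> ('h \<Rightarrow> 'h \<Rightarrow> 'b::complex_vector) \<Rightarrow> 'h \<Rightarrow> 'b"
  where "sweedler H f h = lift2 f (comult H h)"

locale hopf_algebra =
  fixes H :: "'h::complex_algebra_1 hopf"
  assumes comult_linear: "clinear (comult H)"
    and comult_tensor: "comult H h \<in> tpow 2"
    and counit_linear: "clinear (counit H)"
    and antipode_linear: "clinear (antipode H)"
    and coassoc: "sweedler H (\<lambda>a b. comult H a * pure [b]) h
                = sweedler H (\<lambda>a b. pure [a] * comult H b) h"
    and counit_left: "sweedler H (\<lambda>a b. counit H a *\<^sub>C b) h = h"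
    and counit_right: "sweedler H (\<lambda>a b. counit H b *\<^sub>C a) h = h"
    and comult_one: "comult H 1 = pure [1, 1]"
    and comult_mult: "comult H (h * k) = tens2_mult (comult H h) (comult H k)"
    and counit_one: "counit H 1 = 1"
    and counit_mult: "counit H (h * k) = counit H h * counit H k"
    and antipode_left: "sweedler H (\<lambda>a b. antipode H a * b) h = counit H h *\<^sub>C 1"
    and antipode_right: "sweedler H (\<lambda>a b. a * antipode H b) h = counit H h *\<^sub>C 1"

definition character :: "('h::complex_algebra \<Rightarrow> complex) \<Rightarrow> bool" where
  "character \<delta> \<longleftrightarrow> clinear \<delta> \<and> (\<forall>x y. \<delta> (x * y) = \<delta> x * \<delta> y) \<and> (\<exists>x. \<delta> x \<noteq> 0)"

definition twisted_antipode ::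
    "'h::complex_algebra_1 hopf \<Rightarrow> ('h \<Rightarrow> complex) \<Rightarrow> 'h \<Rightarrow> 'h"
  where "twisted_antipode H \<delta> h = sweedler H (\<lambda>a b. \<delta> a *\<^sub>C antipode H b) h"

text \<open>The diagonal action on tensor powers; on the degree 0 part it is through the counit.\<close>

primrec diag_pure :: "'h::complex_algebra_1 hopf \<Rightarrow> 'h list \<Rightarrow> 'h \<Rightarrow> 'h tens" where
  "diag_pure H [] h = counit H h *\<^sub>C 1"
| "diag_pure H (x # xs) h = sweedler H (\<lambda>a b. pure [a * x] * diag_pure H xs b) h"

definition diag_act :: "'h::complex_algebra_1 hopf \<Rightarrow> 'h \<Rightarrow> 'h tens \<Rightarrow> 'h tens"
  where "diag_act H h = tens_lift (\<lambda>xs. diag_pure H xs h)"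

section \<open>Complexes and bicomplexes\<close>

text \<open>
  Vector spaces with an explicit carrier, so that subspaces and quotients (whose elements are
  cosets) are objects of the same kind.
\<close>

record 'v cspace =
  carrier :: "'v set"
  vzero :: 'v
  vadd :: "'v \<Rightarrow> 'v \<Rightarrow> 'v"
  vscale :: "complex \<Rightarrow> 'v \<Rightarrow> 'v"

definition sub_space :: "'v::complex_vector set \<Rightarrow> 'v cspace"
  where "sub_space V = \<lparr>carrier = V, vzero = 0, vadd = (+), vscale = scaleC\<rparr>"

definition coset :: "'v::complex_vector set \<Rightarrow> 'v \<Rightarrow> 'v set"
  where "coset W x = (\<lambda>w. x + w) ` W"

text \<open>
  For subspaces \<open>V\<close>, \<open>W\<close> of a common space: the image of \<open>V\<close> in the quotient by \<open>W\<close>.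
  It will be used for the degree \<open>n\<close> part \<open>V\<close> of a graded space.
\<close>

definition quot_space :: "'v::complex_vector set \<Rightarrow> 'v set \<Rightarrow> 'v set cspace" where
  "quot_space V W = \<lparr>carrier = coset W ` V, vzero = W,
     vadd = (\<lambda>A B. {a + b | a b. a \<in> A \<and> b \<in> B}),
     vscale = (\<lambda>c A. {c *\<^sub>C a + w | a w. a \<in> A \<and> w \<in> W})\<rparr>"

definition quot_map :: "'w::complex_vector set \<Rightarrow> ('v \<Rightarrow> 'w) \<Rightarrow> 'v set \<Rightarrow> 'w set"
  where "quot_map W f A = {f a + w | a w. a \<in> A \<and> w \<in> W}"

definition lin_map :: "'v cspace \<Rightarrow> 'w cspace \<Rightarrow> ('v \<Rightarrow> 'w) \<Rightarrow> bool" where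
  "lin_map V W f \<longleftrightarrow>
     (\<forall>x\<in>carrier V. f x \<in> carrier W) \<and>
     (\<forall>x\<in>carrier V. \<forall>y\<in>carrier V. f (vadd V x y) = vadd W (f x) (f y)) \<and>
     (\<forall>c. \<forall>x\<in>carrier V. f (vscale V c x) = vscale W c (f x))"

definition lin_iso :: "'v cspace \<Rightarrow> 'w cspace \<Rightarrow> ('v \<Rightarrow> 'w) \<Rightarrow> bool"
  where "lin_iso V W f \<longleftrightarrow> lin_map V W f \<and> bij_betw f (carrier V) (carrier W)"

record 'v cochains =
  obj :: "nat \<Rightarrow> 'v cspace"
  dif :: "nat \<Rightarrow> 'v \<Rightarrow> 'v"

definition cochain_complex :: "'v cochains \<Rightarrow> bool" where
  "cochain_complex K \<longleftrightarrow>
     (\<forall>n. lin_map (obj K n) (obj K (Suc n)) (dif K n)) \<and>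
     (\<forall>n. \<forall>x\<in>carrier (obj K n). dif K (Suc n) (dif K n x) = vzero (obj K (Suc (Suc n))))"

definition cochain_iso :: "'v cochains \<Rightarrow> 'w cochains \<Rightarrow> (nat \<Rightarrow> 'v \<Rightarrow> 'w) \<Rightarrow> bool" where
  "cochain_iso K L f \<longleftrightarrow>
     (\<forall>n. lin_iso (obj K n) (obj L n) (f n)) \<and>
     (\<forall>n. \<forall>x\<in>carrier (obj K n). f (Suc n) (dif K n x) = dif L n (f n x))"

definition isomorphic_complexes :: "'v cochains \<Rightarrow> 'w cochains \<Rightarrow> bool" where
  "isomorphic_complexes K L \<longleftrightarrow>
     cochain_complex K \<and> cochain_complex L \<and> (\<exists>f. cochain_iso K L f)"

definition shift :: "'v cochains \<Rightarrow> 'v cochains"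
  where "shift K = \<lparr>obj = (\<lambda>n. obj K (Suc n)), dif = (\<lambda>n. dif K (Suc n))\<rparr>"

text \<open>
  A super-complex of complexes: two columns and degree-preserving horizontal maps between them in
  both directions. It encodes the 2-periodic bicomplex in which the columns \<open>col0\<close>, \<open>col1\<close>
  alternate indefinitely; squares anticommute.
\<close>

record ('v, 'w) supercx =
  col0 :: "'v cochains"
  col1 :: "'w cochains"
  hor01 :: "nat \<Rightarrow> 'v \<Rightarrow> 'w"
  hor10 :: "nat \<Rightarrow> 'w \<Rightarrow> 'v"

definition super_complex :: "('v, 'w) supercx \<Rightarrow> bool" where
  "super_complex X \<longleftrightarrow>
     cochain_complex (col0 X) \<and> cochain_complex (col1 X) \<and>
     (\<forall>n. lin_map (obj (col0 X) n) (obj (col1 X) n) (hor01 X n)) \<and>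
     (\<forall>n. lin_map (obj (col1 X) n) (obj (col0 X) n) (hor10 X n)) \<and>
     (\<forall>n. \<forall>x\<in>carrier (obj (col0 X) n). hor10 X n (hor01 X n x) = vzero (obj (col0 X) n)) \<and>
     (\<forall>n. \<forall>y\<in>carrier (obj (col1 X) n). hor01 X n (hor10 X n y) = vzero (obj (col1 X) n)) \<and>
     (\<forall>n. \<forall>x\<in>carrier (obj (col0 X) n).
        vadd (obj (col1 X) (Suc n)) (hor01 X (Suc n) (dif (col0 X) n x)) (dif (col1 X) n (hor01 X n x))
          = vzero (obj (col1 X) (Suc n))) \<and>
     (\<forall>n. \<forall>y\<in>carrier (obj (col1 X) n).
        vadd (obj (col0 X) (Suc n)) (hor10 X (Suc n) (dif (col1 X) n y)) (dif (col0 X) n (hor10 X n y))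
          = vzero (obj (col0 X) (Suc n)))"

definition isomorphic_super :: "('v, 'w) supercx \<Rightarrow> ('v2, 'w2) supercx \<Rightarrow> bool" where
  "isomorphic_super X Y \<longleftrightarrow> super_complex X \<and> super_complex Y \<and>
     (\<exists>f g. cochain_iso (col0 X) (col0 Y) f \<and> cochain_iso (col1 X) (col1 Y) g \<and>
        (\<forall>n. \<forall>x\<in>carrier (obj (col0 X) n). g n (hor01 X n x) = hor01 Y n (f n x)) \<and>
        (\<forall>n. \<forall>y\<in>carrier (obj (col1 X) n). f n (hor10 X n y) = hor10 Y n (g n y)))"

definition shift_super :: "('v, 'w) supercx \<Rightarrow> ('v, 'w) supercx" where
  "shift_super X = \<lparr>col0 = shift (col0 X), col1 = shift (col1 X),
     hor01 = (\<lambda>n. hor01 X (Suc n)), hor10 = (\<lambda>n. hor10 X (Suc n))\<rparr>"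

section \<open>The cyclic complex and bicomplex of a cocyclic module\<close>

record 'v cocyclic =
  cdeg :: "nat \<Rightarrow> 'v set"
  coface :: "nat \<Rightarrow> nat \<Rightarrow> 'v \<Rightarrow> 'v"  \<comment> \<open>\<open>coface C n i\<close> maps degree \<open>n\<close> to degree \<open>n + 1\<close>\<close>
  codegen :: "nat \<Rightarrow> nat \<Rightarrow> 'v \<Rightarrow> 'v"  \<comment> \<open>\<open>codegen C n i\<close> maps degree \<open>n + 1\<close> to degree \<open>n\<close>\<close>
  cyc :: "nat \<Rightarrow> 'v \<Rightarrow> 'v"

definition cyc_b :: "'v::complex_vector cocyclic \<Rightarrow> nat \<Rightarrow> 'v \<Rightarrow> 'v"
  where "cyc_b C n x = (\<Sum>i\<le>n+1. (- 1) ^ i *\<^sub>C coface C n i x)"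

definition cyc_b' :: "'v::complex_vector cocyclic \<Rightarrow> nat \<Rightarrow> 'v \<Rightarrow> 'v"
  where "cyc_b' C n x = (\<Sum>i\<le>n. (- 1) ^ i *\<^sub>C coface C n i x)"

definition cyc_lambda :: "'v::complex_vector cocyclic \<Rightarrow> nat \<Rightarrow> 'v \<Rightarrow> 'v"
  where "cyc_lambda C n x = (- 1) ^ n *\<^sub>C cyc C n x"

definition cyc_N :: "'v::complex_vector cocyclic \<Rightarrow> nat \<Rightarrow> 'v \<Rightarrow> 'v"
  where "cyc_N C n x = (\<Sum>i\<le>n. (cyc_lambda C n ^^ i) x)"

definition cyclic_complex :: "'v::complex_vector cocyclic \<Rightarrow> 'v cochains" where
  "cyclic_complex C =
     \<lparr>obj = (\<lambda>n. sub_space {x \<in> cdeg C n. x - cyc_lambda C n x = 0}), dif = cyc_b C\<rparr>"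

definition cyclic_bicomplex :: "'v::complex_vector cocyclic \<Rightarrow> ('v, 'v) supercx" where
  "cyclic_bicomplex C =
     \<lparr>col0 = \<lparr>obj = (\<lambda>n. sub_space (cdeg C n)), dif = (\<lambda>n x. - cyc_b' C n x)\<rparr>,
      col1 = \<lparr>obj = (\<lambda>n. sub_space (cdeg C n)), dif = cyc_b C\<rparr>,
      hor01 = cyc_N C,
      hor10 = (\<lambda>n x. x - cyc_lambda C n x)\<rparr>"

text \<open>The functions below give the values on pure tensors; on the degree 0 part, the ground field,
  the cyclic operator is the identity.\<close>

definition hopf_coface ::
    "'h::complex_algebra_1 hopf \<Rightarrow> nat \<Rightarrow> nat \<Rightarrow> 'h list \<Rightarrow> 'h tens" where
  "hopf_coface H n i xs =
     (if length xs \<noteq> n then 0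
      else if i = 0 then pure (1 # xs)
      else if i \<le> n then pure (take (i - 1) xs) * comult H (xs ! (i - 1)) * pure (drop i xs)
      else pure (xs @ [1]))"

definition hopf_codegen ::
    "'h::complex_algebra_1 hopf \<Rightarrow> nat \<Rightarrow> nat \<Rightarrow> 'h list \<Rightarrow> 'h tens" where
  "hopf_codegen H n i xs =
     (if length xs \<noteq> Suc n \<or> i > n then 0
      else counit H (xs ! i) *\<^sub>C pure (take i xs @ drop (Suc i) xs))"

definition hopf_cyc ::
    "'h::complex_algebra_1 hopf \<Rightarrow> ('h \<Rightarrow> complex) \<Rightarrow> nat \<Rightarrow> 'h list \<Rightarrow> 'h tens" where
  "hopf_cyc H \<delta> n xs =
     (if length xs \<noteq> n then 0
      else case xs of [] \<Rightarrow> 1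
         | x # ys \<Rightarrow> diag_act H (twisted_antipode H \<delta> x) (pure (ys @ [1])))"

definition hopf_cocyclic ::
    "'h::complex_algebra_1 hopf \<Rightarrow> ('h \<Rightarrow> complex) \<Rightarrow> 'h tens cocyclic" where
  "hopf_cocyclic H \<delta> =
     \<lparr>cdeg = tpow,
      coface = (\<lambda>n i. tens_lift (hopf_coface H n i)),
      codegen = (\<lambda>n i. tens_lift (hopf_codegen H n i)),
      cyc = (\<lambda>n. tens_lift (hopf_cyc H \<delta> n))\<rparr>"

section \<open>Localized complexes of a DG algebra with an action\<close>

text \<open>
  A DG algebra on the (possibly non-unital) algebra \<open>'r\<close> with an \<open>'h\<close>-action. The algebra is
  the sum of its homogeneous parts \<open>grade R n\<close>.
\<close>

record ('h, 'r) dga =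
  grade :: "nat \<Rightarrow> 'r set"
  ddif :: "'r \<Rightarrow> 'r"
  act :: "'h \<Rightarrow> 'r \<Rightarrow> 'r"

definition coinv :: "('h \<Rightarrow> complex) \<Rightarrow> ('h \<Rightarrow> 'v \<Rightarrow> 'v) \<Rightarrow> 'v::complex_vector set"
  where "coinv \<delta> a = {a h v - \<delta> h *\<^sub>C v | h v. True}"

definition graded_comms :: "('h, 'r::complex_algebra) dga \<Rightarrow> 'r set" where
  "graded_comms R =
     {x * y - (- 1) ^ (p * q) *\<^sub>C (y * x) | x y p q. x \<in> grade R p \<and> y \<in> grade R q}"

definition natural_complex ::
    "('h \<Rightarrow> complex) \<Rightarrow> ('h, 'r::complex_algebra) dga \<Rightarrow> 'r set cochains" where
  "natural_complex \<delta> R = (let W = cspan (graded_comms R \<union> coinv \<delta> (act R)) in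
     \<lparr>obj = (\<lambda>n. quot_space (grade R n) W), dif = (\<lambda>n. quot_map W (ddif R))\<rparr>)"

subsection \<open>Non-commutative 1-forms\<close>

text \<open>
  The algebra with a unit adjoined is \<open>complex \<times> 'r\<close>, and \<open>x \<otimes>\<^sub>t y\<close> stands for the
  1-form \<open>x dy\<close>.
\<close>

type_synonym 'r omega1 = "(complex \<times> 'r, 'r) tensor"

definition ugrade :: "('h, 'r::complex_algebra) dga \<Rightarrow> nat \<Rightarrow> (complex \<times> 'r) set"
  where "ugrade R p = {(c, x). x \<in> grade R p \<and> (p \<noteq> 0 \<longrightarrow> c = 0)}"

definition umult_left :: "'r::complex_algebra \<Rightarrow> complex \<times> 'r \<Rightarrow> 'r"
  where "umult_left r x = fst x *\<^sub>C r + r * snd x"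

definition umult_right :: "complex \<times> 'r \<Rightarrow> 'r::complex_algebra \<Rightarrow> 'r"
  where "umult_right x r = fst x *\<^sub>C r + snd x * r"

definition omega_grade :: "('h, 'r::complex_algebra) dga \<Rightarrow> nat \<Rightarrow> 'r omega1 set" where
  "omega_grade R n =
     cspan {x \<otimes>\<^sub>t y | x y p q. x \<in> ugrade R p \<and> y \<in> grade R q \<and> p + q = n}"

text \<open>The bimodule structure: \<open>r (x dy) = (r x) dy\<close> and \<open>(x dy) r = x d(y r) - (x y) dr\<close>.\<close>

definition omega_left :: "'r::complex_algebra \<Rightarrow> 'r omega1 \<Rightarrow> 'r omega1"
  where "omega_left r = tensor_lift (\<lambda>x y. (0, umult_left r x) \<otimes>\<^sub>t y)"

definition omega_right :: "'r::complex_algebra omega1 \<Rightarrow> 'r \<Rightarrow> 'r omega1"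
  where "omega_right \<omega> r =
     tensor_lift (\<lambda>x y. x \<otimes>\<^sub>t (y * r) - (0, umult_right x y) \<otimes>\<^sub>t r) \<omega>"

definition omega_comms :: "('h, 'r::complex_algebra) dga \<Rightarrow> 'r omega1 set" where
  "omega_comms R =
     {omega_right \<omega> r - (- 1) ^ (p * q) *\<^sub>C omega_left r \<omega>
        | \<omega> r p q. \<omega> \<in> omega_grade R p \<and> r \<in> grade R q}"

definition uact ::
    "'h::complex_algebra_1 hopf \<Rightarrow> ('h, 'r::complex_algebra) dga \<Rightarrow> 'h \<Rightarrow> complex \<times> 'r \<Rightarrow> complex \<times> 'r"
  where "uact H R h x = (counit H h * fst x, act R h (snd x))"

definition omega_act ::
    "'h::complex_algebra_1 hopf \<Rightarrow> ('h, 'r::complex_algebra) dga \<Rightarrow> 'h \<Rightarrow> 'r omega1 \<Rightarrow> 'r omega1"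
  where "omega_act H R h = tensor_lift (\<lambda>x y. sweedler H (\<lambda>a b. uact H R a x \<otimes>\<^sub>t act R b y) h)"

text \<open>The induced differential, \<open>x dy \<mapsto> (\<partial>x) dy + (-1)^p x d(\<partial>y)\<close> for \<open>x\<close> of degree \<open>p\<close>.\<close>

definition omega_dif :: "('h, 'r::complex_algebra) dga \<Rightarrow> 'r omega1 \<Rightarrow> 'r omega1" where
  "omega_dif R = (THE D. clinear D \<and>
     (\<forall>p. \<forall>x\<in>ugrade R p. \<forall>y.
        D (x \<otimes>\<^sub>t y) = (0, ddif R (snd x)) \<otimes>\<^sub>t y + (- 1) ^ p *\<^sub>C (x \<otimes>\<^sub>t ddif R y)))"

definition omega_d :: "'r::complex_algebra \<Rightarrow> 'r omega1"
  where "omega_d x = (1, 0) \<otimes>\<^sub>t x"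

text \<open>\<open>b (x dy) = [x, y]\<close>, the graded commutator; the adjoined unit is of degree 0.\<close>

definition omega_b :: "('h, 'r::complex_algebra) dga \<Rightarrow> 'r omega1 \<Rightarrow> 'r" where
  "omega_b R = (THE B. clinear B \<and>
     (\<forall>p q. \<forall>x\<in>ugrade R p. \<forall>y\<in>grade R q.
        B (x \<otimes>\<^sub>t y) = umult_right x y - (- 1) ^ (p * q) *\<^sub>C umult_left y x))"

definition X_complex ::
    "'h::complex_algebra_1 hopf \<Rightarrow> ('h \<Rightarrow> complex) \<Rightarrow> ('h, 'r::complex_algebra) dga
       \<Rightarrow> ('r set, 'r omega1 set) supercx" where
  "X_complex H \<delta> R =
     (let W0 = cspan (coinv \<delta> (act R));
          W1 = cspan (omega_comms R \<union> coinv \<delta> (omega_act H R)) in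
      \<lparr>col0 = \<lparr>obj = (\<lambda>n. quot_space (grade R n) W0), dif = (\<lambda>n. quot_map W0 (\<lambda>x. - ddif R x))\<rparr>,
       col1 = \<lparr>obj = (\<lambda>n. quot_space (omega_grade R n) W1), dif = (\<lambda>n. quot_map W1 (omega_dif R))\<rparr>,
       hor01 = (\<lambda>n. quot_map W1 omega_d),
       hor10 = (\<lambda>n. quot_map W0 (omega_b R))\<rparr>)"

subsection \<open>The DG tensor algebra of a Hopf algebra\<close>

text \<open>The odd derivation extending the coproduct, with its Koszul signs:
  it sends \<open>h0 \<otimes> \<dots> \<otimes> hn\<close> to the sum of
  \<open>(-1)^i h0 \<otimes> \<dots> \<otimes> \<Delta> hi \<otimes> \<dots> \<otimes> hn\<close>.\<close>

definition tens_dif :: "'h::complex_algebra_1 hopf \<Rightarrow> 'h tens \<Rightarrow> 'h tens" where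
  "tens_dif H = tens_lift (\<lambda>xs. \<Sum>i<length xs.
     (- 1) ^ i *\<^sub>C (pure (take i xs) * comult H (xs ! i) * pure (drop (Suc i) xs)))"

definition tensor_dga :: "'h::complex_algebra_1 hopf \<Rightarrow> ('h, 'h tens_pos) dga" where
  "tensor_dga H =
     \<lparr>grade = (\<lambda>n. {x. Rep_tens_pos x \<in> tpow n}),
      ddif = (\<lambda>x. Abs_tens_pos (tens_dif H (Rep_tens_pos x))),
      act = (\<lambda>h x. Abs_tens_pos (diag_act H h (Rep_tens_pos x)))\<rparr>"

end

theory Submission
  imports Defs
begin

text \<open>
  In degree \<open>n + 1\<close> the map \<open>h\<^sub>0 \<otimes> y \<mapsto> S\<^sub>\<delta>(h\<^sub>0) y\<close> identifies the coinvariants of the tensor algebra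
  with the \<open>n\<close>-th tensor power.  It carries the derivation to \<open>b'\<close> and, because \<open>S\<^sub>\<delta>\<close> is an
  involution, cyclic permutation of factors to the cyclic operator, so that graded commutators
  become the image of \<open>1 - \<lambda>\<close>; averaging over \<open>\<lambda>\<close> identifies the cokernel of \<open>1 - \<lambda>\<close> with its kernel.

  Modulo commutators and coinvariants every one-form is \<open>\<plusminus> z d1\<close>, where \<open>1\<close> is the unit of the Hopf
  algebra.  In this description \<open>d\<close> becomes \<open>N\<close> but \<open>b(x dy) = [x, y]\<close> becomes \<open>- (1 - \<lambda>)\<close>.  No natural
  choice of signs removes the minus sign in a 2-periodic bicomplex; the isomorphism is therefore
  corrected by an automorphism of the columns obtained from a splitting of the cyclic complex
  over the field.
\<close>

section \<open>Linear maps on graded spaces\<close>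

text \<open>Why signs alone fail: signs that commute with non-zero vertical maps are constant along
  each column; then \<open>N\<close> forces the two columns to carry the same sign, and
  \<open>- (1 - \<lambda>)\<close> forces opposite ones.

  The correction is therefore sought as a pair of maps \<open>1 - 2 P\<close> on the
  \<open>b'\<close>-column and \<open>1 - 2 Q\<close> on the \<open>b\<close>-column. Compatibility
  with \<open>N\<close> makes \<open>P\<close> and \<open>Q\<close> induce one idempotent
  \<open>p\<close> of the invariant complex, and the sign change becomes
  \<open>P M + M Q = M\<close> with \<open>M = 1 - L\<close>. The \<open>b'\<close>-column is
  contractible, so \<open>p\<close> lifts to an idempotent \<open>P\<close>, and \<open>P\<close>
  yields a first candidate for \<open>Q\<close>. Its failure to commute with \<open>b\<close> can be
  removed exactly when \<open>S - p S - S p\<close> vanishes on cohomology, \<open>S\<close> being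
  the periodicity operator. This determines in which degrees \<open>p\<close> has to be the identity
  on cohomology and in which zero.

  The relations among one-forms are hard to test directly. A linear invariant counting rotations of
  words detects them; it also turns the compatibility of \<open>d\<close> with the differentials
  into the identity \<open>b N = N b'\<close>.\<close>

abbreviation csubspace :: "'a::complex_vector set \<Rightarrow> bool"
  where "csubspace \<equiv> module.subspace scaleC"

lemmas scaleC_diff_right = complex_vector.scale_right_diff_distrib
lemmas subspace_cspan = complex_vector.subspace_span
lemmas cspan_base = complex_vector.span_base

lemma clinearI:
  assumes "\<And>x y. f (x + y) = f x + f y" "\<And>c x. f (c *\<^sub>C x) = c *\<^sub>C f x"
  shows "clinear f"
  using assms by (simp add: clinear_iff)

lemma clinear_sum: "clinear f \<Longrightarrow> f (\<Sum>i\<in>S. g i) = (\<Sum>i\<in>S. f (g i))"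
  by (rule complex_vector.linear_sum)

lemma clinear_uminus: "clinear f \<Longrightarrow> f (- x) = - f x"
  by (rule complex_vector.linear_neg)

lemmas clinearD = clinear_add clinear_scale clinear_diff clinear_zero clinear_uminus clinear_sum

lemma clinear_id: "clinear (\<lambda>x. x)"
  and clinear_const_0: "clinear (\<lambda>x. 0)"
  and clinear_add_fun: "clinear f \<Longrightarrow> clinear g \<Longrightarrow> clinear (\<lambda>x. f x + g x)"
  and clinear_diff_fun: "clinear f \<Longrightarrow> clinear g \<Longrightarrow> clinear (\<lambda>x. f x - g x)"
  and clinear_uminus_fun: "clinear f \<Longrightarrow> clinear (\<lambda>x. - f x)"
  and clinear_scale_fun: "clinear f \<Longrightarrow> clinear (\<lambda>x. c *\<^sub>C f x)"
  by (simp_all add: clinear_iff algebra_simps scaleC_add_right mult.commute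
      scaleC_diff_right)

lemma clinear_sum_fun: "(\<And>i. i \<in> S \<Longrightarrow> clinear (f i)) \<Longrightarrow> clinear (\<lambda>x. \<Sum>i\<in>S. f i x)"
  by (rule complex_vector.linear_compose_sum) blast

lemma clinear_tens_mult_left_fun:
    "clinear f \<Longrightarrow> clinear (\<lambda>x. f x * (t::'a::complex_vector tens))"
  and clinear_tens_mult_right_fun:
    "clinear f \<Longrightarrow> clinear (\<lambda>x. (t::'a::complex_vector tens) * f x)"
  by (simp_all add: clinear_iff algebra_simps)

lemmas clinear_intros = clinear_id clinear_const_0 clinear_add_fun clinear_diff_fun
  clinear_uminus_fun clinear_scale_fun clinear_sum_fun clinear_tens_mult_left_fun clinear_tens_mult_right_fun

lemma clinear_funpow: "clinear f \<Longrightarrow> clinear (f ^^ k)" for f :: "'a::complex_vector \<Rightarrow> 'a"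
  by (induction k) (auto simp: clinear_iff)

lemma span_image_subset:
  assumes "clinear f" "\<And>x. x \<in> S \<Longrightarrow> f x \<in> cspan W" "x \<in> cspan S"
  shows "f x \<in> cspan W"
proof -
  have "f x \<in> f ` cspan S" using assms(3) by blast
  also have "\<dots> = cspan (f ` S)" by (rule complex_vector.linear_span_image [OF assms(1), symmetric])
  also have "\<dots> \<subseteq> cspan W"
    by (rule complex_vector.span_minimal) (use assms(2) in \<open>auto simp: subspace_cspan\<close>)
  finally show ?thesis .
qed

lemma linear_span_mem:
  assumes "clinear f" "csubspace V" "\<And>x. x \<in> S \<Longrightarrow> f x \<in> V" "x \<in> cspan S"
  shows "f x \<in> V"
proof -
  have "f x \<in> cspan V"
    by (rule span_image_subset [OF assms(1) _ assms(4)])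
      (use assms(3) in \<open>auto intro: cspan_base\<close>)
  then show ?thesis by (metis assms(2) complex_vector.span_eq_iff)
qed

lemma scaleC_minus_one [simp]: "(- 1) *\<^sub>C x = - x"
  by (metis complex_vector.scale_minus_left scaleC_one)

subsection \<open>Homogeneous parts of the tensor algebra\<close>

lemma subspace_tpow: "csubspace (tpow n)"
  unfolding tpow_def by (rule subspace_cspan)

lemmas tpow_closed = complex_vector.subspace_0 [OF subspace_tpow]
  complex_vector.subspace_add [OF subspace_tpow] complex_vector.subspace_diff [OF subspace_tpow]
  complex_vector.subspace_neg [OF subspace_tpow] complex_vector.subspace_scale [OF subspace_tpow]
  complex_vector.subspace_sum [OF subspace_tpow]

lemma pure_tpow: "length xs = n \<Longrightarrow> pure xs \<in> tpow n"
  unfolding tpow_def by (rule cspan_base) blast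

lemma tpow_linear_eq:
  assumes "clinear f" "clinear g" "\<And>xs. length xs = n \<Longrightarrow> f (pure xs) = g (pure xs)" "x \<in> tpow n"
  shows "f x = g x"
  by (rule clinear_eq_on_span [OF assms(1,2) _ assms(4) [unfolded tpow_def]]) (use assms(3) in blast)

lemma tens_linear_eq:
  assumes "clinear f" "clinear g" "\<And>xs. f (pure xs) = g (pure xs)"
  shows "f x = g x"
  by (rule clinear_eq_on_span [OF assms(1,2) _ tens_span]) (use assms(3) in blast)

lemma tens_linear_eq_tpow:
  assumes "clinear f" "clinear g" "\<And>n x. x \<in> tpow n \<Longrightarrow> f x = g x"
  shows "f x = g x"
  by (rule tens_linear_eq [OF assms(1,2)]) (use assms(3) pure_tpow in blast)

lemma tpow_linear_mem:
  assumes "clinear f" "csubspace V" "\<And>xs. length xs = n \<Longrightarrow> f (pure xs) \<in> V" "x \<in> tpow n"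
  shows "f x \<in> V"
proof -
  have "f x \<in> cspan V"
    by (rule span_image_subset [OF assms(1) _ assms(4) [unfolded tpow_def]])
      (use assms(3) in \<open>auto intro: cspan_base\<close>)
  then show ?thesis by (metis assms(2) complex_vector.span_eq_iff)
qed

lemma tens_linear_mem:
  assumes "clinear f" "csubspace V" "\<And>xs. f (pure xs) \<in> V"
  shows "f x \<in> V"
proof -
  have "f x \<in> cspan V"
    by (rule span_image_subset [OF assms(1) _ tens_span])
      (use assms(3) in \<open>auto intro: cspan_base\<close>)
  then show ?thesis by (metis assms(2) complex_vector.span_eq_iff)
qed

lemma tpow_mult:
  assumes "x \<in> tpow m" "y \<in> tpow n"
  shows "x * y \<in> tpow (m + n)"
proof (rule tpow_linear_mem [OF _ subspace_tpow _ assms(1)])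
  show "clinear (\<lambda>x. x * y)" by (intro clinear_intros)
  show "pure xs * y \<in> tpow (m + n)" if "length xs = m" for xs
    by (rule tpow_linear_mem [OF _ subspace_tpow _ assms(2)])
      (use that in \<open>auto intro: clinear_intros pure_tpow\<close>)
qed

text \<open>Replacing one entry keeps the length, so \<open>n\<close> stays fixed in every instance
  of multilinearity.\<close>

lemma multilinear_by_length:
  assumes "\<And>n. multilinear (f n)"
  shows "multilinear (\<lambda>xs. f (length xs) xs)"
  using assms by (simp add: multilinear_def)

lemma multilinear_linear_pure: "clinear f \<Longrightarrow> multilinear (\<lambda>xs. f (pure xs))"
  unfolding multilinear_def using multilinear_pure [unfolded multilinear_def] clinear_compose by blast

section \<open>Operators assembled from their homogeneous parts\<close>

definition by_degree :: "(nat \<Rightarrow> 'a::complex_vector tens \<Rightarrow> 'b::complex_vector) \<Rightarrow> 'a tens \<Rightarrow> 'b"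
  where "by_degree F = tens_lift (\<lambda>xs. F (length xs) (pure xs))"

lemma multilinear_by_degree:
  "(\<And>n. clinear (F n)) \<Longrightarrow> multilinear (\<lambda>xs. F (length xs) (pure xs))"
  using multilinear_by_length [of "\<lambda>n xs. F n (pure xs)"] by (simp add: multilinear_linear_pure)

lemma clinear_by_degree: "(\<And>n. clinear (F n)) \<Longrightarrow> clinear (by_degree F)"
  unfolding by_degree_def by (intro clinear_tens_lift multilinear_by_degree)

lemma by_degree_pure: "(\<And>n. clinear (F n)) \<Longrightarrow> by_degree F (pure xs) = F (length xs) (pure xs)"
  unfolding by_degree_def by (rule tens_lift_pure) (rule multilinear_by_degree)

lemma by_degree_tpow:
  assumes "\<And>n. clinear (F n)" "x \<in> tpow n"
  shows "by_degree F x = F n x"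
  by (rule tpow_linear_eq [OF clinear_by_degree _ _ assms(2)]) (use assms(1) in \<open>auto simp: by_degree_pure\<close>)

text \<open>Both sides of each linearity law in \<open>y\<close> are linear in \<open>x\<close>, so
  they are compared on pure tensors, where the degree is known. This yields the bilinearity behind
  the invariant of one-forms.\<close>

lemma by_degree_clinear_param:
  assumes "\<And>n y. clinear (\<lambda>x. F n x y)" "\<And>n x. clinear (F n x)"
  shows "clinear (\<lambda>y. by_degree (\<lambda>n x. F n x y) x)"
proof -
  let ?G = "\<lambda>x y. by_degree (\<lambda>n x. F n x y) x"
  have L: "clinear (\<lambda>x. ?G x y)" for y by (rule clinear_by_degree) (rule assms(1))
  have G: "?G (pure xs) y = F (length xs) (pure xs) y" for xs y
    by (rule by_degree_pure) (rule assms(1))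
  have "?G x (y + y') = ?G x y + ?G x y'" for x y y'
    by (rule tens_linear_eq [OF L clinear_add_fun [OF L L]]) (unfold G, rule clinear_add [OF assms(2)])
  moreover have "?G x (c *\<^sub>C y) = c *\<^sub>C ?G x y" for c x y
    by (rule tens_linear_eq [OF L clinear_scale_fun [OF L]]) (unfold G, rule clinear_scale [OF assms(2)])
  ultimately show ?thesis by (rule clinearI)
qed

definition wt :: "(nat \<Rightarrow> complex) \<Rightarrow> 'a::complex_vector tens \<Rightarrow> 'a tens"
  where "wt w = by_degree (\<lambda>n x. w n *\<^sub>C x)"

lemma clinear_wt: "clinear (wt w)"
  unfolding wt_def by (intro clinear_by_degree clinear_intros)

lemma wt_tpow: "x \<in> tpow n \<Longrightarrow> wt w x = w n *\<^sub>C x"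
  unfolding wt_def by (rule by_degree_tpow) (intro clinear_intros)

text \<open>The degree is an integer so that composites of maps raising and lowering the degree need
  no case distinction. The clause for negative targets makes a map of degree -1 vanish on
  scalars.\<close>

definition degree_map :: "int \<Rightarrow> ('a::complex_vector tens \<Rightarrow> 'b::complex_vector tens) \<Rightarrow> bool" where
  "degree_map d f \<longleftrightarrow> clinear f \<and>
     (\<forall>n. \<forall>x\<in>tpow n. if int n + d < 0 then f x = 0 else f x \<in> tpow (nat (int n + d)))"

lemma degree_map_linear: "degree_map d f \<Longrightarrow> clinear f"
  by (simp add: degree_map_def)

lemma all_nat_split: "(\<forall>n. P n) \<longleftrightarrow> P 0 \<and> (\<forall>n. P (Suc n))"
  by (metis not0_implies_Suc)

lemma degree_map_0: "degree_map 0 f \<longleftrightarrow> clinear f \<and> (\<forall>n. \<forall>x\<in>tpow n. f x \<in> tpow n)"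
  by (simp add: degree_map_def)

lemma degree_map_1: "degree_map 1 f \<longleftrightarrow> clinear f \<and> (\<forall>n. \<forall>x\<in>tpow n. f x \<in> tpow (Suc n))"
  by (simp add: degree_map_def nat_add_distrib)

lemma degree_map_neg1:
  "degree_map (- 1) f \<longleftrightarrow> clinear f \<and> (\<forall>x\<in>tpow 0. f x = 0) \<and> (\<forall>n. \<forall>x\<in>tpow (Suc n). f x \<in> tpow n)"
proof -
  have "(\<forall>n. \<forall>x\<in>tpow n. if int n + - 1 < 0 then f x = 0 else f x \<in> tpow (nat (int n + - 1)))
    \<longleftrightarrow> (\<forall>x\<in>tpow 0. f x = 0) \<and> (\<forall>n. \<forall>x\<in>tpow (Suc n). f x \<in> tpow n)"
    (is "(\<forall>n. ?P n) \<longleftrightarrow> ?Q")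
    by (subst all_nat_split) simp
  then show ?thesis unfolding degree_map_def by simp
qed

lemma degree_map_comp:
  fixes f :: "'a::complex_vector tens \<Rightarrow> 'b::complex_vector tens" and g :: "'b tens \<Rightarrow> 'c::complex_vector tens"
  assumes "degree_map d f" "degree_map d' g"
  shows "degree_map (d + d') (\<lambda>x. g (f x))"
  unfolding degree_map_def
proof (intro conjI allI ballI)
  show "clinear (\<lambda>x. g (f x))"
    by (rule clinear_compose [OF degree_map_linear [OF assms(1)] degree_map_linear [OF assms(2)]])
  have g0: "g 0 = 0" by (rule clinear_zero [OF degree_map_linear [OF assms(2)]])
  fix n and x :: "'a tens" assume x: "x \<in> tpow n"
  show "if int n + (d + d') < 0 then g (f x) = 0 else g (f x) \<in> tpow (nat (int n + (d + d')))"
  proof (cases "int n + d < 0")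
    case True
    then have "f x = 0" using assms(1) x unfolding degree_map_def by meson
    then show ?thesis by (simp add: g0 tpow_closed)
  next
    case False
    then have "f x \<in> tpow (nat (int n + d))"
      using assms(1) x unfolding degree_map_def by meson
    then have "if int (nat (int n + d)) + d' < 0 then g (f x) = 0
       else g (f x) \<in> tpow (nat (int (nat (int n + d)) + d'))"
      using assms(2) unfolding degree_map_def by blast
    moreover have "int (nat (int n + d)) + d' = int n + (d + d')" using False by simp
    ultimately show ?thesis by (simp only:)
  qed
qed

lemma degree_map_diff: "degree_map d f \<Longrightarrow> degree_map d g \<Longrightarrow> degree_map d (\<lambda>x. f x - g x)"
  and degree_map_add: "degree_map d f \<Longrightarrow> degree_map d g \<Longrightarrow> degree_map d (\<lambda>x. f x + g x)"
  and degree_map_uminus: "degree_map d f \<Longrightarrow> degree_map d (\<lambda>x. - f x)"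
  and degree_map_scale: "degree_map d f \<Longrightarrow> degree_map d (\<lambda>x. c *\<^sub>C f x)"
  and degree_map_id: "degree_map 0 (\<lambda>x. x)"
  by (auto simp: degree_map_def tpow_closed intro!: clinear_intros)

lemma degree_map_wt: "degree_map 0 (wt w)"
  by (auto simp: degree_map_0 clinear_wt wt_tpow tpow_closed)

lemma degree_map_by_degree:
  "(\<And>n. degree_map 0 (F n)) \<Longrightarrow> degree_map 0 (by_degree F)"
  unfolding degree_map_0 by (auto simp: clinear_by_degree by_degree_tpow)

lemma degree_map_wt_comm:
  assumes "degree_map 0 f"
  shows "f (wt w x) = wt w (f x)"
proof (rule tens_linear_eq_tpow [where x = x])
  show "clinear (\<lambda>x. f (wt w x))" "clinear (\<lambda>x. wt w (f x))"
    using clinear_compose clinear_wt degree_map_linear [OF assms] by blast+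
  show "f (wt w x) = wt w (f x)" if "x \<in> tpow n" for n x
    using that assms by (simp add: degree_map_0 wt_tpow [of _ n] clinear_scale)
qed

lemma degree_map_funpow: "degree_map 0 f \<Longrightarrow> degree_map 0 (f ^^ k)"
  for f :: "'a::complex_vector tens \<Rightarrow> 'a tens"
  by (induction k) (auto simp: degree_map_0 clinear_funpow clinear_iff)

lemma degree_map_0I:
  assumes "clinear f" "\<And>xs. f (pure xs) \<in> tpow (length xs)"
  shows "degree_map 0 f"
  unfolding degree_map_0
proof (intro conjI allI ballI assms(1))
  show "f x \<in> tpow n" if "x \<in> tpow n" for n x
    by (rule tpow_linear_mem [OF assms(1) subspace_tpow _ that]) (use assms(2) in blast)
qed

lemma degree_map_1I:
  assumes "clinear f" "\<And>xs. f (pure xs) \<in> tpow (Suc (length xs))"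
  shows "degree_map 1 f"
  unfolding degree_map_1
proof (intro conjI allI ballI assms(1))
  show "f x \<in> tpow (Suc n)" if "x \<in> tpow n" for n x
    by (rule tpow_linear_mem [OF assms(1) subspace_tpow _ that]) (use assms(2) in blast)
qed

text \<open>Choosing the generalized inverse one degree at a time keeps it homogeneous.\<close>

lemma degree_one_generalized_inverse:
  assumes "degree_map 1 f"
  obtains g where "degree_map (- 1) g" "\<And>x. f (g (f x)) = f x"
proof -
  have lf: "clinear f" using assms by (simp add: degree_map_1)
  have "\<forall>n. \<exists>g. range g \<subseteq> tpow n \<and> clinear g \<and> (\<forall>v\<in>f ` tpow n. f (g v) = v)"
    using complex_vector.linear_exists_right_inverse_on [OF lf subspace_tpow] by blast
  then obtain G where G: "range (G n) \<subseteq> tpow n" "clinear (G n)" "\<forall>v\<in>f ` tpow n. f (G n v) = v" for n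
    by metis
  \<comment> \<open>Values of \<open>f\<close> from degree \<open>n\<close> lie in degree
    \<open>n + 1\<close>, hence the shift of index. Homogeneous values of \<open>f\<close> never
    have degree 0, so the default value 0 there is harmless.\<close>
  define F where "F n = (if n = 0 then (\<lambda>x. 0) else G (n - 1))" for n
  have F: "clinear (F n)" for n by (auto simp: F_def G clinear_const_0)
  have FS: "F (Suc n) = G n" for n by (simp add: F_def)
  define g where "g = by_degree F"
  have lg: "clinear g" unfolding g_def by (rule clinear_by_degree) (rule F)
  have gS: "g x = G n x" if "x \<in> tpow (Suc n)" for n x
    using that by (simp add: g_def by_degree_tpow [of F, OF F that] FS)
  have "degree_map (- 1) g"
    unfolding degree_map_neg1 using G(1) lg gS by (auto simp: by_degree_tpow [of F, OF F] F_def g_def)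
  moreover have "f (g (f x)) = f x" for x
  proof (rule tens_linear_eq_tpow [OF _ lf])
    show "clinear (\<lambda>x. f (g (f x)))" 
      by (rule clinear_compose [OF lf clinear_compose [OF lg lf]])
    show "f (g (f x)) = f x" if "x \<in> tpow n" for n x
      
      using that assms G(3) [of n] by (simp add: degree_map_1 gS [of _ n])
  qed
  ultimately show ?thesis using that by blast
qed

section \<open>Changing the sign of a horizontal differential\<close>

definition cyc_sum :: "('a::complex_vector tens \<Rightarrow> 'a tens) \<Rightarrow> 'a tens \<Rightarrow> 'a tens"
  where "cyc_sum L = by_degree (\<lambda>n x. \<Sum>i\<le>n. (L ^^ i) x)"

lemma degree_map_sum:
  "(\<And>i. i \<in> S \<Longrightarrow> degree_map 0 (f i)) \<Longrightarrow> degree_map 0 (\<lambda>x. \<Sum>i\<in>S. f i x)"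
  unfolding degree_map_0 by (auto intro!: clinear_sum_fun tpow_closed)

locale cyclic_operator =
  fixes L :: "'a::complex_vector tens \<Rightarrow> 'a tens"
  assumes L_degree: "degree_map 0 L"
    and L_period: "x \<in> tpow n \<Longrightarrow> (L ^^ Suc n) x = x"
begin

abbreviation M where "M x \<equiv> x - L x"
abbreviation N where "N \<equiv> cyc_sum L"

definition V :: "'a tens \<Rightarrow> 'a tens" where "V = wt (\<lambda>n. 1 / of_nat (Suc n))"
definition E :: "'a tens \<Rightarrow> 'a tens" where "E x = V (N x)"
text \<open>A quasi-inverse of \<open>M\<close>, in the sense that \<open>M J = J M = 1 - E\<close>.
  The weights \<open>k\<close> come from a telescoping sum: applying \<open>L - 1\<close> to the sum
  of \<open>k L^k\<close> leaves \<open>(n + 1) - N\<close> in degree \<open>n\<close>, and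
  \<open>V\<close> divides by \<open>n + 1\<close>. Being a polynomial in \<open>L\<close> in each
  degree, \<open>J\<close> is homogeneous and commutes with \<open>L\<close>.\<close>

definition J :: "'a tens \<Rightarrow> 'a tens"
  where "J x = - V (by_degree (\<lambda>n x. \<Sum>k\<le>n. of_nat k *\<^sub>C (L ^^ k) x) x)"

lemma clinear_L: "clinear L" by (rule degree_map_linear [OF L_degree])

lemmas L_simps [simp] = clinearD [OF clinear_L]

lemma clinear_Lpow: "clinear (L ^^ k)" by (rule clinear_funpow) (rule clinear_L)

lemma N_degree: "degree_map 0 N"
  unfolding cyc_sum_def
  by (intro degree_map_by_degree degree_map_sum degree_map_funpow L_degree)

lemma N_tpow: "x \<in> tpow n \<Longrightarrow> N x = (\<Sum>i\<le>n. (L ^^ i) x)"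
  unfolding cyc_sum_def by (rule by_degree_tpow) (intro clinear_sum_fun clinear_Lpow)

lemma V_degree: "degree_map 0 V" unfolding V_def by (rule degree_map_wt)

lemma E_degree: "degree_map 0 E"
  unfolding E_def [abs_def] using degree_map_comp [OF N_degree V_degree] by simp

lemma J_degree: "degree_map 0 J"
proof -
  let ?R = "by_degree (\<lambda>n x. \<Sum>k\<le>n. of_nat k *\<^sub>C (L ^^ k) x)"
  have "degree_map 0 ?R"
    by (intro degree_map_by_degree degree_map_sum degree_map_scale degree_map_funpow L_degree)
  from degree_map_uminus [OF degree_map_comp [OF this V_degree]]
  show ?thesis unfolding J_def [abs_def] by simp
qed

lemmas N_simps [simp] = clinearD [OF degree_map_linear [OF N_degree]]
lemmas V_simps [simp] = clinearD [OF degree_map_linear [OF V_degree]]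
lemmas E_simps [simp] = clinearD [OF degree_map_linear [OF E_degree]]
lemmas J_simps [simp] = clinearD [OF degree_map_linear [OF J_degree]]

lemma V_commute: "degree_map 0 f \<Longrightarrow> f (V x) = V (f x)"
  unfolding V_def by (rule degree_map_wt_comm)

lemma L_N [simp]: "L (N x) = N x"
proof (rule tens_linear_eq_tpow [of _ _ x])
  show "clinear (\<lambda>x. L (N x))" "clinear N"
    using clinear_compose [OF degree_map_linear [OF N_degree] clinear_L] degree_map_linear [OF N_degree] by auto
  fix n and x :: "'a tens" assume x: "x \<in> tpow n"
  have "x + (\<Sum>i\<le>n. (L ^^ Suc i) x) = (\<Sum>i\<le>Suc n. (L ^^ i) x)"
    unfolding sum.atMost_Suc_shift by simp
  also have "\<dots> = (\<Sum>i\<le>n. (L ^^ i) x) + x" using L_period [OF x] by simp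
  finally show "L (N x) = N x" using N_tpow [OF x] by simp
qed

lemma N_L [simp]: "N (L x) = N x"
proof (rule tens_linear_eq_tpow [of _ _ x])
  show "clinear (\<lambda>x. N (L x))" "clinear N"
    using clinear_compose [OF clinear_L degree_map_linear [OF N_degree]] degree_map_linear [OF N_degree] by auto
  fix n and x :: "'a tens" assume x: "x \<in> tpow n"
  have "L x \<in> tpow n" using L_degree x by (simp add: degree_map_0)
  from N_tpow [OF this] have "N (L x) = L (N x)"
    by (simp add: N_tpow [OF x] funpow_swap1)
  then show "N (L x) = N x" by simp
qed

lemma M_J: "M (J x) = x - E x"
proof (rule tens_linear_eq_tpow [of "\<lambda>x. M (J x)" "\<lambda>x. x - E x" x])
  note lin = degree_map_linear [OF J_degree] degree_map_linear [OF E_degree]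
  show "clinear (\<lambda>x. M (J x))" "clinear (\<lambda>x. x - E x)"
    by (intro clinear_intros lin clinear_compose [OF lin(1) clinear_L])+
  fix n and x :: "'a tens" assume x: "x \<in> tpow n"
  let ?R = "\<lambda>m. \<Sum>k\<le>m. of_nat k *\<^sub>C (L ^^ k) x"
  \<comment> \<open>For \<open>m = n\<close> the period replaces the boundary term by
    \<open>n x\<close>, and the right-hand side becomes \<open>(n + 1) x - N x\<close>.\<close>
  have R: "L (?R m) - ?R m = x + of_nat m *\<^sub>C (L ^^ Suc m) x - (\<Sum>k\<le>m. (L ^^ k) x)" for m
    by (induction m) (simp_all add: algebra_simps scaleC_add_left)
  have NV: "N x \<in> tpow n" "V y = (1 / of_nat (Suc n)) *\<^sub>C y" if "y \<in> tpow n" for y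
    using that x N_degree unfolding V_def by (auto simp: degree_map_0 wt_tpow)
  have Jx: "J x = - V (?R n)"
    unfolding J_def by (subst by_degree_tpow [OF _ x]) (auto intro!: clinear_intros clinear_Lpow)
  have "M (J x) = V (L (?R n) - ?R n)"
    by (simp add: Jx V_commute [OF L_degree, symmetric])
  also have "\<dots> = V (of_nat (Suc n) *\<^sub>C x - N x)"
    unfolding R L_period [OF x] N_tpow [OF x] by (simp add: scaleC_add_left)
  also have "\<dots> = x - E x" by (simp add: E_def NV(2) [OF x] del: of_nat_Suc)
  finally show "M (J x) = x - E x" .
qed

lemma J_L: "J (L x) = L (J x)"
proof (rule tens_linear_eq_tpow [of "\<lambda>x. J (L x)" "\<lambda>x. L (J x)" x])
  note lin = degree_map_linear [OF J_degree] clinear_L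
  show "clinear (\<lambda>x. J (L x))" "clinear (\<lambda>x. L (J x))"
    by (rule clinear_compose [OF lin] clinear_compose [OF lin(2,1)])+
  fix n and x :: "'a tens" assume x: "x \<in> tpow n"
  have Lx: "L x \<in> tpow n" using L_degree x by (simp add: degree_map_0)
  have J: "J y = - V (\<Sum>k\<le>n. of_nat k *\<^sub>C (L ^^ k) y)" if "y \<in> tpow n" for y
    unfolding J_def by (subst by_degree_tpow [OF _ that]) (auto intro!: clinear_intros clinear_Lpow)
  show "J (L x) = L (J x)" 
    unfolding J [OF x] J [OF Lx] by (simp add: V_commute [OF L_degree] funpow_swap1)
qed

lemma J_M: "J (M x) = x - E x" by (simp add: J_L M_J)

lemma E_L [simp]: "E (L x) = E x" and L_E [simp]: "L (E x) = E x"
  by (simp_all add: E_def V_commute [OF L_degree])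

lemma E_M [simp]: "E (M x) = 0" and M_E [simp]: "M (E x) = 0" by simp_all

lemma E_fixed: "L y = y \<Longrightarrow> E y = y" using J_M [of y] by simp

lemma E_E [simp]: "E (E x) = E x" and E_N [simp]: "E (N x) = N x" by (simp_all add: E_fixed)

lemma N_E [simp]: "N (E x) = N x"
proof -
  have "N (M (J x)) = 0" by simp
  then show ?thesis unfolding M_J by simp
qed

lemma N_V: "N (V x) = E x" by (simp add: E_def V_commute [OF N_degree])

lemma E_J: "E (J x) = J (E x)"
proof -
  have "J (M (J x)) = M (J (J x))" by (simp add: J_L)
  then show ?thesis unfolding J_M M_J by simp
qed

lemma N_0_iff: "N x = 0 \<longleftrightarrow> E x = 0"
  by (metis E_def N_E V_simps(4) N_simps(4))

end

text \<open>
  The columns \<open>b\<close>, \<open>b'\<close> with horizontal maps \<open>1 - L\<close> and \<open>N\<close>.  Over a field, changing the sign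
  of \<open>1 - L\<close> gives an isomorphic super-complex.  The isomorphism is not natural: on the cohomology
  of the invariant subcomplex it has to anticommute with the periodicity operator, and it is taken
  to be \<open>-1\<close> there in the degrees 2 and 3 modulo 4.
\<close>

locale sign_twist = cyclic_operator +
  fixes b b' s :: "'a tens \<Rightarrow> 'a tens"
  assumes b_degree: "degree_map 1 b" and b'_degree: "degree_map 1 b'" and s_degree: "degree_map (- 1) s"
    and b_b [simp]: "b (b x) = 0" and b'_b' [simp]: "b' (b' x) = 0"
    and M_b: "b x - L (b x) = b' (x - L x)"
    and b_N: "b (N x) = N (b' x)"
    and contraction: "b' (s x) + s (b' x) = x"
begin

lemmas b_simps [simp] = clinearD [OF degree_map_linear [OF b_degree]]
lemmas b'_simps [simp] = clinearD [OF degree_map_linear [OF b'_degree]]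
lemmas s_simps [simp] = clinearD [OF degree_map_linear [OF s_degree]]

lemma s_b': "s (b' x) = x - b' (s x)" using contraction [of x] by (simp add: algebra_simps)

text \<open>The differential of the invariant complex, the image of \<open>E\<close>, extended by
  zero to the complement, the image of \<open>M\<close>. In this form it is an operator on the whole
  space and has a homogeneous generalized inverse.\<close>

definition f where "f x = b (E x)"

text \<open>Since \<open>V\<close> commutes with \<open>N\<close>, \<open>E\<close> can be written
  as \<open>N V\<close>; then \<open>b E = N b' V\<close> takes values in the image of
  \<open>N\<close>, which \<open>E\<close> fixes.\<close>

lemma E_b_E: "E (b (E x)) = b (E x)"
  unfolding E_def [of x] V_commute [OF N_degree, symmetric] b_N by simp

lemma E_f [simp]: "E (f x) = f x" and f_E [simp]: "f (E x) = f x" and f_f [simp]: "f (f x) = 0"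
  by (simp_all add: f_def E_b_E)

lemma f_degree: "degree_map 1 f"
  unfolding f_def [abs_def] using degree_map_comp [OF E_degree b_degree] by simp

lemmas f_simps [simp] = clinearD [OF degree_map_linear [OF f_degree]]

text \<open>A Hodge-type splitting of the invariant complex. The map
  \<open>pi = 1 - f g - g f\<close> is homotopic to the identity and kills coboundaries. The
  idempotent \<open>p\<close> retains representatives of the cohomology in the degrees 2 and 3
  modulo 4 only; the last clause says so for cocycles. The maps \<open>g\<close> and
  \<open>pi\<close> are kept in the conclusion because a homotopy is later built from them.\<close>

lemma splitting_exists:
  "\<exists>g pi p. degree_map (- 1) g \<and> degree_map 0 pi \<and> degree_map 0 p \<and>
     (\<forall>x. E (g x) = g x) \<and> (\<forall>x. pi x = x - f (g x) - g (f x)) \<and> (\<forall>x. f (g (f x)) = f x) \<and>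
     (\<forall>x. p (p x) = p x) \<and> (\<forall>x. p (f x) = 0) \<and> (\<forall>x. f (p x) = 0) \<and>
     (\<forall>x. p (E x) = p x) \<and> (\<forall>x. E (p x) = p x) \<and>
     (\<forall>n x. x \<in> tpow n \<longrightarrow> f x = 0 \<longrightarrow> E x = x \<longrightarrow>
        (if n mod 4 \<in> {2, 3} then \<exists>y. x - p x = f y else p x = 0))"
proof -
  obtain g0 where g0: "degree_map (- 1) g0" "\<And>x. f (g0 (f x)) = f x"
    using degree_one_generalized_inverse [OF f_degree] by blast
  \<comment> \<open>As \<open>E f = f = f E\<close>, compressing by \<open>E\<close> preserves
    \<open>f g f = f\<close> and makes the values invariant.\<close>
  define g where "g x = E (g0 (E x))" for x
  have g_degree: "degree_map (- 1) g"
    unfolding g_def [abs_def]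
    using degree_map_comp [OF degree_map_comp [OF E_degree g0(1)] E_degree] by simp
  note [simp] = clinearD [OF degree_map_linear [OF g_degree]]
  have fgf: "f (g (f x)) = f x" and Eg [simp]: "E (g x) = g x" and gE [simp]: "g (E x) = g x" for x
    by (simp_all add: g_def g0)
  define pi where "pi x = x - f (g x) - g (f x)" for x
  have pi_degree: "degree_map 0 pi"
    unfolding pi_def [abs_def]
    using degree_map_diff [OF degree_map_diff [OF degree_map_id
      degree_map_comp [OF g_degree f_degree, simplified]] degree_map_comp [OF f_degree g_degree, simplified]]
    by simp
  have pi_f: "pi (f x) = 0" and f_pi: "f (pi x) = 0" and E_pi: "E (pi x) = pi (E x)" for x
    by (simp_all add: pi_def fgf)
  note [simp] = clinearD [OF degree_map_linear [OF pi_degree]]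
  \<comment> \<open>\<open>pi\<close> need not be idempotent, because \<open>g g\<close> need not
    vanish. But \<open>f pi = 0\<close> gives \<open>pi - pi pi = f g pi\<close>, and
    \<open>pi f = 0\<close> then gives \<open>pi^3 = pi^2\<close>, so the square is
    idempotent.\<close>
  define q where "q x = pi (pi (E x))" for x
  have q_f: "q (f x) = 0" and f_q: "f (q x) = 0" and E_q: "E (q x) = q x" and q_E: "q (E x) = q x" for x
    by (simp_all add: q_def pi_f f_pi E_pi)
  have q_ker: "x - q x = f (g x + g (pi x))" if "f x = 0" "E x = x" for x
    using that f_pi [of x] by (simp add: q_def pi_def)
  have q_ker': "\<exists>y. x - q x = f y" if "f x = 0" "E x = x" for x
    using q_ker [OF that] by blast
  have q_q: "q (q x) = q x" for x
    
  proof -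
    have pip: "pi (pi y) - pi (pi (pi y)) = 0" for y
    proof -
      have "pi y - pi (pi y) = f (g (pi y))" using f_pi [of y] by (simp add: pi_def)
      then have "pi (pi y - pi (pi y)) = 0" by (simp only: pi_f)
      then show ?thesis by simp
    qed
    show ?thesis using pip [of "E x"] pip [of "pi (E x)"] by (simp add: q_def E_pi)
  qed
  define chi :: "'a tens \<Rightarrow> 'a tens" where "chi = wt (\<lambda>n. if n mod 4 \<in> {2, 3} then 1 else 0)"
  define p where "p x = chi (q x)" for x
  have q_degree: "degree_map 0 q"
    unfolding q_def [abs_def]
    using degree_map_comp [OF degree_map_comp [OF E_degree pi_degree] pi_degree] by simp
  have chi_degree: "degree_map 0 chi" unfolding chi_def by (rule degree_map_wt)
  have p_degree: "degree_map 0 p"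
    unfolding p_def [abs_def] using degree_map_comp [OF q_degree chi_degree] by simp
  have chi_comm: "h (chi x) = chi (h x)" if "degree_map 0 h" for h :: "'a tens \<Rightarrow> 'a tens" and x
    unfolding chi_def by (rule degree_map_wt_comm [OF that])
  have lin: "clinear p" "clinear f" "clinear q" "clinear chi"
    using p_degree f_degree q_degree chi_degree by (auto dest: degree_map_linear)
  have chi0 [simp]: "chi 0 = 0" by (rule clinear_zero [OF lin(4)])
  have p_on: "p x = (if n mod 4 \<in> {2, 3} then q x else 0)" if "x \<in> tpow n" for n x
  proof -
    have "q x \<in> tpow n" using q_degree that by (simp add: degree_map_0)
    then show ?thesis by (auto simp: p_def chi_def wt_tpow)
  qed
  have chi_chi: "chi (chi x) = chi x" for x
  proof (rule tens_linear_eq_tpow [of "\<lambda>x. chi (chi x)" chi])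
    show "clinear (\<lambda>x. chi (chi x))" "clinear chi" using lin(4) clinear_compose by blast+
    show "chi (chi y) = chi y" if "y \<in> tpow n" for n y
      using wt_tpow [OF that, of "\<lambda>n. if n mod 4 \<in> {2, 3} then 1 else 0"]
      by (auto simp: chi_def clinearD [OF clinear_wt])
  qed
  have "f (p x) = 0" for x
  proof (rule tens_linear_eq_tpow [of "\<lambda>x. f (p x)" "\<lambda>x. 0"])
    show "clinear (\<lambda>x. f (p x))" by (rule clinear_compose [OF lin(1,2)])
    show "f (p y) = 0" if "y \<in> tpow n" for n y using p_on [OF that] f_q by simp
  qed (rule clinear_const_0)
  moreover have "p (p x) = p x" for x
    by (simp add: p_def chi_comm [OF q_degree] chi_chi q_q)
  moreover have "p (f x) = 0" "p (E x) = p x" "E (p x) = p x" for x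
    by (simp_all add: p_def q_f q_E E_q chi_comm [OF E_degree])
  moreover have "if n mod 4 \<in> {2, 3} then \<exists>y. x - p x = f y else p x = 0"
    if "x \<in> tpow n" "f x = 0" "E x = x" for n x
    using p_on [OF that(1)] q_ker' [OF that(2,3)] by auto
  ultimately show ?thesis
    using g_degree pi_degree p_degree fgf Eg by (intro exI [of _ g] exI [of _ pi] exI [of _ p]) (simp add: pi_def)
qed

text \<open>With \<open>al = 1 - 2 P\<close> and \<open>be = 1 - 2 Q\<close> the requirements read:
  \<open>P\<close> commutes with \<open>b'\<close>, \<open>Q\<close> with \<open>b\<close>,
  \<open>Q N = N P\<close> and \<open>M Q = M - P M\<close>. An idempotent \<open>P\<close> makes
  \<open>al\<close> an involution. On invariants \<open>Q\<close> has to be the \<open>p\<close> of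
  the splitting, and the contraction of \<open>b'\<close> lifts \<open>p\<close> to
  \<open>P\<close>. What remains is to choose \<open>Q\<close> with the prescribed
  \<open>M Q\<close>, so that it commutes with \<open>b\<close>.\<close>

lemma sign_twist_exists:
  "\<exists>al be. degree_map 0 al \<and> degree_map 0 be \<and>
     (\<forall>x. al (b' x) = b' (al x)) \<and> (\<forall>x. be (b x) = b (be x)) \<and>
     (\<forall>x. be (N x) = N (al x)) \<and> (\<forall>x. al (M x) = - M (be x)) \<and>
     (\<forall>x. al (al x) = x) \<and> (\<forall>x. be x = 0 \<longrightarrow> x = 0) \<and> (\<forall>n. \<forall>y\<in>tpow n. \<exists>x\<in>tpow n. be x = y)"
proof -
  obtain g pi p where degs: "degree_map (- 1) g" "degree_map 0 pi" "degree_map 0 p"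
    and E_g: "\<And>x. E (g x) = g x" and pi: "\<And>x. pi x = x - f (g x) - g (f x)"
    and fgf: "\<And>x. f (g (f x)) = f x" and p_p: "\<And>x. p (p x) = p x"
    and p_f: "\<And>x. p (f x) = 0" and f_p: "\<And>x. f (p x) = 0"
    and p_E: "\<And>x. p (E x) = p x" and E_p: "\<And>x. E (p x) = p x"
    and p_ker: "\<And>n x. x \<in> tpow n \<Longrightarrow> f x = 0 \<Longrightarrow> E x = x \<Longrightarrow>
        if n mod 4 \<in> {2, 3} then \<exists>y. x - p x = f y else p x = 0"
    using splitting_exists by metis
  note g_simps [simp] = clinearD [OF degree_map_linear [OF degs(1)]]
  note pi_simps [simp] = clinearD [OF degree_map_linear [OF degs(2)]]
  note p_simps [simp] = clinearD [OF degree_map_linear [OF degs(3)]]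
  have N_b': "N (b' x) = b (N x)" for x by (rule b_N [symmetric])
  have L_p: "L (p x) = p x" for x using L_E [of "p x"] by (simp add: E_p)
  have p_bN: "p (b (N x)) = 0" for x using p_f [of "N x"] by (simp add: f_def)
  have p_bE: "p (b (E x)) = 0" for x using p_f [of x] by (simp add: f_def)
  have b_p: "b (p x) = 0" for x using f_p [of x] by (simp add: f_def E_p)

  \<comment> \<open>The lift of \<open>p\<close> to the contractible column, as a map of degree -1:
    it satisfies \<open>N phi = p N s\<close>, because \<open>N V = E\<close> and \<open>p\<close>
    has invariant values.\<close>
  define phi where "phi x = V (p (N (s x)))" for x
  have phi_degree: "degree_map (- 1) phi"
    unfolding phi_def [abs_def]
    using degree_map_comp [OF degree_map_comp [OF degree_map_comp [OF s_degree N_degree] degs(3)] V_degree] by simp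
  note phi_simps [simp] = clinearD [OF degree_map_linear [OF phi_degree]]
  have N_phi: "N (phi x) = p (N (s x))" for x by (simp add: phi_def N_V E_p)
  have phi_phi: "phi (b' (phi x)) = phi x" for x
    unfolding phi_def [of "b' (phi x)"] s_b' by (simp add: N_phi N_b' p_p p_bN) (simp add: phi_def)
  \<comment> \<open>Since \<open>phi b' phi = phi\<close>, both \<open>A = b' phi\<close> and
    \<open>B = phi b'\<close> are idempotent, and \<open>B A = 0\<close> by
    \<open>b' b' = 0\<close>. Hence \<open>A + B - A B\<close> is idempotent.\<close>
  define P where "P x = b' (phi x) + phi (b' x) - b' (phi (phi (b' x)))" for x
  have P_degree: "degree_map 0 P"
  proof -
    note d = degree_map_comp [OF phi_degree b'_degree, simplified] degree_map_comp [OF b'_degree phi_degree, simplified]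
      degree_map_comp [OF degree_map_comp [OF degree_map_comp [OF b'_degree phi_degree] phi_degree] b'_degree, simplified]
    from degree_map_diff [OF degree_map_add [OF d(1,2)] d(3)] show ?thesis
      by (simp add: P_def [abs_def])
  qed
  note P_simps [simp] = clinearD [OF degree_map_linear [OF P_degree]]
  have b'_P: "b' (P x) = b' (phi (b' x))" and P_b': "P (b' x) = b' (phi (b' x))" for x
    by (simp_all add: P_def)
  have P_P: "P (P x) = P x" for x
    unfolding P_def [of "P x"] b'_P by (simp add: P_def phi_phi)
  have N_P: "N (P x) = p (N x)" for x
    by (simp add: P_def N_b' N_phi b_p s_b' p_bN)
  have E_P_M: "E (P (x - L x)) = 0" for x
    unfolding N_0_iff [symmetric] N_P by simp

  \<comment> \<open>The equation \<open>M Q0 = M - P M\<close> is solved by the quasi-inverse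
    \<open>J\<close>; this is legitimate because \<open>E P M = 0\<close>. The summand
    \<open>p\<close> does not affect it and gives the right values on invariants. Only commutation
    with \<open>b\<close> is still missing.\<close>
  define Q0 where "Q0 x = p x + J ((x - L x) - P (x - L x))" for x
  have M_degree: "degree_map 0 (\<lambda>x. x - L x)" by (intro degree_map_diff degree_map_id L_degree)
  have Q0_degree: "degree_map 0 Q0"
  proof -
    from degree_map_add [OF degs(3) degree_map_comp [OF degree_map_diff [OF M_degree
        degree_map_comp [OF M_degree P_degree, simplified]] J_degree, simplified]]
    show ?thesis by (simp add: Q0_def [abs_def])
  qed
  note Q0_simps [simp] = clinearD [OF degree_map_linear [OF Q0_degree]]
  have M_Q0: "Q0 x - L (Q0 x) = (x - L x) - P (x - L x)" for x
  proof -
    have "Q0 x - L (Q0 x) = M (J ((x - L x) - P (x - L x)))"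
      unfolding Q0_def clinear_add [OF clinear_L] L_p by simp
    also have "\<dots> = (x - L x) - P (x - L x)"
      unfolding M_J by (simp only: clinear_diff [OF degree_map_linear [OF E_degree]] E_P_M) simp
    finally show ?thesis .
  qed
  have Q0_E: "Q0 (E x) = p x" for x by (simp add: Q0_def p_E)
  \<comment> \<open>The defect has invariant values and vanishes on invariants, so it factors
    through \<open>M\<close> as \<open>del = D M\<close>.\<close>
  define del where "del x = b (Q0 x) - Q0 (b x)" for x
  have del_degree: "degree_map 1 del"
    using degree_map_diff [OF degree_map_comp [OF Q0_degree b_degree, simplified] degree_map_comp [OF b_degree Q0_degree, simplified]]
    by (simp add: del_def [abs_def])
  note del_simps [simp] = clinearD [OF degree_map_linear [OF del_degree]]
  have M_del: "L (del x) = del x" for x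
  proof -
    have "del x - L (del x) = (b (Q0 x) - L (b (Q0 x))) - (Q0 (b x) - L (Q0 (b x)))"
      by (simp add: del_def algebra_simps)
    also have "\<dots> = b' (M x - P (M x)) - (b' (M x) - P (b' (M x)))"
      unfolding M_b M_Q0 ..
    also have "\<dots> = 0" by (simp add: b'_P P_b')
    finally show ?thesis by simp
  qed
  have del_E: "del (E x) = 0" for x
  proof -
    have "Q0 (b (E x)) = 0" using Q0_E [of "b (E x)"] by (simp add: E_b_E p_bE)
    then show ?thesis by (simp add: del_def Q0_E b_p)
  qed
  have b_del: "b (del x) = - del (b x)" for x by (simp add: del_def)
  define D where "D x = del (J x)" for x
  have D_degree: "degree_map 1 D"
    unfolding D_def [abs_def] using degree_map_comp [OF J_degree del_degree] by simp
  note D_simps [simp] = clinearD [OF degree_map_linear [OF D_degree]]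
  have L_D: "L (D x) = D x" for x by (simp add: D_def M_del)
  have E_D: "E (D x) = D x" for x by (rule E_fixed) (rule L_D)
  have D_E: "D (E x) = 0" for x by (simp add: D_def E_J [symmetric] del_E)
  have del_D: "del x = D (M x)" for x
    unfolding D_def J_M by (simp add: del_E)
  \<comment> \<open>The differential \<open>b'\<close> on the image of \<open>M\<close>, which is
    the kernel of \<open>E\<close>, extended by zero to the invariants. Up to sign, \<open>D\<close>
    is a cochain map from there to the invariant complex, of degree 1.\<close>
  define f' where "f' x = b' (x - E x)" for x
  have f'_degree: "degree_map 1 f'"
    using degree_map_comp [OF degree_map_diff [OF degree_map_id E_degree] b'_degree]
    by (simp add: f'_def [abs_def])
  have b_D: "b (D x) = - D (f' x)" for x
  proof -
    have "b (D x) = - del (b (J x))" by (simp add: D_def b_del)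
    also have "\<dots> = - D (f' x)" unfolding del_D M_b M_J f'_def ..
    finally show ?thesis .
  qed
  obtain g' where g'_degree: "degree_map (- 1) g'" and f'g'f': "\<And>x. f' (g' (f' x)) = f' x"
    using degree_one_generalized_inverse [OF f'_degree] by blast
  note f'_simps [simp] = clinearD [OF degree_map_linear [OF f'_degree]]
  note g'_simps [simp] = clinearD [OF degree_map_linear [OF g'_degree]]
  have b_fix: "b x = f x" if "E x = x" for x using that by (simp add: f_def)

  \<comment> \<open>The defect is removable if \<open>D\<close> is null-homotopic. Over a field it
    suffices that \<open>D\<close> vanishes on cohomology, which is the assertion here.\<close>
  have D_exact: "\<exists>y. D z = f y" if z: "z \<in> tpow n" "E z = 0" "b' z = 0" for z n
  proof (cases n)
    case 0
    then have "s z = 0" using z(1) s_degree by (simp add: degree_map_neg1)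
    then have "z = 0" using contraction [of z] z(3) by simp
    then have "D z = f 0" by simp
    then show ?thesis by blast
  next
    case (Suc m)
    \<comment> \<open>By the contraction, the cocycle \<open>z\<close> is the
      \<open>b'\<close>-coboundary of \<open>s z\<close>. Applying \<open>N\<close> instead gives an
      invariant cocycle one degree lower, which represents the class of \<open>z\<close> under the
      connecting map.\<close>
    define w where "w = N (s z)"
    have bs: "b' (s z) = z" using contraction [of z] z(3) by simp
    have w: "w \<in> tpow m" "E w = w"
      using z(1) Suc s_degree N_degree by (auto simp: w_def degree_map_neg1 degree_map_0)
    have bw: "b w = 0" using z(2) unfolding w_def N_b' [symmetric] bs N_0_iff .
    define th where "th = b' (V w)"
    have z_split: "z = th + f' (s z)"
      by (simp add: f'_def bs th_def w_def E_def)
    have E_th: "E th = 0" unfolding N_0_iff [symmetric] th_def N_b' N_V w(2) by (rule bw)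
    define y where "y = J th"
    have My: "y - L y = th" unfolding y_def M_J E_th by simp
    have P_th: "P th = b' (V (p w))"
    proof -
      have "phi th = V (p w)"
        unfolding phi_def th_def s_b' by (simp add: N_V N_b' w(2) p_bN)
      then show ?thesis by (simp add: th_def P_b')
    qed
    \<comment> \<open>The periodicity operator on cochains: lift an invariant through
      \<open>N\<close> by \<open>V\<close>, apply \<open>b'\<close>, lift through \<open>M\<close>
      by \<open>J\<close>, apply \<open>b\<close>. The degree goes up by two.\<close>
    define S where "S x = b (J (b' (V x)))" for x
    have Sdeg: "degree_map 2 S"
      using degree_map_comp [OF degree_map_comp [OF degree_map_comp [OF V_degree b'_degree] J_degree] b_degree]
      by (simp add: S_def [abs_def])
    have Sw: "S w \<in> tpow (m + 2)" using Sdeg w(1) by (auto simp: degree_map_def nat_add_distrib)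
    have ESw: "E (S w) = S w"
    proof (rule E_fixed)
      have "b y - L (b y) = 0" unfolding M_b My by (simp add: th_def)
      then show "L (S w) = S w" by (simp add: S_def y_def th_def)
    qed
    have fSw: "f (S w) = 0" unfolding f_def ESw by (simp add: S_def)
    \<comment> \<open>On cocycles the obstruction is thus \<open>S - S p - p S\<close>, which is
      half the anticommutator of \<open>S\<close> with \<open>1 - 2 p\<close>.\<close>
    have "D th = S (w - p w) - p (S w)"
    proof -
      have "D th = b (Q0 y) - Q0 (b y)" by (simp add: D_def y_def del_def)
      also have "b (Q0 y) = S (w - p w)"
        unfolding Q0_def My P_th by (simp add: b_p S_def th_def)
      also have "Q0 (b y) = p (S w)"
        using Q0_E [of "b y"] ESw by (simp add: y_def S_def th_def)
      finally show ?thesis .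
    qed
    \<comment> \<open>Exactly one of \<open>m\<close> and \<open>m + 2\<close> is 2 or 3 modulo 4.
      Hence \<open>p\<close> is the identity up to coboundaries on one of \<open>w\<close>,
      \<open>S w\<close> and zero on the other, so a single copy of \<open>S w\<close> is cancelled
      in either case.\<close>
    moreover have "\<exists>u. S (w - p w) - p (S w) = f u"
    proof (cases "m mod 4 \<in> {2, 3}")
      case True
      then obtain u where u: "w - p w = f u"
        using p_ker [OF w(1) _ w(2)] bw w(2) by (auto simp: f_def)
      have "(m + 2) mod 4 \<notin> {2, 3}" using True by (simp add: mod_simps) presburger
      then have "p (S w) = 0" using p_ker [OF Sw fSw ESw] by simp
      \<comment> \<open>\<open>S\<close> preserves coboundaries: write \<open>E = 1 - M J\<close>,
        use \<open>b' b' = 0\<close> and \<open>b' M = M b\<close>, and cancel the \<open>M\<close>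
        by \<open>J M = 1 - E\<close>.\<close>
      moreover have "S (f u) = f (b (J (b' (V (E u)))))"
      proof -
        let ?k = "E u"
        have "b ?k = N (b' (V ?k))" unfolding N_b' N_V by simp
        then have "V (f u) = E (b' (V ?k))" unfolding f_def E_def by simp
        then have "S (f u) = b (J (b' (E (b' (V ?k)))))" by (simp add: S_def)
        also have "b' (E (b' (V ?k))) = - b' (M (J (b' (V ?k))))" unfolding M_J by simp
        also have "\<dots> = - M (b (J (b' (V ?k))))" unfolding M_b ..
        also have "J \<dots> = - (b (J (b' (V ?k))) - E (b (J (b' (V ?k)))))" 
          unfolding clinear_uminus [OF degree_map_linear [OF J_degree]] J_M ..
        also have "b \<dots> = f (b (J (b' (V ?k))))" by (simp add: f_def)
        finally show ?thesis .
      qed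
      ultimately have "S (w - p w) - p (S w) = f (b (J (b' (V (E u)))))" unfolding u by simp
      then show ?thesis by blast
    next
      case False
      then have "p w = 0" using p_ker [OF w(1) _ w(2)] bw w(2) by (auto simp: f_def)
      moreover have "(m + 2) mod 4 \<in> {2, 3}" using False by simp presburger
      then have "\<exists>u. S w - p (S w) = f u" using p_ker [OF Sw fSw ESw] by simp
      ultimately show ?thesis by simp
    qed
    ultimately obtain u where u: "D th = f u" by auto
    have "D z = D th + D (f' (s z))" by (subst z_split) simp
    also have "D (f' (s z)) = f (- D (s z))"
      using b_D [of "s z"] b_fix [OF E_D, of "s z"] by simp
    finally have "D z = f (u - D (s z))" using u by simp
    then show ?thesis by blast
  qed

  \<comment> \<open>Since \<open>b D = - D f'\<close>, the term \<open>g D\<close> contributes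
    \<open>f g D + g f D = D - pi D\<close>. The second term supplies \<open>pi D g' f'\<close>. The
    difference is \<open>pi D\<close> of an \<open>f'\<close>-cocycle, where \<open>D\<close> gives
    a coboundary, and \<open>pi\<close> kills coboundaries.\<close>
  define kap where "kap x = g (D x) - pi (D (g' x))" for x
  have kap_degree: "degree_map 0 kap"
    using degree_map_diff [OF degree_map_comp [OF D_degree degs(1), simplified]
        degree_map_comp [OF degree_map_comp [OF g'_degree D_degree] degs(2), simplified]]
    by (simp add: kap_def [abs_def])
  note kap_simps [simp] = clinearD [OF degree_map_linear [OF kap_degree]]
  have pi_f: "pi (f x) = 0" and f_pi: "f (pi x) = 0" for x by (simp_all add: pi fgf)
  have E_kap: "E (kap x) = kap x" for x by (simp add: kap_def pi E_g E_D)
  have L_kap: "L (kap x) = kap x" for x using L_E [of "kap x"] by (simp add: E_kap)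
  have kap_eq: "b (kap x) - kap (f' x) = D x" if x: "x \<in> tpow n" for x n
  proof -
    have 1: "b (kap x) = f (g (D x))" unfolding b_fix [OF E_kap] by (simp add: kap_def f_pi)
    have "D (f' x) = - f (D x)" using b_D [of x] b_fix [OF E_D, of x] by simp
    then have 2: "kap (f' x) = - g (f (D x)) - pi (D (g' (f' x)))" by (simp add: kap_def)
    define z where "z = (x - g' (f' x)) - E (x - g' (f' x))"
    have "degree_map 0 (\<lambda>x. x - g' (f' x))"
      using degree_map_diff [OF degree_map_id degree_map_comp [OF f'_degree g'_degree, simplified]] .
    then have z: "z \<in> tpow n" using x E_degree unfolding z_def degree_map_0 by (blast intro: tpow_closed)
    have "E z = 0" by (simp add: z_def)
    moreover have "b' z = 0" using f'g'f' [of x] unfolding z_def f'_def [symmetric] by simp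
    ultimately obtain y where "D z = f y" using D_exact [OF z] by blast
    then have "pi (D z) = 0" by (simp add: pi_f)
    then have "pi (D x) = pi (D (g' (f' x)))" by (simp add: z_def D_E)
    then show ?thesis unfolding 1 2 using pi [of "D x"] by (simp add: algebra_simps)
  qed
  \<comment> \<open>\<open>kap\<close> has invariant values and \<open>M\<close> kills invariants,
    so neither \<open>M Q\<close> nor the restriction of \<open>Q\<close> to invariants
    changes.\<close>
  define Q where "Q x = Q0 x - kap (x - L x)" for x
  have Q_degree: "degree_map 0 Q"
    using degree_map_diff [OF Q0_degree degree_map_comp [OF M_degree kap_degree, simplified]]
    by (simp add: Q_def [abs_def])
  note Q_simps [simp] = clinearD [OF degree_map_linear [OF Q_degree]]
  have Q_b_hom: "Q (b x) = b (Q x)" if x: "x \<in> tpow n" for x n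
  proof -
    have Mx: "M x \<in> tpow n" using M_degree x by (simp add: degree_map_0)
    have f'M: "f' (M x) = b' (M x)" unfolding f'_def E_M by simp
    have "b (Q x) - Q (b x) = del x - (b (kap (M x)) - kap (M (b x)))"
      by (simp add: Q_def del_def algebra_simps)
    also have "\<dots> = del x - D (M x)" unfolding M_b f'M [symmetric] kap_eq [OF Mx] ..
    finally show ?thesis unfolding del_D by simp
  qed
  have Q_b: "Q (b x) = b (Q x)" for x
    by (rule tens_linear_eq_tpow [of "\<lambda>x. Q (b x)" "\<lambda>x. b (Q x)"])
      (use Q_b_hom clinear_compose [OF degree_map_linear [OF Q_degree] degree_map_linear [OF b_degree]]
        clinear_compose [OF degree_map_linear [OF b_degree] degree_map_linear [OF Q_degree]] in blast)+
  have M_Q: "Q x - L (Q x) = M x - P (M x)" for x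
    using M_Q0 [of x] by (simp add: Q_def L_kap)
  have Q_fix: "Q x = p x" if "L x = x" for x
    using that by (simp add: Q_def Q0_def)

  define al where "al x = x - (P x + P x)" for x
  define be where "be x = x - (Q x + Q x)" for x
  have be_degree: "degree_map 0 be" and al_degree: "degree_map 0 al"
    unfolding be_def [abs_def] al_def [abs_def]
    by (intro degree_map_diff degree_map_add degree_map_id Q_degree P_degree)+
  note al_simps [simp] = clinearD [OF degree_map_linear [OF al_degree]]
  note be_simps [simp] = clinearD [OF degree_map_linear [OF be_degree]]
  have al_al: "al (al x) = x" for x by (simp add: al_def P_P)
  have al_M: "al (M x) = - M (be x)" for x
  proof -
    have "M (be x) = M x - ((Q x - L (Q x)) + (Q x - L (Q x)))" by (simp add: be_def algebra_simps)
    then show ?thesis unfolding M_Q by (simp add: al_def)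
  qed
  have be_fix: "be (x - (p x + p x)) = x" if "L x = x" for x
    using that by (simp add: be_def Q_fix L_p p_p)
  have be_0: "x = 0" if "be x = 0" for x
  proof -
    have "al (M x) = 0" unfolding al_M that by simp
    then have "M x = 0" using al_al [of "M x"] by simp
    then have L: "L x = x" by simp
    then have "x = p x + p x" using that by (simp add: be_def Q_fix)
    then have "p x = p x + p x" by (metis p_p p_simps(1))
    then show ?thesis using \<open>x = p x + p x\<close> by simp
  qed
  \<comment> \<open>The relation \<open>al M = - M be\<close> determines \<open>M x\<close> from
    \<open>y\<close>, and \<open>J\<close> recovers a candidate. The remaining error is invariant,
    and on invariants \<open>be\<close> is the involution \<open>1 - 2 p\<close>.\<close>
  have be_surj: "\<exists>x\<in>tpow n. be x = y" if y: "y \<in> tpow n" for n y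
  proof -
    let ?x1 = "J (- al (M y))"
    have "E (al (M y)) = 0" by (simp only: al_M) (simp)
    then have M1: "M ?x1 = - al (M y)" unfolding M_J by simp
    let ?k = "y - be ?x1"
    have "M ?k = M y - M (be ?x1)" by (simp add: algebra_simps)
    also have "M (be ?x1) = - al (M ?x1)" by (simp only: al_M) simp
    also have "\<dots> = M y" unfolding M1 clinear_uminus [OF degree_map_linear [OF al_degree]] al_al by simp
    finally have "?k - L ?k = 0" unfolding diff_self .
    then have k: "L ?k = ?k" by (metis right_minus_eq)
    let ?x = "?x1 + (?k - (p ?k + p ?k))"
    have "be ?x = be ?x1 + be (?k - (p ?k + p ?k))" by (rule be_simps(1))
    also have "\<dots> = y" unfolding be_fix [OF k] by simp
    finally have "be ?x = y" .
    moreover have "?x \<in> tpow n"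
    proof -
      have "al z \<in> tpow n" "be z \<in> tpow n" "J z \<in> tpow n" "M z \<in> tpow n" "p z \<in> tpow n"
        if "z \<in> tpow n" for z
        using that al_degree be_degree J_degree M_degree degs(3) unfolding degree_map_0 by blast+
      then show ?thesis by (meson y tpow_closed(2-4))
    qed
    ultimately show ?thesis by blast
  qed
  have "al (b' x) = b' (al x)" "be (b x) = b (be x)" "be (N x) = N (al x)" for x
    by (simp_all add: al_def be_def b'_P P_b' Q_b Q_fix N_P)
  then show ?thesis
    using al_degree be_degree al_M al_al be_0 be_surj by (intro exI [of _ al] exI [of _ be]) blast
qed

end

section \<open>Sweedler sums\<close>

lemma cbilinear_iff:
  "cbilinear f \<longleftrightarrow> (\<forall>x y y'. f x (y + y') = f x y + f x y') \<and> (\<forall>x c y. f x (c *\<^sub>C y) = c *\<^sub>C f x y) \<and>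
     (\<forall>x x' y. f (x + x') y = f x y + f x' y) \<and> (\<forall>c x y. f (c *\<^sub>C x) y = c *\<^sub>C f x y)"
  unfolding cbilinear_def clinear_iff by blast

lemma clinear_pure_one: "clinear (\<lambda>x::'a::complex_vector. pure [x])"
  using multilinear_pure [where 'a = 'a, unfolded multilinear_def, rule_format, of "[]" "[]"] by simp

lemmas pure_one_simps [simp] = clinear_add [OF clinear_pure_one] clinear_scale [OF clinear_pure_one]

lemma pure_Cons: "pure (x # xs) = pure [x] * pure xs"
  by simp

lemma pure_Nil: "pure [] = 1"
  by (simp add: one_tens_def)

lemma multilinear_case2:
  assumes "cbilinear f"
  shows "multilinear (\<lambda>xs. case xs of [a, b] \<Rightarrow> f a b | _ \<Rightarrow> 0)"
  unfolding multilinear_def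
proof (intro allI)
  fix xs ys :: "'a list"
  have "(\<exists>a. xs = [a] \<and> ys = []) \<or> (\<exists>b. xs = [] \<and> ys = [b]) \<or> length xs + length ys \<noteq> 1"
    by (cases xs; cases ys) auto
  moreover have "(case zs of [a, b] \<Rightarrow> f a b | _ \<Rightarrow> 0) = 0" if "length zs \<noteq> 2" for zs
    using that by (auto split: list.splits)
  ultimately show "clinear (\<lambda>x. case xs @ x # ys of [a, b] \<Rightarrow> f a b | _ \<Rightarrow> 0)"
    using assms by (auto simp: cbilinear_def clinear_const_0)
qed

lemma clinear_lift2: "cbilinear f \<Longrightarrow> clinear (lift2 f)"
  and lift2_pure: "cbilinear f \<Longrightarrow> lift2 f (pure [a, b]) = f a b"
  unfolding lift2_def by (simp_all add: clinear_tens_lift tens_lift_pure multilinear_case2)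

lemma multilinear_case3:
  assumes "\<And>a b. clinear (F a b)" "\<And>a c. clinear (\<lambda>b. F a b c)" "\<And>b c. clinear (\<lambda>a. F a b c)"
  shows "multilinear (\<lambda>xs. case xs of [a, b, c] \<Rightarrow> F a b c | _ \<Rightarrow> 0)"
  unfolding multilinear_def
proof (intro allI)
  fix xs ys :: "'a list"
  have "(\<exists>a b. xs = [a, b] \<and> ys = []) \<or> (\<exists>a c. xs = [a] \<and> ys = [c]) \<or>
      (\<exists>b c. xs = [] \<and> ys = [b, c]) \<or> length xs + length ys \<noteq> 2"
    by (cases xs rule: remdups_adj.cases; cases ys rule: remdups_adj.cases) auto
  moreover have "(case zs of [a, b, c] \<Rightarrow> F a b c | _ \<Rightarrow> 0) = 0" if "length zs \<noteq> 3" for zs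
    using that by (auto split: list.splits)
  ultimately show "clinear (\<lambda>x. case xs @ x # ys of [a, b, c] \<Rightarrow> F a b c | _ \<Rightarrow> 0)"
    using assms by (auto simp: clinear_const_0)
qed

context hopf_algebra
begin

lemma comult_expansion: "\<exists>l. comult H h = (\<Sum>(a, b)\<leftarrow>l. pure [a, b])"
proof -
  have "\<exists>l. t = (\<Sum>(a, b)\<leftarrow>l. pure [a, b])" if "t \<in> cspan {pure xs | xs. length xs = 2}" for t :: "'h tens"
    using that
  proof (induction rule: complex_vector.span_induct_alt)
    case base
    show ?case by (rule exI [of _ "[]"]) simp
  next
    case (step c x y)
    then obtain l where l: "y = (\<Sum>(a, b)\<leftarrow>l. pure [a, b])" by blast
    from step(1) obtain xs where xs: "x = pure xs" "length xs = 2" by blast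
    then obtain a b where "x = pure [a] * pure [b]" by (auto simp: numeral_2_eq_2 length_Suc_conv)
    then have "c *\<^sub>C x = pure [c *\<^sub>C a] * pure [b]" by (simp del: pure_mult)
    then have "c *\<^sub>C x + y = (\<Sum>(a, b)\<leftarrow>(c *\<^sub>C a, b) # l. pure [a, b])" by (simp add: l del: pure_one_simps)
    then show ?case by blast
  qed
  then show ?thesis using comult_tensor [of h] unfolding tpow_def by blast
qed

definition cop :: "'h \<Rightarrow> ('h \<times> 'h) list"
  where "cop h = (SOME l. comult H h = (\<Sum>(a, b)\<leftarrow>l. pure [a, b]))"

text \<open>
  Unlike \<^const>\<open>sweedler\<close>, this sum commutes with linear maps and other sums for
  arbitrary, not only bilinear, summands.
\<close>

definition sws :: "('h \<Rightarrow> 'h \<Rightarrow> 'b::complex_vector) \<Rightarrow> 'h \<Rightarrow> 'b"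
  where "sws f h = (\<Sum>i<length (cop h). f (fst (cop h ! i)) (snd (cop h ! i)))"

lemma comult_sws: "comult H h = sws (\<lambda>a b. pure [a, b]) h"
proof -
  have "comult H h = (\<Sum>(a, b)\<leftarrow>cop h. pure [a, b])"
    unfolding cop_def by (rule someI_ex) (rule comult_expansion)
  then show ?thesis by (simp add: sws_def sum_list_sum_nth case_prod_beta atLeast0LessThan)
qed

lemma sws_linear: "clinear \<phi> \<Longrightarrow> \<phi> (sws f h) = sws (\<lambda>a b. \<phi> (f a b)) h"
  by (simp add: sws_def clinear_sum)

lemma sws_add [simp]: "sws (\<lambda>a b. f a b + g a b) h = sws f h + sws g h"
  and sws_diff [simp]: "sws (\<lambda>a b. f a b - g a b) h = sws f h - sws g h"
  and sws_uminus [simp]: "sws (\<lambda>a b. - f a b) h = - sws f h"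
  and sws_scale [simp]: "sws (\<lambda>a b. c *\<^sub>C f a b) h = c *\<^sub>C sws f h"
  by (simp_all add: sws_def sum.distrib sum_subtractf sum_negf complex_vector.scale_sum_right)

lemma sws_mult_left: "sws (\<lambda>a b. x * f a b) h = x * sws f h"
  and sws_mult_right: "sws (\<lambda>a b. f a b * x) h = sws f h * x" for x :: "'b::complex_algebra"
  by (simp_all add: sws_def sum_distrib_left sum_distrib_right)

lemma sws_swap: "sws (\<lambda>a b. sws (F a b) k) h = sws (\<lambda>c d. sws (\<lambda>a b. F a b c d) h) k"
  unfolding sws_def by (rule sum.swap)

lemma sws_mem:
  "csubspace W \<Longrightarrow> (\<And>a b. f a b \<in> W) \<Longrightarrow> sws f h \<in> W"
  unfolding sws_def by (rule complex_vector.subspace_sum)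

lemma lift2_comult: "cbilinear f \<Longrightarrow> lift2 f (comult H h) = sws f h"
  by (simp add: comult_sws sws_linear [OF clinear_lift2] lift2_pure)

lemma sweedler_sws: "cbilinear f \<Longrightarrow> sweedler H f h = sws f h"
  by (simp add: sweedler_def lift2_comult)

lemmas H_simps [simp] = clinearD [OF comult_linear] clinearD [OF counit_linear] clinearD [OF antipode_linear]

lemma clinear_sws: "cbilinear f \<Longrightarrow> clinear (sws f)"
  unfolding clinear_iff
  by (simp add: lift2_comult [symmetric] clinear_add [OF clinear_lift2] clinear_scale [OF clinear_lift2])

lemmas bilin = cbilinear_iff algebra_simps scaleC_add_right

text \<open>A trilinear summand extends to the third tensor power, where coassociativity can be
  applied to it.\<close>

lemma coassoc_sws:
  assumes "\<And>a b. clinear (F a b)" "\<And>a c. clinear (\<lambda>b. F a b c)" "\<And>b c. clinear (\<lambda>a. F a b c)"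
  shows "sws (\<lambda>a b. sws (\<lambda>c d. F c d b) a) h = sws (\<lambda>a b. sws (F a) b) h"
proof -
  let ?l = "tens_lift (\<lambda>xs. case xs of [a, b, c] \<Rightarrow> F a b c | _ \<Rightarrow> 0)"
  have l: "clinear ?l" by (rule clinear_tens_lift) (rule multilinear_case3 [OF assms])
  have lp: "?l (pure [a, b, c]) = F a b c" for a b c
    by (simp add: tens_lift_pure [OF multilinear_case3 [OF assms]])
  have "?l (sweedler H (\<lambda>a b. comult H a * pure [b]) h) = ?l (sweedler H (\<lambda>a b. pure [a] * comult H b) h)"
    by (simp only: coassoc)
  moreover have "sweedler H (\<lambda>a b. comult H a * pure [b]) h = sws (\<lambda>a b. comult H a * pure [b]) h"
    "sweedler H (\<lambda>a b. pure [a] * comult H b) h = sws (\<lambda>a b. pure [a] * comult H b) h"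
    by (rule sweedler_sws, simp add: bilin)+
  ultimately show ?thesis
    by (simp add: sws_linear [OF l] comult_sws sws_mult_left [symmetric] sws_mult_right [symmetric] lp)
qed

lemma counit_left_sws: "clinear f \<Longrightarrow> sws (\<lambda>a b. counit H a *\<^sub>C f b) h = f h"
proof -
  assume f: "clinear f"
  have "h = sws (\<lambda>a b. counit H a *\<^sub>C b) h"
    using counit_left [of h] by (subst (asm) sweedler_sws) (auto simp: bilin scaleC_add_left scaleC_complex_def)
  then have "f h = f (sws (\<lambda>a b. counit H a *\<^sub>C b) h)" by simp
  then show ?thesis unfolding sws_linear [OF f] by (simp add: clinear_scale [OF f])
qed

lemma counit_right_sws: "clinear f \<Longrightarrow> sws (\<lambda>a b. counit H b *\<^sub>C f a) h = f h"
proof -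
  assume f: "clinear f"
  have "h = sws (\<lambda>a b. counit H b *\<^sub>C a) h"
    using counit_right [of h] by (subst (asm) sweedler_sws) (auto simp: bilin scaleC_add_left scaleC_complex_def)
  then have "f h = f (sws (\<lambda>a b. counit H b *\<^sub>C a) h)" by simp
  then show ?thesis unfolding sws_linear [OF f] by (simp add: clinear_scale [OF f])
qed

lemma antipode_left_sws: "sws (\<lambda>a b. antipode H a * b) h = counit H h *\<^sub>C 1"
  and antipode_right_sws: "sws (\<lambda>a b. a * antipode H b) h = counit H h *\<^sub>C 1"
proof -
  have "cbilinear (\<lambda>a b. antipode H a * b)" "cbilinear (\<lambda>a b. a * antipode H b)"
    by (simp_all add: cbilinear_iff distrib_left distrib_right)
  from this [THEN sweedler_sws, of h]
  show "sws (\<lambda>a b. antipode H a * b) h = counit H h *\<^sub>C 1"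
    "sws (\<lambda>a b. a * antipode H b) h = counit H h *\<^sub>C 1"
    by (simp_all add: antipode_left antipode_right)
qed

lemma sws_one: "cbilinear f \<Longrightarrow> sws f 1 = f 1 1"
  unfolding lift2_comult [symmetric] comult_one by (rule lift2_pure)

lemma comult_mult_sws: "comult H (h * k) = sws (\<lambda>a b. sws (\<lambda>c d. pure [a * c, b * d]) k) h"
proof -
  have p: "pure [x, y] = pure [x] * pure [y]" for x y :: 'h by simp
  have 1: "cbilinear (\<lambda>c d. pure [a * c, b * d])" for a b :: 'h
    unfolding p by (simp add: bilin del: pure_mult)
  have 2: "cbilinear (\<lambda>a b. sws (\<lambda>c d. pure [a * c, b * d]) k)"
    unfolding p by (simp add: bilin del: pure_mult)
  show ?thesis unfolding comult_mult tens2_mult_def lift2_comult [OF 1] lift2_comult [OF 2] ..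
qed

lemma sws_mult:
  assumes "cbilinear f"
  shows "sws f (h * k) = sws (\<lambda>a b. sws (\<lambda>c d. f (a * c) (b * d)) k) h"
  unfolding lift2_comult [OF assms, symmetric] comult_mult_sws
  by (simp add: sws_linear [OF clinear_lift2 [OF assms]] lift2_pure [OF assms])

subsection \<open>The diagonal action\<close>

abbreviation act_h (infixr "\<rhd>" 75) where "h \<rhd> t \<equiv> diag_act H h t"

lemma diag_pure_linear: "clinear (diag_pure H xs)"
proof (induction xs)
  case Nil
  then show ?case by (simp add: clinear_iff scaleC_add_left scaleC_complex_def)
next
  case (Cons x xs)
  have b: "cbilinear (\<lambda>a b. pure [a * x] * diag_pure H xs b)"
    by (simp add: bilin clinearD [OF Cons] del: pure_mult)
  show ?case using clinear_sws [OF b] by (simp add: sweedler_sws [OF b] clinear_iff)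
qed

lemmas diag_pure_simps [simp] = clinearD [OF diag_pure_linear]

lemma diag_pure_Cons: "diag_pure H (x # xs) h = sws (\<lambda>a b. pure [a * x] * diag_pure H xs b) h"
  by (simp, rule sweedler_sws) (simp add: bilin del: pure_mult)

declare diag_pure.simps(2) [simp del]

lemma multilinear_diag_pure: "multilinear (\<lambda>xs. diag_pure H xs h)"
  unfolding multilinear_def
proof (intro allI)
  fix xs ys
  have "clinear (\<lambda>x. diag_pure H (xs @ x # ys) h)" for h
  proof (induction xs arbitrary: h)
    case Nil
    show ?case by (simp add: clinear_iff diag_pure_Cons algebra_simps)
  next
    case (Cons z zs)
    show ?case
      by (simp add: clinear_iff diag_pure_Cons clinearD [OF Cons.IH] algebra_simps)
  qed
  then show "clinear (\<lambda>x. diag_pure H (xs @ x # ys) h)" .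
qed

lemma act_linear: "clinear (diag_act H h)"
  and act_pure: "h \<rhd> pure xs = diag_pure H xs h"
  unfolding diag_act_def by (simp_all add: clinear_tens_lift tens_lift_pure multilinear_diag_pure)

lemmas act_simps [simp] = clinearD [OF act_linear]

lemma act_linear_left: "clinear (\<lambda>h. h \<rhd> t)"
proof (rule clinearI)
  show "(h + k) \<rhd> t = h \<rhd> t + k \<rhd> t" for h k
    by (rule tens_linear_eq [OF act_linear clinear_add_fun [OF act_linear act_linear]]) (simp add: act_pure)
  show "(c *\<^sub>C h) \<rhd> t = c *\<^sub>C h \<rhd> t" for c h
    by (rule tens_linear_eq [OF act_linear clinear_scale_fun [OF act_linear]]) (simp add: act_pure)
qed

lemmas act_simps_left [simp] = clinearD [OF act_linear_left]

lemma act_1 [simp]: "h \<rhd> 1 = counit H h *\<^sub>C 1"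
  unfolding pure_Nil [symmetric] act_pure by (simp add: pure_Nil)

lemma act_pure_Cons: "h \<rhd> pure (x # xs) = sws (\<lambda>a b. pure [a * x] * (b \<rhd> pure xs)) h"
  unfolding act_pure by (rule diag_pure_Cons)

lemma act_pure1 [simp]: "h \<rhd> pure [x] = pure [h * x]"
proof -
  have "h \<rhd> pure [x] = sws (\<lambda>a b. counit H b *\<^sub>C pure [a * x]) h"
    unfolding act_pure_Cons by (simp add: pure_Nil)
  also have "\<dots> = pure [h * x]"
    by (rule counit_right_sws) (simp add: clinear_iff algebra_simps)
  finally show ?thesis .
qed

text \<open>Splitting off one letter is the definition of the action; for longer left factors
  coassociativity rebrackets the iterated coproduct.\<close>

lemma act_mult: "h \<rhd> (x * y) = sws (\<lambda>a b. (a \<rhd> x) * (b \<rhd> y)) h"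
proof -
  have 1: "h \<rhd> (pure xs * pure ys) = sws (\<lambda>a b. (a \<rhd> pure xs) * (b \<rhd> pure ys)) h" for xs ys h
  proof (induction xs arbitrary: h)
    case Nil
    then show ?case by (simp add: pure_Nil counit_left_sws [OF act_linear_left])
  next
    case (Cons x xs)
    define F where "F a b c = pure [a * x] * ((b \<rhd> pure xs) * (c \<rhd> pure ys))" for a b c
    have F: "clinear (F a b)" "clinear (\<lambda>b. F a b c)" "clinear (\<lambda>a. F a b c)" for a b c
      by (simp_all add: F_def clinear_iff algebra_simps)
    have "h \<rhd> (pure (x # xs) * pure ys) = sws (\<lambda>a b. pure [a * x] * (b \<rhd> (pure xs * pure ys))) h"
      unfolding pure_mult append_Cons act_pure_Cons ..
    also have "\<dots> = sws (\<lambda>a b. sws (F a) b) h"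
      unfolding Cons.IH F_def by (simp only: sws_mult_left)
    also have "\<dots> = sws (\<lambda>a b. sws (\<lambda>c d. F c d b) a) h"
      by (rule coassoc_sws [symmetric]) (rule F)+
    also have "\<dots> = sws (\<lambda>a b. (a \<rhd> pure (x # xs)) * (b \<rhd> pure ys)) h"
      unfolding act_pure_Cons F_def by (simp only: sws_mult_right mult.assoc [symmetric])
    finally show ?case .
  qed
  have 2: "h \<rhd> (pure xs * y) = sws (\<lambda>a b. (a \<rhd> pure xs) * (b \<rhd> y)) h" for xs
    by (rule tens_linear_eq [of "\<lambda>y. h \<rhd> (pure xs * y)" _ y]) (simp_all add: clinear_iff algebra_simps 1 del: pure_mult)
  show ?thesis
    by (rule tens_linear_eq [of "\<lambda>x. h \<rhd> (x * y)" _ x]) (simp_all add: clinear_iff algebra_simps 2)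
qed

lemma act_mult_left: "(h * k) \<rhd> t = h \<rhd> k \<rhd> t"
proof -
  have "(h * k) \<rhd> pure xs = h \<rhd> k \<rhd> pure xs" for xs h k
  proof (induction xs arbitrary: h k)
    case Nil
    then show ?case by (simp add: pure_Nil counit_mult mult.commute)
  next
    case (Cons x xs)
    have b: "cbilinear (\<lambda>a b. pure [a * x] * (b \<rhd> pure xs))"
      by (simp add: bilin del: pure_mult)
    have "(h * k) \<rhd> pure (x # xs)
        = sws (\<lambda>a b. sws (\<lambda>c d. pure [a * c * x] * ((b * d) \<rhd> pure xs)) k) h"
      unfolding act_pure_Cons by (rule sws_mult [OF b])
    also have "\<dots> = sws (\<lambda>c d. sws (\<lambda>a b. (a \<rhd> pure [c * x]) * (b \<rhd> d \<rhd> pure xs)) h) k"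
      unfolding Cons.IH by (subst sws_swap) (simp only: act_pure1 mult.assoc)
    also have "\<dots> = h \<rhd> k \<rhd> pure (x # xs)"
      unfolding act_pure_Cons sws_linear [OF act_linear] act_mult ..
    finally show ?case .
  qed
  then show ?thesis
    by (rule tens_linear_eq [OF act_linear clinear_compose [OF act_linear act_linear]])
qed

lemma act_one [simp]: "1 \<rhd> t = t"
proof (rule tens_linear_eq [OF act_linear clinear_id])
  show "1 \<rhd> pure xs = pure xs" for xs
  proof (induction xs)
    case Nil
    then show ?case by (simp add: pure_Nil counit_one)
  next
    case (Cons x xs)
    have b: "cbilinear (\<lambda>a b. pure [a * x] * (b \<rhd> pure xs))"
      by (simp add: bilin del: pure_mult)
    show ?case unfolding act_pure_Cons sws_one [OF b] by (simp add: Cons)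
  qed
qed

lemma act_degree: "degree_map 0 (diag_act H h)"
proof -
  have "h \<rhd> pure xs \<in> tpow (length xs)" for xs h
  proof (induction xs arbitrary: h)
    case Nil
    then show ?case by (simp add: pure_Nil) (simp add: pure_Nil [symmetric] pure_tpow tpow_closed)
  next
    case (Cons x xs)
    have "pure [a * x] * (b \<rhd> pure xs) \<in> tpow (length (x # xs))" for a b
      using tpow_mult [OF pure_tpow [of "[a * x]" 1] Cons] by simp
    then show ?case unfolding act_pure_Cons by (intro sws_mem subspace_tpow)
  qed
  then show ?thesis by (rule degree_map_0I [OF act_linear])
qed

text \<open>Multiplicativity of the coproduct is its equivariance for the diagonal action. It is the
  reason why the derivation commutes with \<open>H\<close>.\<close>

lemma act_comult: "h \<rhd> comult H k = comult H (h * k)"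
proof -
  have "h \<rhd> pure [c, d] = sws (\<lambda>a b. pure [a * c, b * d]) h" for c d
    by (subst act_pure_Cons) simp
  then show ?thesis
    unfolding comult_mult_sws comult_sws [of k] sws_linear [OF act_linear] by (simp only:) (rule sws_swap)
qed

subsection \<open>The derivation extending the coproduct\<close>

text \<open>The Koszul sign as a linear operator, so that graded identities hold for all tensors
  without mention of degrees.\<close>

definition parity :: "'h tens \<Rightarrow> 'h tens" where "parity = wt (\<lambda>n. (- 1) ^ n)"

lemma parity_linear: "clinear parity" unfolding parity_def by (rule clinear_wt)

lemmas parity_simps [simp] = clinearD [OF parity_linear]

lemma parity_tpow: "x \<in> tpow n \<Longrightarrow> parity x = (- 1) ^ n *\<^sub>C x" by (simp add: parity_def wt_tpow)

lemma parity_pure: "parity (pure xs) = (- 1) ^ length xs *\<^sub>C pure xs" by (simp add: parity_tpow pure_tpow)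

lemma parity_1 [simp]: "parity 1 = 1" unfolding pure_Nil [symmetric] by (simp add: parity_pure)

lemma parity_pure1: "parity (pure [x]) = - pure [x]" by (simp add: parity_pure)

lemma parity_degree: "degree_map 0 parity" unfolding parity_def by (rule degree_map_wt)

lemma parity_mult: "parity (x * y) = parity x * parity y"
proof (rule tens_linear_eq [of "\<lambda>x. parity (x * y)" "\<lambda>x. parity x * parity y"])
  fix xs
  show "parity (pure xs * y) = parity (pure xs) * parity y"
    by (rule tens_linear_eq [of "\<lambda>y. parity (pure xs * y)" "\<lambda>y. parity (pure xs) * parity y"])
      (simp_all add: clinear_iff algebra_simps parity_pure power_add)
qed (simp_all add: clinear_iff algebra_simps)

lemma parity_parity [simp]: "parity (parity x) = x"
  by (rule tens_linear_eq [OF clinear_compose [OF parity_linear parity_linear] clinear_id])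
    (simp add: parity_pure power_add [symmetric])

lemma parity_odd:
  assumes "degree_map 1 f \<or> degree_map (- 1) f"
  shows "parity (f x) = - f (parity x)"
proof (rule tens_linear_eq_tpow [of "\<lambda>x. parity (f x)" "\<lambda>x. - f (parity x)"])
  have f: "clinear f" using assms degree_map_linear by blast
  note [simp] = clinearD [OF f]
  show "clinear (\<lambda>x. parity (f x))" "clinear (\<lambda>x. - f (parity x))" by (simp_all add: clinear_iff algebra_simps)
  show "parity (f x) = - f (parity x)" if x: "x \<in> tpow n" for n x
  proof (cases "degree_map 1 f")
    case True
    then have "f x \<in> tpow (Suc n)" using x by (simp add: degree_map_1)
    then show ?thesis by (simp add: parity_tpow [OF x] parity_tpow)
  next
    case False
    then have d: "degree_map (- 1) f" using assms by simp
    show ?thesis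
    proof (cases n)
      case 0
      then show ?thesis using d x by (simp add: degree_map_neg1 parity_tpow [OF x])
    next
      case (Suc m)
      then have "f x \<in> tpow m" using d x by (simp add: degree_map_neg1)
      then show ?thesis by (simp add: parity_tpow [OF x] parity_tpow Suc)
    qed
  qed
qed

lemma parity_comult [simp]: "parity (comult H x) = comult H x"
  using parity_tpow [OF comult_tensor] by simp

abbreviation D where "D \<equiv> tens_dif H"

lemma clinear_pure_at: "clinear (\<lambda>x. pure (xs @ x # ys))"
  using multilinear_pure unfolding multilinear_def by blast

lemma clinear_insert_at:
  assumes "clinear \<phi>" "k < length xs + length ys + 1"
  shows "clinear (\<lambda>x. pure (take k (xs @ x # ys)) * \<phi> ((xs @ x # ys) ! k) * pure (drop (Suc k) (xs @ x # ys)))"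
proof -
  consider "k < length xs" | "k = length xs" | j where "k = Suc (length xs + j)" "j < length ys"
    using assms(2) by (metis Suc_eq_plus1 add_Suc_right less_Suc_eq_le less_imp_Suc_add linorder_neqE_nat nat_add_left_cancel_less not_less)
  then show ?thesis
  proof cases
    case 1
    then have e: "take k (xs @ x # ys) = take k xs" "(xs @ x # ys) ! k = xs ! k"
      "drop (Suc k) (xs @ x # ys) = drop (Suc k) xs @ x # ys" for x
      by (simp_all add: nth_append)
    show ?thesis unfolding e by (intro clinear_intros clinear_pure_at)
  next
    case 2
    then show ?thesis
      by (simp, intro clinear_intros assms(1))
  next
    case 3
    then have e: "take k (xs @ x # ys) = xs @ x # take j ys" "(xs @ x # ys) ! k = ys ! j"
      "drop (Suc k) (xs @ x # ys) = drop (Suc j) ys" for x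
      by (simp_all add: nth_append)
    show ?thesis unfolding e by (intro clinear_intros clinear_pure_at)
  qed
qed

lemma multilinear_D: "multilinear (\<lambda>xs. \<Sum>i<length xs.
     (- 1) ^ i *\<^sub>C (pure (take i xs) * comult H (xs ! i) * pure (drop (Suc i) xs)))"
  unfolding multilinear_def length_append length_Cons
  by (intro allI clinear_sum_fun clinear_scale_fun clinear_insert_at comult_linear) simp

lemma D_linear: "clinear D" unfolding tens_dif_def by (rule clinear_tens_lift) (rule multilinear_D)

lemmas D_simps [simp] = clinearD [OF D_linear]

lemma D_pure: "D (pure xs) = (\<Sum>i<length xs.
     (- 1) ^ i *\<^sub>C (pure (take i xs) * comult H (xs ! i) * pure (drop (Suc i) xs)))"
  unfolding tens_dif_def by (rule tens_lift_pure) (rule multilinear_D)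

lemma D_1 [simp]: "D 1 = 0" unfolding pure_Nil [symmetric] by (simp add: D_pure)

lemma D_Cons: "D (pure [x] * pure xs) = comult H x * pure xs - pure [x] * D (pure xs)"
proof -
  have "D (pure (x # xs)) = comult H x * pure xs +
     (\<Sum>i<length xs. (- 1) ^ Suc i *\<^sub>C (pure [x] * (pure (take i xs) * comult H (xs ! i) * pure (drop (Suc i) xs))))"
    unfolding D_pure length_Cons sum.lessThan_Suc_shift
    by (simp add: pure_Nil mult.assoc [symmetric])
  also have "\<dots> = comult H x * pure xs - pure [x] * D (pure xs)"
    by (simp add: D_pure sum_distrib_left complex_vector.scale_minus_left sum_negf)
  finally show ?thesis by simp
qed

lemma D_pure1 [simp]: "D (pure [x]) = comult H x"
  using D_Cons [of x "[]"] by (simp add: pure_Nil)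

lemma D_mult: "D (x * y) = D x * y + parity x * D y"
proof (rule tens_linear_eq [of "\<lambda>x. D (x * y)" "\<lambda>x. D x * y + parity x * D y"])
  fix xs
  show "D (pure xs * y) = D (pure xs) * y + parity (pure xs) * D y"
  proof (rule tens_linear_eq [of "\<lambda>y. D (pure xs * y)" "\<lambda>y. D (pure xs) * y + parity (pure xs) * D y"])
    fix ys
    show "D (pure xs * pure ys) = D (pure xs) * pure ys + parity (pure xs) * D (pure ys)"
    proof (induction xs)
      case Nil
      then show ?case by (simp add: pure_Nil)
    next
      case (Cons x xs)
      have "D (pure (x # xs) * pure ys) = D (pure [x] * pure (xs @ ys))" by simp
      also have "\<dots> = comult H x * (pure xs * pure ys) - pure [x] * D (pure xs * pure ys)"
        unfolding D_Cons by simp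
      also have "\<dots> = D (pure [x] * pure xs) * pure ys + parity (pure [x] * pure xs) * D (pure ys)"
        unfolding Cons D_Cons parity_mult parity_pure1 by (simp add: algebra_simps del: pure_mult)
      finally show ?case by simp
    qed
  qed (simp_all add: clinear_iff algebra_simps del: pure_mult)
qed (simp_all add: clinear_iff algebra_simps)

text \<open>Coassociativity: the Koszul sign gives the two ways of splitting a coproduct further
  opposite signs. The derivation therefore squares to zero on generators.\<close>

lemma D_comult [simp]: "D (comult H h) = 0"
proof -
  have F: "clinear (\<lambda>c. pure [a] * pure [b] * pure [c])" "clinear (\<lambda>b. pure [a] * pure [b] * pure [c])"
    "clinear (\<lambda>a. pure [a] * pure [b] * pure [c])" for a b c :: 'h
    by (simp_all add: clinear_iff algebra_simps del: pure_mult)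
  have p: "pure [a, b] = pure [a] * pure [b]" for a b :: 'h by simp
  have "D (pure [a] * pure [b]) = sws (\<lambda>c d. pure [c] * pure [d] * pure [b]) a - sws (\<lambda>c d. pure [a] * pure [c] * pure [d]) b"
    for a b
    unfolding D_mult parity_pure1 D_pure1 comult_sws p
    by (simp only: sws_mult_left [symmetric] sws_mult_right [symmetric] mult.assoc mult_minus_left
        add_uminus_conv_diff sws_uminus)
  then show ?thesis
    unfolding comult_sws [of h] p sws_linear [OF D_linear]
    using coassoc_sws [of "\<lambda>a b c. pure [a] * pure [b] * pure [c]" h, OF F] by (simp del: pure_mult)
qed

lemma D_D [simp]: "D (D x) = 0"
proof (rule tens_linear_eq [OF clinear_compose [OF D_linear D_linear] clinear_const_0])
  show "D (D (pure xs)) = 0" for xs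
  proof (induction xs)
    case Nil
    then show ?case by (simp add: pure_Nil)
  next
    case (Cons x xs)
    then show ?case
      by (simp add: pure_Cons [of x xs] D_mult parity_pure1 parity_mult del: pure_mult)
  qed
qed

lemma D_degree: "degree_map 1 D"
proof -
  have "D (pure xs) \<in> tpow (Suc (length xs))" for xs
  proof (induction xs)
    case Nil
    then show ?case by (simp add: pure_Nil tpow_closed)
  next
    case (Cons x xs)
    have "comult H x * pure xs \<in> tpow (2 + length xs)" "pure [x] * D (pure xs) \<in> tpow (1 + Suc (length xs))"
      by (intro tpow_mult comult_tensor pure_tpow Cons; simp)+
    then show ?case unfolding pure_Cons [of x xs] D_Cons by (simp add: tpow_closed)
  qed
  then show ?thesis by (rule degree_map_1I [OF D_linear])
qed

lemma parity_D: "parity (D x) = - D (parity x)" by (rule parity_odd) (simp add: D_degree)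

lemma act_D: "h \<rhd> D x = D (h \<rhd> x)"
proof (rule tens_linear_eq [OF clinear_compose [OF D_linear act_linear] clinear_compose [OF act_linear D_linear]])
  show "h \<rhd> D (pure xs) = D (h \<rhd> pure xs)" for xs
  proof (induction xs arbitrary: h)
    case Nil
    then show ?case by (simp add: pure_Nil)
  next
    case (Cons x xs)
    have "h \<rhd> D (pure (x # xs)) = h \<rhd> (comult H x * pure xs) - h \<rhd> (pure [x] * D (pure xs))"
      unfolding pure_Cons [of x xs] D_Cons by simp
    also have "\<dots> = sws (\<lambda>a b. comult H (a * x) * (b \<rhd> pure xs) - pure [a * x] * D (b \<rhd> pure xs)) h"
      unfolding act_mult act_comult act_pure1 Cons by simp
    also have "\<dots> = sws (\<lambda>a b. D (pure [a * x] * (b \<rhd> pure xs))) h"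
      unfolding D_mult parity_pure1 by simp
    also have "\<dots> = D (h \<rhd> pure (x # xs))"
      unfolding act_pure_Cons sws_linear [OF D_linear] ..
    finally show ?case .
  qed
qed

subsection \<open>The antipode\<close>

text \<open>Uniqueness of convolution inverses: the sum of
  \<open>S (h0 k0) h1 k1 S (k2) S (h2)\<close> is evaluated twice. Contracting the first two groups
  leaves \<open>S k S h\<close>, contracting the last two leaves \<open>S (h k)\<close>.\<close>

lemma antipode_mult: "antipode H (h * k) = antipode H k * antipode H h"
proof -
  let ?S = "antipode H"
  define G where "G a b c d e f = ?S (a * d) * (b * e) * (?S f * ?S c)" for a b c d e f :: 'h
  have lin: "clinear (G a b c d e)" "clinear (\<lambda>e. G a b c d e f)" "clinear (\<lambda>d. G a b c d e f)"
     "clinear (\<lambda>c. G a b c d e f)" "clinear (\<lambda>b. G a b c d e f)" "clinear (\<lambda>a. G a b c d e f)"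
    for a b c d e f by (simp_all add: clinear_iff G_def algebra_simps)
  define T where "T a b c = sws (\<lambda>d f. sws (\<lambda>d0 d1. G a b c d0 d1 f) d) k" for a b c
  have T_lin: "clinear (T a b)" "clinear (\<lambda>b. T a b c)" "clinear (\<lambda>a. T a b c)" for a b c
    by (simp_all add: T_def clinear_iff clinearD [OF lin(4)] clinearD [OF lin(5)] clinearD [OF lin(6)])
  have bil: "cbilinear (\<lambda>u v. ?S u * v)" by (simp add: cbilinear_iff distrib_left distrib_right)
  have "sws (\<lambda>a b. sws (\<lambda>c d. T c d b) a) h = ?S k * ?S h"
  proof -
    have G: "G a b c d e f = (?S (a * d) * (b * e)) * (?S f * ?S c)" for a b c d e f by (simp add: G_def)
    have "sws (\<lambda>c d. T c d b) a = sws (\<lambda>d f. sws (\<lambda>c c1. sws (\<lambda>d0 d1. G c c1 b d0 d1 f) d) a) k" for a b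
      unfolding T_def by (rule sws_swap)
    also have "\<dots> a b = sws (\<lambda>d f. (counit H a * counit H d) *\<^sub>C (?S f * ?S b)) k" for a b
    proof -
      have "sws (\<lambda>c c1. sws (\<lambda>d0 d1. G c c1 b d0 d1 f) d) a = sws (\<lambda>u v. ?S u * v) (a * d) * (?S f * ?S b)" for d f
        unfolding sws_mult [OF bil] G by (simp only: sws_mult_right)
      then show ?thesis unfolding antipode_left_sws counit_mult by simp
    qed
    also have "\<dots> a b = counit H a *\<^sub>C (?S k * ?S b)" for a b
    proof -
      have "clinear (\<lambda>f. ?S f * ?S b)" by (simp add: clinear_iff algebra_simps)
      from counit_left_sws [OF this, of k] show ?thesis
        unfolding scaleC_scaleC [symmetric] sws_scale by simp
    qed
    finally have "sws (\<lambda>a b. sws (\<lambda>c d. T c d b) a) h = sws (\<lambda>a b. counit H a *\<^sub>C (?S k * ?S b)) h" by simp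
    also have "\<dots> = ?S k * ?S h" by (rule counit_left_sws) (simp add: clinear_iff algebra_simps)
    finally show ?thesis .
  qed
  moreover have "sws (\<lambda>a b. sws (T a) b) h = ?S (h * k)"
  proof -
    have "T a b c = ?S (a * k) * (b * ?S c)" for a b c
    proof -
      have "T a b c = sws (\<lambda>d f. sws (G a b c d) f) k"
        unfolding T_def by (rule coassoc_sws) (rule lin)+
      also have "\<dots> = sws (\<lambda>d f. counit H f *\<^sub>C (?S (a * d) * (b * ?S c))) k"
      proof -
        have "G a b c d = (\<lambda>e f. (?S (a * d) * b) * ((e * ?S f) * ?S c))" for d
          by (intro ext) (simp add: G_def mult.assoc)
        then have "sws (G a b c d) f = (?S (a * d) * b) * (sws (\<lambda>e f. e * ?S f) f * ?S c)" for d f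
          by (simp only: sws_mult_left sws_mult_right)
        then show ?thesis unfolding antipode_right_sws by (simp add: mult.assoc)
      qed
      also have "\<dots> = ?S (a * k) * (b * ?S c)"
        by (rule counit_right_sws) (simp add: clinear_iff algebra_simps)
      finally show ?thesis .
    qed
    then have "T a = (\<lambda>b c. ?S (a * k) * (b * ?S c))" for a by (intro ext)
    then have "sws (T a) b = ?S (a * k) * sws (\<lambda>b c. b * ?S c) b" for a b
      by (simp only: sws_mult_left)
    then have "sws (\<lambda>a b. sws (T a) b) h = sws (\<lambda>a b. counit H b *\<^sub>C ?S (a * k)) h"
      unfolding antipode_right_sws by simp
    also have "\<dots> = ?S (h * k)" by (rule counit_right_sws) (simp add: clinear_iff algebra_simps)
    finally show ?thesis .
  qed
  moreover have "sws (\<lambda>a b. sws (\<lambda>c d. T c d b) a) h = sws (\<lambda>a b. sws (T a) b) h"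
    by (rule coassoc_sws) (rule T_lin)+
  ultimately show ?thesis by simp
qed

lemma antipode_one: "antipode H 1 = 1"
proof -
  have "sws (\<lambda>a b. antipode H a * b) 1 = antipode H 1 * 1"
    by (rule sws_one) (simp add: cbilinear_iff distrib_left distrib_right)
  then show ?thesis unfolding antipode_left_sws by (simp add: counit_one)
qed

end

section \<open>Coinvariants and the cyclic operator\<close>

locale hopf_character = hopf_algebra H for H :: "'h::complex_algebra_1 hopf" +
  fixes \<delta> :: "'h \<Rightarrow> complex"
  assumes \<delta>_character: "character \<delta>"
    and twisted_involution: "twisted_antipode H \<delta> (twisted_antipode H \<delta> h) = h"
begin

abbreviation Sd where "Sd \<equiv> twisted_antipode H \<delta>"

lemma \<delta>_linear: "clinear \<delta>" and \<delta>_mult: "\<delta> (x * y) = \<delta> x * \<delta> y"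
  using \<delta>_character by (simp_all add: character_def)

lemmas \<delta>_simps [simp] = clinearD [OF \<delta>_linear, unfolded scaleC_complex_def]

lemma \<delta>_one: "\<delta> 1 = 1"
proof -
  obtain x where "\<delta> x \<noteq> 0" using \<delta>_character by (auto simp: character_def)
  then show ?thesis using \<delta>_mult [of x 1] by simp
qed

lemma cbilinear_Sd: "cbilinear (\<lambda>a b. \<delta> a *\<^sub>C antipode H b)"
  by (simp add: bilin scaleC_add_left)

lemma Sd_sws: "Sd h = sws (\<lambda>a b. \<delta> a *\<^sub>C antipode H b) h"
  unfolding twisted_antipode_def by (rule sweedler_sws [OF cbilinear_Sd])

lemma Sd_linear: "clinear Sd"
  unfolding Sd_sws [abs_def] by (rule clinear_sws [OF cbilinear_Sd])

lemmas Sd_simps [simp] = clinearD [OF Sd_linear]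

lemma Sd_mult: "Sd (h * k) = Sd k * Sd h"
proof -
  have "Sd (h * k) = sws (\<lambda>a b. sws (\<lambda>c d. (\<delta> c *\<^sub>C antipode H d) * (\<delta> a *\<^sub>C antipode H b)) k) h"
    unfolding Sd_sws sws_mult [OF cbilinear_Sd] by (simp add: \<delta>_mult antipode_mult mult.commute)
  also have "\<dots> = Sd k * Sd h"
    unfolding sws_mult_right sws_mult_left Sd_sws ..
  finally show ?thesis .
qed

lemma Sd_one: "Sd 1 = 1"
  unfolding Sd_sws sws_one [OF cbilinear_Sd] by (simp add: \<delta>_one antipode_one)

lemma Sd_left: "sws (\<lambda>a b. Sd a * b) h = \<delta> h *\<^sub>C 1"
proof -
  let ?F = "\<lambda>c d b. \<delta> c *\<^sub>C (antipode H d * b)"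
  have F: "clinear (?F c d)" "clinear (\<lambda>d. ?F c d b)" "clinear (\<lambda>c. ?F c d b)" for b c d
    by (simp_all add: clinear_iff algebra_simps scaleC_add_right scaleC_add_left)
  have "sws (\<lambda>a b. Sd a * b) h = sws (\<lambda>a b. sws (\<lambda>c d. ?F c d b) a) h"
    unfolding Sd_sws by (simp add: sws_mult_right [symmetric] del: sws_scale)
  also have "\<dots> = sws (\<lambda>a b. sws (?F a) b) h" by (rule coassoc_sws [OF F])
  also have "\<dots> = sws (\<lambda>a b. counit H b *\<^sub>C (\<delta> a *\<^sub>C 1)) h"
    unfolding sws_scale antipode_left_sws by (simp add: mult.commute)
  also have "\<dots> = \<delta> h *\<^sub>C 1"
    by (rule counit_right_sws) (simp add: clinear_iff scaleC_add_left)
  finally show ?thesis .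
qed

lemma Sd_act_left: "sws (\<lambda>a b. Sd a \<rhd> b \<rhd> y) h = \<delta> h *\<^sub>C y"
proof -
  have "sws (\<lambda>a b. Sd a \<rhd> b \<rhd> y) h = sws (\<lambda>a b. Sd a * b) h \<rhd> y"
    unfolding sws_linear [OF act_linear_left] act_mult_left ..
  then show ?thesis unfolding Sd_left by simp
qed

text \<open>Integration by parts. Inserting \<open>h1 S (h2)\<close> into the second argument gives
  the sum of \<open>F (h0 x) (h1 S (h2) y)\<close>; coinvariance replaces the common action of
  \<open>h0\<close>, \<open>h1\<close> by \<open>\<delta>\<close>, and
  \<open>\<delta> (h0) S (h1)\<close> is the twisted antipode. The subspace is left arbitrary: it is
  zero for maps on coinvariants, and the span of the relations for functions and for forms.\<close>

lemma coinvariant_move: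
  fixes F :: "'h tens \<Rightarrow> 'h tens \<Rightarrow> 'v::complex_vector"
  assumes F: "cbilinear F" and W: "csubspace W"
    and co: "\<And>h x y. sws (\<lambda>a b. F (a \<rhd> x) (b \<rhd> y)) h - \<delta> h *\<^sub>C F x y \<in> W"
  shows "F (h \<rhd> x) y - F x (Sd h \<rhd> y) \<in> W"
proof -
  note Fs = F [unfolded cbilinear_iff, THEN conjunct1, rule_format]
    F [unfolded cbilinear_iff, THEN conjunct2, THEN conjunct1, rule_format]
    F [unfolded cbilinear_iff, THEN conjunct2, THEN conjunct2, THEN conjunct1, rule_format]
    F [unfolded cbilinear_iff, THEN conjunct2, THEN conjunct2, THEN conjunct2, rule_format]
  let ?S = "antipode H"
  let ?G = "\<lambda>a b c. F (a \<rhd> x) (b \<rhd> ?S c \<rhd> y)"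
  have G: "clinear (?G a b)" "clinear (\<lambda>b. ?G a b c)" "clinear (\<lambda>a. ?G a b c)" for a b c
    by (simp_all add: clinear_iff Fs)
  have FR: "clinear (F z)" for z using F by (simp add: cbilinear_def)
  have "sws (\<lambda>a b. sws (\<lambda>c d. ?G c d b) a - \<delta> a *\<^sub>C F x (?S b \<rhd> y)) h \<in> W"
    by (rule sws_mem [OF W]) (rule co)
  moreover have "sws (\<lambda>a b. sws (\<lambda>c d. ?G c d b) a) h = F (h \<rhd> x) y"
  proof -
    have "sws (\<lambda>a b. sws (\<lambda>c d. ?G c d b) a) h = sws (\<lambda>a b. sws (?G a) b) h"
      by (rule coassoc_sws [OF G])
    also have "\<dots> = sws (\<lambda>a b. counit H b *\<^sub>C F (a \<rhd> x) y) h"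
    proof -
      have "sws (?G a) b = F (a \<rhd> x) (sws (\<lambda>c d. c * ?S d) b \<rhd> y)" for a b
        unfolding sws_linear [OF act_linear_left] sws_linear [OF FR] act_mult_left ..
      then show ?thesis unfolding antipode_right_sws by (simp add: Fs)
    qed
    also have "\<dots> = F (h \<rhd> x) y"
      by (rule counit_right_sws) (simp add: clinear_iff Fs)
    finally show ?thesis .
  qed
  moreover have "sws (\<lambda>a b. \<delta> a *\<^sub>C F x (?S b \<rhd> y)) h = F x (Sd h \<rhd> y)"
    unfolding Sd_sws sws_linear [OF act_linear_left] sws_linear [OF FR] by (simp add: Fs)
  ultimately show ?thesis by simp
qed

lemma coinvariant_move_eq:
  fixes F :: "'h tens \<Rightarrow> 'h tens \<Rightarrow> 'v::complex_vector"
  assumes "cbilinear F" "\<And>h x y. sws (\<lambda>a b. F (a \<rhd> x) (b \<rhd> y)) h = \<delta> h *\<^sub>C F x y"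
  shows "F (h \<rhd> x) y = F x (Sd h \<rhd> y)"
  using coinvariant_move [OF assms(1), of "{0}"] assms(2) by (simp add: complex_vector.subspace_0)

subsection \<open>Identifying the coinvariants\<close>

text \<open>Scalars have no first letter; the value 0 on them makes this a map of degree -1 on the
  unital algebra.\<close>

definition Phi :: "'h tens \<Rightarrow> 'h tens"
  where "Phi = tens_lift (\<lambda>xs. case xs of [] \<Rightarrow> 0 | x # ys \<Rightarrow> Sd x \<rhd> pure ys)"

lemma multilinear_Phi: "multilinear (\<lambda>xs. case xs of [] \<Rightarrow> 0 | x # ys \<Rightarrow> Sd x \<rhd> pure ys)"
  unfolding multilinear_def
proof (intro allI)
  fix xs ys :: "'h list"
  show "clinear (\<lambda>x. case xs @ x # ys of [] \<Rightarrow> 0 | x # ys \<Rightarrow> Sd x \<rhd> pure ys)"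
  proof (cases xs)
    case Nil
    then show ?thesis by (simp add: clinear_iff)
  next
    case (Cons z zs)
    then show ?thesis using clinear_compose [OF clinear_pure_at act_linear] by simp
  qed
qed

lemma Phi_linear: "clinear Phi" unfolding Phi_def by (rule clinear_tens_lift [OF multilinear_Phi])

lemmas Phi_simps [simp] = clinearD [OF Phi_linear]

lemma Phi_1 [simp]: "Phi 1 = 0" unfolding pure_Nil [symmetric] Phi_def by (simp add: tens_lift_pure [OF multilinear_Phi])

lemma Phi_Cons: "Phi (pure [x] * y) = Sd x \<rhd> y"
  by (rule tens_linear_eq [of "\<lambda>y. Phi (pure [x] * y)" "\<lambda>y. Sd x \<rhd> y"])
    (simp_all add: clinear_iff algebra_simps Phi_def tens_lift_pure [OF multilinear_Phi] clinearD [OF clinear_tens_lift [OF multilinear_Phi]])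

text \<open>The twisted antipode reverses products, so \<open>h\<close> appears next to the
  remaining letters as the sum of \<open>Sd (h0) h1\<close>, which is
  \<open>\<delta> h\<close>.\<close>

lemma Phi_act: "Phi (h \<rhd> v) = \<delta> h *\<^sub>C Phi v"
proof (rule tens_linear_eq [OF clinear_compose [OF act_linear Phi_linear] clinear_scale_fun [OF Phi_linear]])
  fix xs
  show "Phi (h \<rhd> pure xs) = \<delta> h *\<^sub>C Phi (pure xs)"
  proof (cases xs)
    case Nil
    then show ?thesis by (simp add: pure_Nil)
  next
    case (Cons x ys)
    have "Phi (h \<rhd> (pure [x] * pure ys)) = sws (\<lambda>a b. Sd (a * x) \<rhd> b \<rhd> pure ys) h"
      unfolding act_mult sws_linear [OF Phi_linear] act_pure1 Phi_Cons ..
    also have "\<dots> = Sd x \<rhd> sws (\<lambda>a b. Sd a \<rhd> b \<rhd> pure ys) h"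
      unfolding sws_linear [OF act_linear] Sd_mult act_mult_left ..
    also have "\<dots> = \<delta> h *\<^sub>C Phi (pure [x] * pure ys)"
      unfolding Sd_act_left Phi_Cons by simp
    finally show ?thesis using Cons by simp
  qed
qed

lemma Phi_move: "Phi ((h \<rhd> x) * y) = Phi (x * (Sd h \<rhd> y))"
proof (rule coinvariant_move_eq)
  show "cbilinear (\<lambda>x y. Phi (x * y))" by (simp add: bilin)
  show "sws (\<lambda>a b. Phi ((a \<rhd> x) * (b \<rhd> y))) h = \<delta> h *\<^sub>C Phi (x * y)" for h x y
    unfolding sws_linear [OF Phi_linear, symmetric] act_mult [symmetric] by (rule Phi_act)
qed

definition e :: "'h tens" where "e = pure [1]"

lemma e_tpow: "e \<in> tpow 1" by (simp add: e_def pure_tpow)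

lemma act_e: "h \<rhd> e = pure [h]" by (simp add: e_def)

lemma Phi_e [simp]: "Phi (e * y) = y" by (simp add: e_def Phi_Cons Sd_one)

lemma D_e: "D e = e * e" by (simp add: e_def comult_one)

lemma parity_e: "parity e = - e" by (simp add: e_def parity_pure1)

lemma Phi_degree: "degree_map (- 1) Phi"
  unfolding degree_map_neg1
proof (intro conjI allI ballI Phi_linear)
  show "Phi x = 0" if "x \<in> tpow 0" for x
    by (rule tpow_linear_eq [OF Phi_linear clinear_const_0 _ that]) (simp add: pure_Nil)
  show "Phi x \<in> tpow n" if "x \<in> tpow (Suc n)" for n x
  proof (rule tpow_linear_mem [OF Phi_linear subspace_tpow _ that])
    fix xs :: "'h list" assume "length xs = Suc n"
    then obtain y ys where xs: "xs = y # ys" "length ys = n" by (auto simp: length_Suc_conv)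
    show "Phi (pure xs) \<in> tpow n"
      using act_degree pure_tpow [OF xs(2)] unfolding xs(1) pure_Cons [of y ys] Phi_Cons degree_map_0 by blast
  qed
qed

text \<open>Closed forms of the alternating sums of cofaces: left multiplication by \<open>e\<close>
  is the zeroth coface, the derivation collects the cofaces that apply the coproduct, and
  \<open>parity x * e\<close> is the last coface up to sign.\<close>

definition b' :: "'h tens \<Rightarrow> 'h tens" where "b' x = e * x - D x"
definition b :: "'h tens \<Rightarrow> 'h tens" where "b x = e * x - D x - parity x * e"
definition Lam :: "'h tens \<Rightarrow> 'h tens" where "Lam x = parity (Phi (x * e))"

text \<open>The first letter is \<open>x = x \<rhd> e\<close>, and equivariance of the derivation
  allows moving \<open>x\<close> to the other factors. Only first letter \<open>e\<close> remains,
  where \<open>D e = e e\<close> produces the zeroth coface.\<close>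

lemma Phi_D: "Phi (D v) = b' (Phi v)"
proof (rule tens_linear_eq [of "\<lambda>v. Phi (D v)" "\<lambda>v. b' (Phi v)"])
  fix xs
  show "Phi (D (pure xs)) = b' (Phi (pure xs))"
  proof (cases xs)
    case Nil
    then show ?thesis by (simp add: pure_Nil b'_def)
  next
    case (Cons x ys)
    have "Phi (D ((x \<rhd> e) * pure ys)) = Phi (D (e * (Sd x \<rhd> pure ys)))"
    proof (rule coinvariant_move_eq)
      show "cbilinear (\<lambda>x y. Phi (D (x * y)))" by (simp add: bilin)
      show "sws (\<lambda>a b. Phi (D ((a \<rhd> x) * (b \<rhd> y)))) h = \<delta> h *\<^sub>C Phi (D (x * y))" for h x y
        unfolding sws_linear [OF clinear_compose [OF D_linear Phi_linear], symmetric] act_mult [symmetric]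
          act_D [symmetric] by (rule Phi_act)
    qed
    also have "\<dots> = b' (Phi ((x \<rhd> e) * pure ys))"
      unfolding D_mult D_e parity_e by (simp add: b'_def act_e Phi_Cons mult.assoc del: pure_mult)
    finally show ?thesis by (simp add: act_e Cons)
  qed
qed (simp_all add: clinear_iff b'_def algebra_simps scaleC_diff_right)

lemma b_degree: "degree_map 1 b" and b'_degree: "degree_map 1 b'"
proof -
  have "degree_map 1 (\<lambda>x. e * x)" "degree_map 1 (\<lambda>x. parity x * e)"
    using tpow_mult [OF e_tpow] tpow_mult [OF _ e_tpow] parity_degree
    by (auto simp: degree_map_1 degree_map_0 clinear_iff algebra_simps)
  then show "degree_map 1 b" "degree_map 1 b'"
    unfolding b_def [abs_def] b'_def [abs_def] by (simp_all add: degree_map_diff D_degree)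
qed

lemma Lam_degree: "degree_map 0 Lam"
proof -
  have "degree_map 1 (\<lambda>x. x * e)"
    using tpow_mult [OF _ e_tpow] by (auto simp: degree_map_1 clinear_iff algebra_simps)
  from degree_map_comp [OF degree_map_comp [OF this Phi_degree] parity_degree] show ?thesis
    by (simp add: Lam_def [abs_def])
qed

lemmas b_simps = clinearD [OF degree_map_linear [OF b_degree]]
lemmas b'_simps = clinearD [OF degree_map_linear [OF b'_degree]]
lemmas Lam_simps = clinearD [OF degree_map_linear [OF Lam_degree]]

lemma b_b: "b (b x) = 0"
  by (simp add: b_def D_mult D_e parity_e parity_mult parity_D algebra_simps)

lemma b'_b': "b' (b' x) = 0"
  by (simp add: b'_def D_mult D_e parity_e algebra_simps)

lemma parity_b': "parity (b' x) = - b' (parity x)"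
  by (rule parity_odd) (simp add: b'_degree)

text \<open>\<open>Phi_D\<close> applied to \<open>x e\<close> gives \<open>b' (Lam x)\<close>. By
  the Leibniz rule it has the same terms as \<open>Lam (b x)\<close>, apart from the one coming from
  the zeroth coface, which \<open>Lam\<close> turns into the last one.\<close>

lemma M_b: "b x - Lam (b x) = b' (x - Lam x)"
proof -
  have "b' (Lam x) = - parity (b' (Phi (x * e)))" by (simp add: Lam_def parity_b')
  also have "\<dots> = - parity (Phi (D x * e)) - parity (Phi (parity x * e * e))"
    unfolding Phi_D [symmetric] D_mult D_e by (simp add: algebra_simps)
  finally have 1: "b' (Lam x) = - parity (Phi (D x * e)) - parity (Phi (parity x * e * e))" .
  have "Lam (b x) = parity (x * e) - parity (Phi (D x * e)) - parity (Phi (parity x * e * e))"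
    by (simp add: Lam_def b_def algebra_simps)
  also have "\<dots> = - parity x * e + b' (Lam x)" unfolding 1 by (simp add: parity_mult parity_e)
  finally show ?thesis unfolding b'_simps(3) by (simp add: b_def b'_def)
qed

text \<open>The cyclic operator is induced by the cyclic permutation of tensor factors.  This is the only
  place where the involution hypothesis enters the theory of \<open>Phi\<close>.\<close>

lemma Lam_Phi_Cons: "Lam (Phi (pure [x] * y)) = parity (Phi (y * pure [x]))"
proof -
  have "Phi ((Sd x \<rhd> y) * e) = Phi (y * (Sd (Sd x) \<rhd> e))" by (rule Phi_move)
  then show ?thesis by (simp add: Lam_def Phi_Cons twisted_involution act_e)
qed

text \<open>Each \<open>Lam\<close> moves the first letter to the end. After \<open>q\<close> steps
  all of \<open>r\<close> has passed \<open>z\<close>, which costs the Koszul sign.\<close>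

lemma Lam_funpow_Phi:
  assumes "r \<in> tpow q" "z \<in> tpow m"
  shows "(Lam ^^ q) (Phi (r * z)) = (- 1) ^ (q * m) *\<^sub>C Phi (z * r)"
proof -
  have lin: "clinear (Lam ^^ q)" for q by (rule clinear_funpow [OF degree_map_linear [OF Lam_degree]])
  note lins = clinearD [OF lin]
  have "(Lam ^^ length rs) (Phi (pure rs * z)) = (- 1) ^ (length rs * m) *\<^sub>C Phi (z * pure rs)"
    if "z \<in> tpow m" for rs z m
    using that
  proof (induction rs arbitrary: z m)
    case Nil
    then show ?case by (simp add: pure_Nil)
  next
    case (Cons x rs)
    let ?q = "length rs"
    have z: "z * pure [x] \<in> tpow (Suc m)" using tpow_mult [OF Cons.prems pure_tpow [of "[x]" 1]] by simp
    have "pure rs * z * pure [x] \<in> tpow (Suc (?q + m))"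
      using tpow_mult [OF pure_tpow [OF refl] z, of rs] by (simp add: mult.assoc)
    then have "Phi (pure rs * z * pure [x]) \<in> tpow (?q + m)"
      using Phi_degree by (simp add: degree_map_neg1)
    then have "Lam (Phi (pure [x] * (pure rs * z))) = (- 1) ^ (?q + m) *\<^sub>C Phi (pure rs * z * pure [x])"
      unfolding Lam_Phi_Cons by (rule parity_tpow)
    then have "(Lam ^^ Suc ?q) (Phi (pure (x # rs) * z))
        = (- 1) ^ (?q + m) *\<^sub>C (Lam ^^ ?q) (Phi (pure rs * (z * pure [x])))"
      by (simp add: funpow_Suc_right lins pure_Cons [of x rs] mult.assoc del: pure_mult funpow.simps)
    also have "\<dots> = ((- 1) ^ (?q + m) * (- 1) ^ (?q * Suc m)) *\<^sub>C Phi (z * pure [x] * pure rs)"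
      unfolding Cons.IH [OF z] by simp
    \<comment> \<open>The exponents add up to \<open>2 q + m + q m\<close>, congruent to
      \<open>(q + 1) m\<close> modulo 2.\<close>
    also have "(- 1) ^ (?q + m) * (- 1) ^ (?q * Suc m) = ((- 1) ^ (length (x # rs) * m) :: complex)"
      by (simp add: power_add [symmetric] minus_one_power_iff)
    finally show ?case by (simp add: mult.assoc)
  qed
  note pure_case = this
  show ?thesis
    by (rule tpow_linear_eq [of "\<lambda>r. (Lam ^^ q) (Phi (r * z))" "\<lambda>r. (- 1) ^ (q * m) *\<^sub>C Phi (z * r)", OF _ _ _ assms(1)])
      (use pure_case [OF assms(2)] in \<open>auto simp: clinear_iff algebra_simps lins scaleC_add_right\<close>)
qed

text \<open>The word \<open>e y\<close> has \<open>n + 1\<close> letters, and all of them are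
  rotated past the empty word.\<close>

lemma Lam_period: "y \<in> tpow n \<Longrightarrow> (Lam ^^ Suc n) y = y"
  using Lam_funpow_Phi [of "e * y" "Suc n" 1 0] tpow_mult [OF e_tpow, of y n] pure_tpow [of "[]::'h list" 0]
  by (simp add: pure_Nil)

sublocale cyclic_operator Lam
  by unfold_locales (rule Lam_degree, rule Lam_period)

subsection \<open>The contraction of the \<open>b'\<close>-column\<close>

text \<open>The last codegeneracy with a sign. In \<open>b'\<close> the coface splitting the last
  factor is composed with it to the identity by the counit axiom, and the two signs cancel; the
  other terms anticommute.\<close>

definition s :: "'h tens \<Rightarrow> 'h tens"
  where "s = tens_lift (\<lambda>xs. if xs = [] then 0
     else ((- 1) ^ (length xs - 1) * counit H (last xs)) *\<^sub>C pure (butlast xs))"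

lemma multilinear_s: "multilinear (\<lambda>xs. if xs = [] then 0
     else ((- 1) ^ (length xs - 1) * counit H (last xs)) *\<^sub>C pure (butlast xs))"
  unfolding multilinear_def
proof (intro allI)
  fix xs ys :: "'h list"
  show "clinear (\<lambda>x. if xs @ x # ys = [] then 0
     else ((- 1) ^ (length (xs @ x # ys) - 1) * counit H (last (xs @ x # ys))) *\<^sub>C pure (butlast (xs @ x # ys)))"
  proof (cases "ys = []")
    case True
    then show ?thesis by (simp add: clinear_iff algebra_simps scaleC_add_left scaleC_complex_def)
  next
    case False
    then show ?thesis by (simp add: butlast_append clinear_scale_fun clinear_pure_at)
  qed
qed

lemma s_linear: "clinear s" unfolding s_def by (rule clinear_tens_lift [OF multilinear_s])

lemma s_1: "s 1 = 0" unfolding pure_Nil [symmetric] s_def by (simp add: tens_lift_pure [OF multilinear_s])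

lemma s_snoc: "s (y * pure [h]) = counit H h *\<^sub>C parity y"
proof (rule tens_linear_eq [of "\<lambda>y. s (y * pure [h])" "\<lambda>y. counit H h *\<^sub>C parity y"])
  show "clinear (\<lambda>y. s (y * pure [h]))" "clinear (\<lambda>y. counit H h *\<^sub>C parity y)"
    by (simp_all add: clinear_iff clinearD [OF s_linear] algebra_simps scaleC_add_right)
  show "s (pure xs * pure [h]) = counit H h *\<^sub>C parity (pure xs)" for xs
    by (simp add: s_def tens_lift_pure [OF multilinear_s] parity_pure mult.commute)
qed

lemma s_degree: "degree_map (- 1) s"
  unfolding degree_map_neg1
proof (intro conjI allI ballI s_linear)
  show "s x = 0" if "x \<in> tpow 0" for x
    by (rule tpow_linear_eq [OF s_linear clinear_const_0 _ that]) (simp add: pure_Nil s_1)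
  show "s x \<in> tpow n" if "x \<in> tpow (Suc n)" for n x
  proof (rule tpow_linear_mem [OF s_linear subspace_tpow _ that])
    fix xs :: "'h list" assume "length xs = Suc n"
    then show "s (pure xs) \<in> tpow n"
      unfolding s_def tens_lift_pure [OF multilinear_s] by (auto intro!: tpow_closed pure_tpow)
  qed
qed

lemma contraction: "b' (s x) + s (b' x) = x"
proof (rule tens_linear_eq [of "\<lambda>x. b' (s x) + s (b' x)" "\<lambda>x. x"])
  note [simp] = clinearD [OF s_linear]
  show "clinear (\<lambda>x. b' (s x) + s (b' x))" by (simp add: clinear_iff b'_simps scaleC_add_right)
  show "clinear (\<lambda>x::'h tens. x)" by (rule clinear_id)
  fix xs
  show "b' (s (pure xs)) + s (b' (pure xs)) = pure xs"
  proof (cases xs rule: rev_cases)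
    case Nil
    have "s e = 1" using s_snoc [of 1 1] by (simp add: e_def counit_one)
    then show ?thesis using Nil by (simp add: pure_Nil s_1 b'_def)
  next
    case (snoc ys h)
    let ?y = "pure ys"
    have "s (parity ?y * comult H h) = sws (\<lambda>a b. counit H b *\<^sub>C parity (parity ?y * pure [a])) h"
    proof -
      have "parity ?y * comult H h = sws (\<lambda>a b. (parity ?y * pure [a]) * pure [b]) h"
        unfolding comult_sws by (simp add: sws_mult_left [symmetric] mult.assoc)
      then show ?thesis by (simp only: sws_linear [OF s_linear] s_snoc)
    qed
    also have "\<dots> = parity (parity ?y * pure [h])"
      by (rule counit_right_sws) (simp add: clinear_iff algebra_simps)
    finally have 1: "s (parity ?y * comult H h) = - (?y * pure [h])" by (simp add: parity_mult parity_pure1 del: pure_mult)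
    have "b' (?y * pure [h]) = (e * ?y - D ?y) * pure [h] - parity ?y * comult H h"
      by (simp add: b'_def D_mult algebra_simps del: pure_mult)
    then have "s (b' (?y * pure [h])) = counit H h *\<^sub>C parity (b' ?y) + ?y * pure [h]"
      by (simp add: 1 s_snoc b'_def [symmetric] del: pure_mult)
    moreover have "b' (s (?y * pure [h])) = counit H h *\<^sub>C b' (parity ?y)"
      by (simp add: s_snoc b'_simps del: pure_mult)
    ultimately show ?thesis using snoc by (simp add: parity_b')
  qed
qed

subsection \<open>The operators of the cocyclic module\<close>

lemma multilinear_hopf_coface: "multilinear (hopf_coface H n i)"
  unfolding multilinear_def
proof (intro allI)
  fix xs ys :: "'h list"
  show "clinear (\<lambda>x. hopf_coface H n i (xs @ x # ys))"
  proof (cases "length xs + length ys + 1 = n")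
    case False
    then show ?thesis by (simp add: hopf_coface_def clinear_const_0)
  next
    case True
    consider "i = 0" | k where "i = Suc k" "k < n" | "i > n" by (metis not0_implies_Suc not_less Suc_le_eq)
    then show ?thesis
    proof cases
      case 1
      then show ?thesis using True clinear_pure_at [of "1 # xs" ys] by (simp add: hopf_coface_def)
    next
      case 2
      then show ?thesis using True clinear_insert_at [OF comult_linear, of k xs ys]
        by (auto simp: hopf_coface_def)
    next
      case 3
      then show ?thesis using True clinear_pure_at [of xs "ys @ [1]"] by (simp add: hopf_coface_def)
    qed
  qed
qed

lemma cyc_b'_pure:
  assumes "length xs = n"
  shows "(\<Sum>i\<le>n. (- 1) ^ i *\<^sub>C tens_lift (hopf_coface H n i) (pure xs)) = b' (pure xs)"
proof -
  have "(\<Sum>i\<le>n. (- 1) ^ i *\<^sub>C tens_lift (hopf_coface H n i) (pure xs))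
      = (\<Sum>i<Suc n. (- 1) ^ i *\<^sub>C hopf_coface H n i xs)"
    by (simp add: tens_lift_pure [OF multilinear_hopf_coface] lessThan_Suc_atMost)
  also have "\<dots> = pure (1 # xs) + (\<Sum>i<n. (- 1) ^ Suc i *\<^sub>C
      (pure (take i xs) * comult H (xs ! i) * pure (drop (Suc i) xs)))"
    unfolding sum.lessThan_Suc_shift using assms by (simp add: hopf_coface_def)
  also have "\<dots> = b' (pure xs)"
    using assms by (simp add: b'_def D_pure e_def complex_vector.scale_minus_left sum_negf)
  finally show ?thesis .
qed

lemma clinear_lift_coface: "clinear (tens_lift (hopf_coface H n i))"
  by (rule clinear_tens_lift [OF multilinear_hopf_coface])

lemma cyc_b'_eq: "x \<in> tpow n \<Longrightarrow> cyc_b' (hopf_cocyclic H \<delta>) n x = b' x"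
  unfolding cyc_b'_def hopf_cocyclic_def cocyclic.simps
  by (rule tpow_linear_eq [OF _ degree_map_linear [OF b'_degree] cyc_b'_pure])
    (intro clinear_intros clinear_lift_coface)

lemma cyc_b_eq: "x \<in> tpow n \<Longrightarrow> cyc_b (hopf_cocyclic H \<delta>) n x = b x"
  unfolding cyc_b_def hopf_cocyclic_def cocyclic.simps
proof (rule tpow_linear_eq [OF _ degree_map_linear [OF b_degree]])
  show "clinear (\<lambda>x. \<Sum>i\<le>n + 1. (- 1) ^ i *\<^sub>C tens_lift (hopf_coface H n i) x)"
    by (intro clinear_intros clinear_lift_coface)
  fix xs :: "'h list" assume xs: "length xs = n"
  have "(\<Sum>i\<le>n + 1. (- 1) ^ i *\<^sub>C tens_lift (hopf_coface H n i) (pure xs))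
     = b' (pure xs) + (- 1) ^ Suc n *\<^sub>C tens_lift (hopf_coface H n (Suc n)) (pure xs)"
    using cyc_b'_pure [OF xs] by simp
  also have "\<dots> = b (pure xs)"
    using xs by (simp add: tens_lift_pure [OF multilinear_hopf_coface] hopf_coface_def b_def b'_def parity_pure e_def
        complex_vector.scale_minus_left)
  finally show "(\<Sum>i\<le>n + 1. (- 1) ^ i *\<^sub>C tens_lift (hopf_coface H n i) (pure xs)) = b (pure xs)" .
qed

lemma multilinear_hopf_cyc: "multilinear (hopf_cyc H \<delta> n)"
  unfolding multilinear_def
proof (intro allI)
  fix xs ys :: "'h list"
  show "clinear (\<lambda>x. hopf_cyc H \<delta> n (xs @ x # ys))"
  proof (cases "length xs + length ys + 1 = n")
    case False
    then show ?thesis by (simp add: hopf_cyc_def clinear_const_0)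
  next
    case True
    then show ?thesis
    proof (cases xs)
      case Nil
      then show ?thesis using True by (simp add: hopf_cyc_def clinear_iff)
    next
      case (Cons z zs)
      have "clinear (\<lambda>x. Sd z \<rhd> pure (zs @ x # (ys @ [1])))"
        by (rule clinear_compose [OF clinear_pure_at act_linear])
      then show ?thesis using True Cons by (simp add: hopf_cyc_def)
    qed
  qed
qed

lemma cyc_lambda_eq: "x \<in> tpow n \<Longrightarrow> cyc_lambda (hopf_cocyclic H \<delta>) n x = Lam x"
  unfolding cyc_lambda_def hopf_cocyclic_def cocyclic.simps
proof (rule tpow_linear_eq [OF _ degree_map_linear [OF Lam_degree]])
  show "clinear (\<lambda>x. (- 1) ^ n *\<^sub>C tens_lift (hopf_cyc H \<delta> n) x)"
    by (intro clinear_intros clinear_tens_lift multilinear_hopf_cyc)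
  fix xs :: "'h list" assume xs: "length xs = n"
  have 1: "hopf_cyc H \<delta> n xs = Phi (pure xs * e)"
  proof (cases xs)
    case Nil
    then show ?thesis using xs Phi_e [of 1] by (simp add: hopf_cyc_def pure_Nil)
  next
    case (Cons y ys)
    have "Phi (pure xs * e) = Phi (pure [y] * pure (ys @ [1]))" by (simp add: e_def Cons)
    then show ?thesis unfolding Phi_Cons using xs Cons by (simp add: hopf_cyc_def)
  qed
  have "pure xs * e \<in> tpow (Suc n)" using tpow_mult [OF pure_tpow [OF xs] e_tpow] by simp
  then have "Phi (pure xs * e) \<in> tpow n" using Phi_degree by (simp add: degree_map_neg1)
  then show "(- 1) ^ n *\<^sub>C tens_lift (hopf_cyc H \<delta> n) (pure xs) = Lam (pure xs)"
    unfolding Lam_def tens_lift_pure [OF multilinear_hopf_cyc] 1 by (rule parity_tpow [symmetric])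
qed

lemma cyc_N_eq:
  assumes x: "x \<in> tpow n"
  shows "cyc_N (hopf_cocyclic H \<delta>) n x = N x"
proof -
  have "(cyc_lambda (hopf_cocyclic H \<delta>) n ^^ i) x = (Lam ^^ i) x" for i
  proof (induction i)
    case (Suc i)
    have "(Lam ^^ i) x \<in> tpow n" using degree_map_funpow [OF Lam_degree] x by (simp add: degree_map_0)
    then show ?case by (simp add: Suc cyc_lambda_eq)
  qed simp
  then show ?thesis unfolding cyc_N_def N_tpow [OF x] by simp
qed

end

section \<open>The tensor algebra without unit\<close>

lemma scaleC_complex: "c *\<^sub>C z = c * (z::complex)"
  by (simp add: scaleC_complex_def)

definition coeff0 :: "'h::complex_vector tens \<Rightarrow> complex"
  where "coeff0 = tens_lift (\<lambda>xs. if xs = [] then 1 else 0)"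

lemma multilinear_coeff0: "multilinear (\<lambda>xs. if xs = [] then 1 else (0::complex))"
  by (simp add: multilinear_def clinear_const_0)

lemma coeff0_linear: "clinear coeff0"
  unfolding coeff0_def by (rule clinear_tens_lift [OF multilinear_coeff0])

lemmas coeff0_simps [simp] = clinearD [OF coeff0_linear, unfolded scaleC_complex]

lemma coeff0_pure: "coeff0 (pure xs) = (if xs = [] then 1 else 0)"
  unfolding coeff0_def by (rule tens_lift_pure [OF multilinear_coeff0])

lemma coeff0_1 [simp]: "coeff0 1 = 1"
  unfolding one_tens_def by (simp add: coeff0_pure)

lemma coeff0_mult [simp]: "coeff0 (x * y) = coeff0 x * coeff0 y"
proof (rule tens_linear_eq [of "\<lambda>x. coeff0 (x * y)" "\<lambda>x. coeff0 x * coeff0 y"])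
  fix xs
  show "coeff0 (pure xs * y) = coeff0 (pure xs) * coeff0 y"
    by (rule tens_linear_eq [of "\<lambda>y. coeff0 (pure xs * y)" "\<lambda>y. coeff0 (pure xs) * coeff0 y"])
      (simp_all add: clinear_iff algebra_simps coeff0_pure scaleC_complex)
qed (simp_all add: clinear_iff algebra_simps scaleC_complex)

lemma coeff0_tpow: "x \<in> tpow n \<Longrightarrow> n \<noteq> 0 \<Longrightarrow> coeff0 x = 0"
  by (rule tpow_linear_eq [OF coeff0_linear clinear_const_0]) (auto simp: coeff0_pure)

lemma tpow_0: "x \<in> tpow 0 \<Longrightarrow> x = coeff0 x *\<^sub>C 1"
  by (rule tpow_linear_eq [OF clinear_id, of "\<lambda>x. coeff0 x *\<^sub>C 1"])
    (auto simp: coeff0_pure clinear_iff scaleC_add_left one_tens_def)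

lemma coeff0_zero_mem: "coeff0 x = 0 \<Longrightarrow> x \<in> cspan {pure xs | xs. xs \<noteq> []}"
proof -
  have "x - coeff0 x *\<^sub>C 1 \<in> cspan {pure xs | xs. xs \<noteq> []}"
  proof (rule tens_linear_mem [of "\<lambda>x. x - coeff0 x *\<^sub>C 1"])
    show "clinear (\<lambda>x. x - coeff0 x *\<^sub>C 1)"
      by (simp add: clinear_iff algebra_simps scaleC_add_left scaleC_add_right scaleC_diff_right)
    show "pure xs - coeff0 (pure xs) *\<^sub>C 1 \<in> cspan {pure xs | xs. xs \<noteq> []}" for xs
      by (auto simp: coeff0_pure one_tens_def complex_vector.span_zero intro: cspan_base)
  qed (rule subspace_cspan)
  then show "coeff0 x = 0 \<Longrightarrow> x \<in> cspan {pure xs | xs. xs \<noteq> []}" by simp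
qed

lemma coeff0_Rep [simp]: "coeff0 (Rep_tens_pos z) = 0"
  by (rule clinear_zero_on_span [OF coeff0_linear _ Rep_tens_pos]) (auto simp: coeff0_pure)

lemma Rep_linear: "clinear Rep_tens_pos"
  by (simp add: clinear_iff plus_tens_pos.rep_eq scaleC_tens_pos.rep_eq)

lemmas Rep_simps [simp] = clinearD [OF Rep_linear] times_tens_pos.rep_eq

definition pos_part :: "'h::complex_vector tens \<Rightarrow> 'h tens_pos"
  where "pos_part x = Abs_tens_pos (x - coeff0 x *\<^sub>C 1)"

lemma Rep_pos_part: "Rep_tens_pos (pos_part x) = x - coeff0 x *\<^sub>C 1"
  unfolding pos_part_def by (rule Abs_tens_pos_inverse) (simp add: coeff0_zero_mem)

lemma Rep_pos_part_0 [simp]: "coeff0 x = 0 \<Longrightarrow> Rep_tens_pos (pos_part x) = x"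
  by (simp add: Rep_pos_part)

lemma pos_part_Rep [simp]: "pos_part (Rep_tens_pos z) = z"
  by (simp add: pos_part_def Rep_tens_pos_inverse)

lemma pos_part_linear: "clinear pos_part"
  by (simp add: clinear_iff Rep_tens_pos_inject [symmetric] Rep_pos_part algebra_simps scaleC_add_left
      scaleC_diff_right)

lemmas pos_part_simps [simp] = clinearD [OF pos_part_linear]

lemma pos_part_1 [simp]: "pos_part 1 = 0" by (simp add: Rep_tens_pos_inject [symmetric] Rep_pos_part)

lemma pos_part_mult: "coeff0 x = 0 \<Longrightarrow> coeff0 y = 0 \<Longrightarrow> pos_part x * pos_part y = pos_part (x * y)"
  by (simp add: Rep_tens_pos_inject [symmetric])

text \<open>Adjoining a unit to the positive part gives back the full tensor algebra, the new unit
  being the empty tensor. Calculations with forms thereby take place in one unital algebra.\<close>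

definition unitize :: "'h::complex_vector tens \<Rightarrow> complex \<times> 'h tens_pos"
  where "unitize x = (coeff0 x, pos_part x)"

definition deunit :: "complex \<times> 'h::complex_vector tens_pos \<Rightarrow> 'h tens"
  where "deunit z = fst z *\<^sub>C 1 + Rep_tens_pos (snd z)"

lemma scaleC_Pair [simp]: "c *\<^sub>C (x, y) = (c *\<^sub>C x, c *\<^sub>C y)"
  by (simp add: scaleC_prod_def)

lemma fst_scaleC [simp]: "fst (c *\<^sub>C z) = c *\<^sub>C fst z" and snd_scaleC [simp]: "snd (c *\<^sub>C z) = c *\<^sub>C snd z"
  by (simp_all add: scaleC_prod_def)

lemma unitize_linear: "clinear unitize"
  by (simp add: clinear_iff unitize_def scaleC_complex)

lemma deunit_linear: "clinear deunit"
  by (simp add: clinear_iff deunit_def scaleC_complex scaleC_add_left scaleC_add_right)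

lemmas unitize_simps = clinearD [OF unitize_linear]
lemmas deunit_simps = clinearD [OF deunit_linear]

lemma deunit_unitize [simp]: "deunit (unitize x) = x"
  by (simp add: deunit_def unitize_def Rep_pos_part)

lemma unitize_deunit [simp]: "unitize (deunit z) = z"
  by (simp add: deunit_def unitize_def)

lemma unitize_1: "unitize 1 = (1, 0)" by (simp add: unitize_def)

text \<open>The one-form \<open>x dy\<close> for arbitrary tensors. The scalar part of
  \<open>x\<close> belongs to the adjoined unit; the scalar part of \<open>y\<close> is dropped, as
  \<open>d\<close> of the adjoined unit is zero.\<close>

definition form :: "'h::complex_vector tens \<Rightarrow> 'h tens \<Rightarrow> (complex \<times> 'h tens_pos, 'h tens_pos) tensor"
  where "form x y = unitize x \<otimes>\<^sub>t pos_part y"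

lemma tensor_of_simps [simp]:
  "(x + x') \<otimes>\<^sub>t y = x \<otimes>\<^sub>t y + x' \<otimes>\<^sub>t y" "x \<otimes>\<^sub>t (y + y') = x \<otimes>\<^sub>t y + x \<otimes>\<^sub>t y'"
  "(c *\<^sub>C x) \<otimes>\<^sub>t y = c *\<^sub>C (x \<otimes>\<^sub>t y)" "x \<otimes>\<^sub>t (c *\<^sub>C y) = c *\<^sub>C (x \<otimes>\<^sub>t y)"
  using cbilinear_tensor_of unfolding cbilinear_iff by blast+

lemma tensor_of_0 [simp]: "x \<otimes>\<^sub>t 0 = 0" "0 \<otimes>\<^sub>t y = 0"
  using tensor_of_simps(4) [of x 0 0] tensor_of_simps(3) [of 0 0 y] by simp_all

lemma form_1 [simp]: "form x 1 = 0"
  by (simp add: form_def)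

lemma cbilinear_form: "cbilinear form"
  by (simp add: cbilinear_iff form_def unitize_simps)

lemma form_linear_left: "clinear (\<lambda>x. form x y)" and form_linear_right: "clinear (form x)"
  by (rule cbilinear_form [unfolded cbilinear_def, THEN conjunct2, rule_format]
      cbilinear_form [unfolded cbilinear_def, THEN conjunct1, rule_format])+

lemmas form_simps [simp] = clinearD [OF form_linear_left] clinearD [OF form_linear_right]

lemma tensor_of_form: "z \<otimes>\<^sub>t w = form (deunit z) (Rep_tens_pos w)"
  by (simp add: form_def)

lemma form_linear_eq:
  assumes "clinear f" "clinear g"
    "\<And>p q x y. x \<in> tpow p \<Longrightarrow> y \<in> tpow q \<Longrightarrow> coeff0 y = 0 \<Longrightarrow> f (form x y) = g (form x y)"
  shows "f \<omega> = g \<omega>"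
proof (rule clinear_eq_on_span [OF assms(1,2) _ tensor_span])
  fix w assume "w \<in> {x \<otimes>\<^sub>t y :: (complex \<times> 'a tens_pos, 'a tens_pos) tensor | x y. True}"
  then obtain x y where w: "w = form x y" "coeff0 y = 0" by (auto simp: tensor_of_form)
  have lin: "clinear (\<lambda>x. f (form x y))" "clinear (\<lambda>x. g (form x y))"
    "clinear (\<lambda>y. f (form x y))" "clinear (\<lambda>y. g (form x y))" for x y
    using clinear_compose [OF form_linear_left] clinear_compose [OF form_linear_right] assms(1,2) by blast+
  have 1: "f (form x (pure ys)) = g (form x (pure ys))" if "x \<in> tpow p" for p x ys
  proof (cases "ys = []")
    case True
    then have "form x (pure ys) = 0" by (simp add: one_tens_def [symmetric])
    then show ?thesis by (simp add: clinear_zero assms)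
  next
    case False
    then show ?thesis by (intro assms(3) [OF that pure_tpow [OF refl]]) (simp add: coeff0_pure)
  qed
  have 2: "f (form x y) = g (form x y)" if "x \<in> tpow p" for p x y
    by (rule tens_linear_eq [OF lin(3,4)]) (rule 1 [OF that])
  show "f w = g w"
    unfolding w by (rule tens_linear_eq_tpow [OF lin(1,2)]) (rule 2)
qed

context hopf_character
begin

section \<open>The differential graded structure and its one-forms, expressed in the unital tensor
  algebra\<close>

abbreviation R where "R \<equiv> tensor_dga H"

lemma coeff0_act [simp]: "coeff0 (h \<rhd> x) = counit H h * coeff0 x"
proof (rule tens_linear_eq_tpow [of "\<lambda>x. coeff0 (h \<rhd> x)" "\<lambda>x. counit H h * coeff0 x"])
  show "coeff0 (h \<rhd> x) = counit H h * coeff0 x" if x: "x \<in> tpow n" for n x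
  proof (cases "n = 0")
    case True
    then have "x = coeff0 x *\<^sub>C 1" using x tpow_0 by blast
    then have "h \<rhd> x = coeff0 x *\<^sub>C counit H h *\<^sub>C 1" by (metis act_1 act_simps(2))
    then show ?thesis by simp
  next
    case False
    have "h \<rhd> x \<in> tpow n" using act_degree x by (simp add: degree_map_0)
    then show ?thesis using False x by (simp add: coeff0_tpow)
  qed
qed (simp_all add: clinear_iff algebra_simps scaleC_complex)

lemma coeff0_D [simp]: "coeff0 (D x) = 0"
proof (rule tens_linear_eq_tpow [of "\<lambda>x. coeff0 (D x)" "\<lambda>x. 0"])
  show "coeff0 (D x) = 0" if "x \<in> tpow n" for n x
    using that D_degree coeff0_tpow [of "D x" "Suc n"] by (simp add: degree_map_1)
qed (simp_all add: clinear_iff scaleC_complex)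

lemma coeff0_e [simp]: "coeff0 e = 0" by (simp add: e_def coeff0_pure)

lemma grade_R: "z \<in> grade R n \<longleftrightarrow> Rep_tens_pos z \<in> tpow n"
  by (simp add: tensor_dga_def)

lemma pos_part_grade:
  assumes "x \<in> tpow n"
  shows "pos_part x \<in> grade R n"
proof (cases "n = 0")
  case True
  then have "x = coeff0 x *\<^sub>C 1" using assms tpow_0 by blast
  then have "pos_part x = 0" by (metis pos_part_1 pos_part_simps(2) complex_vector.scale_zero_right)
  then show ?thesis by (simp add: grade_R tpow_closed)
next
  case False
  then show ?thesis using assms by (simp add: grade_R coeff0_tpow)
qed

lemma ugrade_R: "z \<in> ugrade R n \<longleftrightarrow> deunit z \<in> tpow n"
proof
  assume z: "z \<in> ugrade R n"
  then obtain c x where zc: "z = (c, x)" "x \<in> grade R n" "n \<noteq> 0 \<longrightarrow> c = 0" by (auto simp: ugrade_def)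
  have "(1::'h tens) \<in> tpow 0" by (simp add: pure_Nil [symmetric] pure_tpow)
  then have "c *\<^sub>C (1::'h tens) \<in> tpow n"
    using zc(3) by (cases "n = 0") (simp_all add: tpow_closed)
  then show "deunit z \<in> tpow n" using zc(1,2) by (simp add: deunit_def grade_R tpow_closed)
next
  assume a: "deunit z \<in> tpow n"
  have "unitize (deunit z) \<in> ugrade R n"
    using a coeff0_tpow [OF a] pos_part_grade [OF a] unfolding unitize_def ugrade_def by blast
  then show "z \<in> ugrade R n" by simp
qed

lemma act_R: "dga.act R h (pos_part y) = pos_part (h \<rhd> y)"
proof -
  have "h \<rhd> (y - coeff0 y *\<^sub>C 1) = (h \<rhd> y) - coeff0 (h \<rhd> y) *\<^sub>C 1" by (simp add: mult.commute)
  then show ?thesis by (simp only: tensor_dga_def dga.simps pos_part_def [of "h \<rhd> y"] Rep_pos_part)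
qed

lemma ddif_R: "ddif R (pos_part y) = pos_part (D y)"
proof -
  have "D (y - coeff0 y *\<^sub>C 1) = D y - coeff0 (D y) *\<^sub>C 1" by simp
  then show ?thesis by (simp only: tensor_dga_def dga.simps pos_part_def [of "D y"] Rep_pos_part)
qed

lemma act_R_linear: "clinear (dga.act R h)"
  unfolding clinear_iff using act_R [of h "Rep_tens_pos _"] act_R [of h "Rep_tens_pos _ + Rep_tens_pos _"]
    act_R [of h "_ *\<^sub>C Rep_tens_pos _"] by simp

lemma act_R_linear_left: "clinear (\<lambda>h. dga.act R h z)"
  unfolding clinear_iff using act_R [of _ "Rep_tens_pos z"] by simp

lemma ddif_R_linear: "clinear (ddif R)"
  unfolding clinear_iff using ddif_R [of "Rep_tens_pos _"] ddif_R [of "Rep_tens_pos _ + Rep_tens_pos _"]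
    ddif_R [of "_ *\<^sub>C Rep_tens_pos _"] by simp

lemmas R_simps [simp] = clinearD [OF act_R_linear] clinearD [OF act_R_linear_left] clinearD [OF ddif_R_linear]

lemma umult_left_unitize: "coeff0 r = 0 \<Longrightarrow> umult_left (pos_part r) (unitize x) = pos_part (r * x)"
  by (simp add: umult_left_def unitize_def Rep_tens_pos_inject [symmetric] Rep_pos_part algebra_simps)

lemma umult_right_unitize: "coeff0 r = 0 \<Longrightarrow> umult_right (unitize x) (pos_part r) = pos_part (x * r)"
  by (simp add: umult_right_def unitize_def Rep_tens_pos_inject [symmetric] Rep_pos_part algebra_simps)

lemma unitize_0: "coeff0 x = 0 \<Longrightarrow> (0, pos_part x) = unitize x"
  by (simp add: unitize_def)

lemma Pair_0_tensor: 
  "(0, x + x') \<otimes>\<^sub>t y = (0, x) \<otimes>\<^sub>t y + (0, x') \<otimes>\<^sub>t y" "(0, c *\<^sub>C x) \<otimes>\<^sub>t y = c *\<^sub>C ((0, x) \<otimes>\<^sub>t y)"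
  for x x' :: "'h tens_pos" and y :: "'h tens_pos"
  using tensor_of_simps(1) [of "(0, x)" "(0, x')" y] tensor_of_simps(3) [of c "(0, x)" y]
  by (simp_all add: complex_vector.scale_zero_right)

lemma umult_simps:
  "umult_left z (x + x') = umult_left z x + umult_left z x'"
  "umult_left z (c *\<^sub>C x) = c *\<^sub>C umult_left z x"
  "umult_right (x + x') z = umult_right x z + umult_right x' z"
  "umult_right (c *\<^sub>C x) z = c *\<^sub>C umult_right x z"
  "umult_right x (z + z') = umult_right x z + umult_right x z'"
  "umult_right x (c *\<^sub>C z) = c *\<^sub>C umult_right x z"
  for x x' :: "complex \<times> 'h tens_pos"
  by (simp_all add: umult_left_def umult_right_def scaleC_add_left scaleC_add_right algebra_simps scaleC_complex)

lemma omega_left_form: "coeff0 r = 0 \<Longrightarrow> omega_left (pos_part r) (form x y) = form (r * x) y"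
  and omega_left_linear: "clinear (omega_left z)" for z :: "'h tens_pos" and r :: "'h tens"
proof -
  have bil: "cbilinear (\<lambda>x (y :: 'h tens_pos). ((0::complex), umult_left z x) \<otimes>\<^sub>t y)" for z :: "'h tens_pos"
    by (simp add: cbilinear_iff umult_simps Pair_0_tensor)
  show "clinear (omega_left z)" unfolding omega_left_def by (rule clinear_tensor_lift [OF bil])
  show "omega_left (pos_part r) (form x y) = form (r * x) y" if "coeff0 r = 0"
    unfolding omega_left_def form_def tensor_lift_tensor_of [OF bil] using that
    by (simp add: umult_left_unitize unitize_0)
qed

lemma omega_right_form: "coeff0 r = 0 \<Longrightarrow> coeff0 y = 0 \<Longrightarrow> omega_right (form x y) (pos_part r) = form x (y * r) - form (x * y) r"
  and omega_right_linear: "clinear (\<lambda>\<omega>. omega_right \<omega> z)" for z :: "'h tens_pos" and r :: "'h tens"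
proof -
  have bil: "cbilinear (\<lambda>x y. x \<otimes>\<^sub>t (y * z) - (0, umult_right x y) \<otimes>\<^sub>t z)" for z :: "'h tens_pos"
    by (simp add: cbilinear_iff umult_simps Pair_0_tensor distrib_right scaleC_diff_right)
  show "clinear (\<lambda>\<omega>. omega_right \<omega> z)" unfolding omega_right_def by (rule clinear_tensor_lift [OF bil])
  show "omega_right (form x y) (pos_part r) = form x (y * r) - form (x * y) r" if "coeff0 r = 0" "coeff0 y = 0"
    unfolding omega_right_def form_def tensor_lift_tensor_of [OF bil] using that
    by (simp add: umult_right_unitize unitize_0 pos_part_mult)
qed

lemma uact_unitize: "uact H R h (unitize x) = unitize (h \<rhd> x)"
  by (simp add: uact_def unitize_def act_R)

lemma omega_act_form: "omega_act H R h (form x y) = sws (\<lambda>a b. form (a \<rhd> x) (b \<rhd> y)) h"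
  and omega_act_linear: "clinear (omega_act H R h)"
proof -
  have u: "uact H R a z = unitize (a \<rhd> deunit z)" for a z using uact_unitize [of a "deunit z"] by simp
  have r: "dga.act R b w = pos_part (b \<rhd> Rep_tens_pos w)" for b w using act_R [of b "Rep_tens_pos w"] by simp
  have "cbilinear (\<lambda>a b. uact H R a z \<otimes>\<^sub>t dga.act R b w)" for z w
    by (simp add: cbilinear_iff u r unitize_simps)
  note sw = sweedler_sws [OF this]
  have bil: "cbilinear (\<lambda>z w. sweedler H (\<lambda>a b. uact H R a z \<otimes>\<^sub>t dga.act R b w) h)"
    unfolding sw by (simp add: cbilinear_iff u r unitize_simps deunit_simps)
  show "clinear (omega_act H R h)" unfolding omega_act_def by (rule clinear_tensor_lift [OF bil])
  show "omega_act H R h (form x y) = sws (\<lambda>a b. form (a \<rhd> x) (b \<rhd> y)) h"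
    unfolding omega_act_def sw form_def tensor_lift_tensor_of [OF bil [unfolded sw]] uact_unitize act_R ..
qed

text \<open>The definite description is resolved by a witness in which \<open>parity\<close>
  replaces the sign \<open>(-1)^p\<close>, so that it is bilinear on all arguments. Uniqueness holds
  because forms with homogeneous coefficients span.\<close>

lemma omega_dif_linear: "clinear (omega_dif R)"
  and omega_dif_form: "omega_dif R (form x y) = form (D x) y + form (parity x) (D y)"
proof -
  let ?f = "\<lambda>z w. form (D (deunit z)) (Rep_tens_pos w) + form (parity (deunit z)) (D (Rep_tens_pos w))"
  have bil: "cbilinear ?f" by (simp add: cbilinear_iff deunit_simps scaleC_add_right algebra_simps)
  let ?P = "\<lambda>Q. clinear Q \<and> (\<forall>p. \<forall>x\<in>ugrade R p. \<forall>y.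
        Q (x \<otimes>\<^sub>t y) = (0, ddif R (snd x)) \<otimes>\<^sub>t y + (- 1) ^ p *\<^sub>C (x \<otimes>\<^sub>t ddif R y))"
  have dd: "(0, ddif R (snd z)) = unitize (D (deunit z))" for z
  proof -
    have "ddif R (snd (unitize (deunit z))) = pos_part (D (deunit z))" by (simp only: unitize_def snd_conv ddif_R)
    then show ?thesis by (simp add: unitize_0)
  qed
  have dr: "ddif R w = pos_part (D (Rep_tens_pos w))" for w using ddif_R [of "Rep_tens_pos w"] by simp
  have ex: "?P (tensor_lift ?f)"
  proof (intro conjI allI ballI)
    show "clinear (tensor_lift ?f)" by (rule clinear_tensor_lift [OF bil])
    fix p z w assume z: "z \<in> ugrade R p"
    then have "parity (deunit z) = (- 1) ^ p *\<^sub>C deunit z" unfolding ugrade_R by (rule parity_tpow)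
    then show "tensor_lift ?f (z \<otimes>\<^sub>t w) = (0, ddif R (snd z)) \<otimes>\<^sub>t w + (- 1) ^ p *\<^sub>C (z \<otimes>\<^sub>t ddif R w)"
      unfolding tensor_lift_tensor_of [OF bil] dd dr [of w] by (simp add: form_def unitize_simps)
  qed
  have uni: "Q = tensor_lift ?f" if "?P Q" for Q
  proof
    fix \<omega>
    show "Q \<omega> = tensor_lift ?f \<omega>"
    proof (rule form_linear_eq [of Q "tensor_lift ?f"])
      show "clinear Q" "clinear (tensor_lift ?f)" using that ex by blast+
      fix p and x y :: "'h tens" assume "x \<in> tpow p"
      then have "unitize x \<in> ugrade R p" by (simp add: ugrade_R)
      then show "Q (form x y) = tensor_lift ?f (form x y)"
        using that ex unfolding form_def by simp
    qed
  qed
  have eq: "omega_dif R = tensor_lift ?f"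
    unfolding omega_dif_def using ex uni by (rule the_equality)
  show "clinear (omega_dif R)" unfolding eq using ex by blast
  show "omega_dif R (form x y) = form (D x) y + form (parity x) (D y)"
  unfolding eq form_def [of x y] tensor_lift_tensor_of [OF bil] by (simp add: Rep_pos_part)
qed

text \<open>The opposite product with its Koszul sign, written bilinearly and without degrees: the
  even part of \<open>x\<close> passes \<open>y\<close> unchanged, the odd part turns
  \<open>y\<close> into \<open>parity y\<close>. It provides the witness for
  \<open>omega_b\<close>.\<close>

definition swap :: "'h tens \<Rightarrow> 'h tens \<Rightarrow> 'h tens"
  where "swap x y = (1/2) *\<^sub>C (y * (x + parity x)) + (1/2) *\<^sub>C (parity y * (x - parity x))"

lemma swap_tpow:
  assumes "x \<in> tpow p" "y \<in> tpow q"
  shows "swap x y = (- 1) ^ (p * q) *\<^sub>C (y * x)"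
  unfolding swap_def parity_tpow [OF assms(1)] parity_tpow [OF assms(2)]
proof (cases "even p")
  case True
  then show "(1/2) *\<^sub>C (y * (x + (- 1) ^ p *\<^sub>C x)) + (1/2) *\<^sub>C (((- 1) ^ q *\<^sub>C y) * (x - (- 1) ^ p *\<^sub>C x))
     = (- 1) ^ (p * q) *\<^sub>C (y * x)"
    by (simp add: algebra_simps scaleC_add_right scaleC_add_left [symmetric])
next
  case False
  then show "(1/2) *\<^sub>C (y * (x + (- 1) ^ p *\<^sub>C x)) + (1/2) *\<^sub>C (((- 1) ^ q *\<^sub>C y) * (x - (- 1) ^ p *\<^sub>C x))
     = (- 1) ^ (p * q) *\<^sub>C (y * x)"
    by (simp add: algebra_simps scaleC_add_right scaleC_add_left [symmetric] minus_one_power_iff)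
qed

lemma omega_b_linear: "clinear (omega_b R)"
  and omega_b_form: "x \<in> tpow p \<Longrightarrow> y \<in> tpow q \<Longrightarrow> coeff0 y = 0 \<Longrightarrow>
      omega_b R (form x y) = pos_part (x * y - (- 1) ^ (p * q) *\<^sub>C (y * x))"
proof -
  let ?f = "\<lambda>z w. pos_part (deunit z * Rep_tens_pos w - swap (deunit z) (Rep_tens_pos w))"
  have bil: "cbilinear ?f"
    by (simp add: cbilinear_iff deunit_simps swap_def scaleC_add_right algebra_simps scaleC_diff_right)
  let ?P = "\<lambda>B. clinear B \<and> (\<forall>p q. \<forall>x\<in>ugrade R p. \<forall>y\<in>grade R q.
        B (x \<otimes>\<^sub>t y) = umult_right x y - (- 1) ^ (p * q) *\<^sub>C umult_left y x)"
  have um: "umult_right z w = pos_part (deunit z * Rep_tens_pos w)" "umult_left w z = pos_part (Rep_tens_pos w * deunit z)"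
    for z and w :: "'h tens_pos"
    using umult_right_unitize [of "Rep_tens_pos w" "deunit z"] umult_left_unitize [of "Rep_tens_pos w" "deunit z"]
    by simp_all
  have ex: "?P (tensor_lift ?f)"
  proof (intro conjI allI ballI)
    show "clinear (tensor_lift ?f)" by (rule clinear_tensor_lift [OF bil])
    fix p q z w assume zw: "z \<in> ugrade R p" "w \<in> grade R q"
    show "tensor_lift ?f (z \<otimes>\<^sub>t w) = umult_right z w - (- 1) ^ (p * q) *\<^sub>C umult_left w z"
      unfolding tensor_lift_tensor_of [OF bil] um swap_tpow [OF zw [unfolded ugrade_R grade_R]]
      by simp
  qed
  have uni: "B = tensor_lift ?f" if "?P B" for B
  proof
    fix \<omega>
    show "B \<omega> = tensor_lift ?f \<omega>"
    proof (rule form_linear_eq [of B "tensor_lift ?f"])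
      show "clinear B" "clinear (tensor_lift ?f)" using that ex by blast+
      fix p q and x y :: "'h tens" assume "x \<in> tpow p" "y \<in> tpow q" "coeff0 y = 0"
      then have "unitize x \<in> ugrade R p" "pos_part y \<in> grade R q" by (simp_all add: ugrade_R grade_R)
      then show "B (form x y) = tensor_lift ?f (form x y)"
        using that ex unfolding form_def by simp
    qed
  qed
  have eq: "omega_b R = tensor_lift ?f"
    unfolding omega_b_def using ex uni by (rule the_equality)
  show "clinear (omega_b R)" unfolding eq using ex by blast
  show "omega_b R (form x y) = pos_part (x * y - (- 1) ^ (p * q) *\<^sub>C (y * x))"
    if "x \<in> tpow p" "y \<in> tpow q" "coeff0 y = 0"
    unfolding eq form_def tensor_lift_tensor_of [OF bil] using that by (simp add: swap_tpow [OF that(1,2)])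
qed

lemma omega_d_form: "coeff0 v = 0 \<Longrightarrow> omega_d (pos_part v) = form 1 v"
  by (simp add: omega_d_def form_def unitize_1)

lemma omega_d_linear: "clinear (omega_d :: 'h tens_pos \<Rightarrow> _)"
  by (simp add: clinear_iff omega_d_def)

lemmas omega_simps [simp] = clinearD [OF omega_left_linear] clinearD [OF omega_right_linear]
  clinearD [OF omega_act_linear] clinearD [OF omega_dif_linear] clinearD [OF omega_b_linear]
  clinearD [OF omega_d_linear]

end

context hopf_character
begin

section \<open>One-forms modulo commutators and coinvariants\<close>

abbreviation W0 where "W0 \<equiv> cspan (coinv \<delta> (dga.act R))"
abbreviation W1 where "W1 \<equiv> cspan (omega_comms R \<union> coinv \<delta> (omega_act H R))"

lemmas W_closed = complex_vector.span_add complex_vector.span_diff complex_vector.span_scale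
  complex_vector.span_neg complex_vector.span_zero

text \<open>The first letter is moved to the rest of the word, leaving \<open>e\<close> in front.
  Hence \<open>y \<mapsto> e y\<close> is inverse to \<open>Phi\<close> modulo coinvariants.\<close>

lemma pos_part_W0: "pos_part x - pos_part (e * Phi x) \<in> W0"
proof (rule tens_linear_mem [of "\<lambda>x. pos_part x - pos_part (e * Phi x)"])
  show "clinear (\<lambda>x. pos_part x - pos_part (e * Phi x))"
    by (simp add: clinear_iff algebra_simps scaleC_diff_right)
  fix xs
  show "pos_part (pure xs) - pos_part (e * Phi (pure xs)) \<in> W0"
  proof (cases xs)
    case Nil
    then show ?thesis by (simp add: pure_Nil complex_vector.span_zero)
  next
    case (Cons x ys)
    have "pos_part ((x \<rhd> e) * pure ys) - pos_part (e * (Sd x \<rhd> pure ys)) \<in> W0"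
    proof (rule coinvariant_move)
      show "cbilinear (\<lambda>x y :: 'h tens. pos_part (x * y))" by (simp add: bilin)
      fix h and x y :: "'h tens"
      have "dga.act R h (pos_part (x * y)) - \<delta> h *\<^sub>C pos_part (x * y) \<in> W0"
        by (rule cspan_base) (auto simp: coinv_def)
      then show "sws (\<lambda>a b. pos_part ((a \<rhd> x) * (b \<rhd> y))) h - \<delta> h *\<^sub>C pos_part (x * y) \<in> W0"
        by (simp only: act_R act_mult sws_linear [OF pos_part_linear])
    qed (rule subspace_cspan)
    then show ?thesis by (simp add: Cons act_e pure_Cons [of x ys] Phi_Cons del: pure_mult)
  qed
qed (rule subspace_cspan)

lemma W0_iff: "z \<in> W0 \<longleftrightarrow> Phi (Rep_tens_pos z) = 0"
proof
  assume z: "z \<in> W0"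
  show "Phi (Rep_tens_pos z) = 0"
  proof (rule clinear_zero_on_span [OF clinear_compose [OF Rep_linear Phi_linear] _ z])
    fix w assume "w \<in> coinv \<delta> (dga.act R)"
    then obtain h v where "w = dga.act R h (pos_part (Rep_tens_pos v)) - \<delta> h *\<^sub>C v" by (auto simp: coinv_def)
    then show "Phi (Rep_tens_pos w) = 0" unfolding act_R by (simp add: Phi_act)
  qed
next
  assume "Phi (Rep_tens_pos z) = 0"
  then show "z \<in> W0" using pos_part_W0 [of "Rep_tens_pos z"] by simp
qed

lemma form_linear_mem:
  assumes "clinear f" "csubspace Y"
    "\<And>p q x y. x \<in> tpow p \<Longrightarrow> y \<in> tpow q \<Longrightarrow> coeff0 y = 0 \<Longrightarrow> f (form x y) \<in> Y"
  shows "f (\<omega> :: 'h tens_pos omega1) \<in> Y"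
proof (rule linear_span_mem [OF assms(1,2) _ tensor_span])
  fix w assume "w \<in> {x \<otimes>\<^sub>t y :: 'h tens_pos omega1 | x y. True}"
  then obtain x y where w: "w = form x y" by (auto simp: tensor_of_form)
  have "f (form (pure xs) (pure ys)) \<in> Y" for xs ys
  proof (cases "ys = []")
    case True
    then show ?thesis by (simp add: pure_Nil clinear_zero [OF assms(1)] complex_vector.subspace_0 [OF assms(2)])
  next
    case False
    then show ?thesis by (intro assms(3) [OF pure_tpow [OF refl] pure_tpow [OF refl]]) (simp add: coeff0_pure)
  qed
  then have "f (form (pure xs) y) \<in> Y" for xs y
    by (rule tens_linear_mem [OF clinear_compose [OF form_linear_right assms(1)] assms(2)])
  then show "f w \<in> Y"
    unfolding w by (rule tens_linear_mem [OF clinear_compose [OF form_linear_left assms(1)] assms(2)])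
qed

lemma form_omega_grade: "x \<in> tpow p \<Longrightarrow> y \<in> tpow q \<Longrightarrow> form x y \<in> omega_grade R (p + q)"
proof -
  assume x: "x \<in> tpow p" and y: "y \<in> tpow q"
  have "unitize x \<in> ugrade R p" by (simp add: ugrade_R x)
  then show "form x y \<in> omega_grade R (p + q)"
    using pos_part_grade [OF y] unfolding omega_grade_def form_def by (intro cspan_base) blast
qed

lemma omega_grade_linear_mem:
  assumes "clinear f" "csubspace Y"
    "\<And>p q x y. x \<in> tpow p \<Longrightarrow> y \<in> tpow q \<Longrightarrow> coeff0 y = 0 \<Longrightarrow> p + q = n \<Longrightarrow> f (form x y) \<in> Y"
    "\<omega> \<in> omega_grade R n"
  shows "f \<omega> \<in> Y"
proof (rule linear_span_mem [OF assms(1,2) _ assms(4) [unfolded omega_grade_def]])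
  fix w assume "w \<in> {x \<otimes>\<^sub>t y | x y p q. x \<in> ugrade R p \<and> y \<in> grade R q \<and> p + q = n}"
  then obtain x y p q where "w = form (deunit x) (Rep_tens_pos y)" "deunit x \<in> tpow p" "Rep_tens_pos y \<in> tpow q" "p + q = n"
    by (auto simp: tensor_of_form ugrade_R grade_R)
  then show "f w \<in> Y" using assms(3) by simp
qed

lemma form_commutator:
  assumes "x \<in> tpow p" "y \<in> tpow m" "r \<in> tpow q" "coeff0 y = 0" "coeff0 r = 0"
  shows "form x (y * r) - form (x * y) r - (- 1) ^ ((p + m) * q) *\<^sub>C form (r * x) y \<in> W1"
proof -
  have "omega_right (form x y) (pos_part r) - (- 1) ^ ((p + m) * q) *\<^sub>C omega_left (pos_part r) (form x y) \<in> omega_comms R"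
    unfolding omega_comms_def using form_omega_grade [OF assms(1,2)] pos_part_grade [OF assms(3)] by blast
  then have "omega_right (form x y) (pos_part r) - (- 1) ^ ((p + m) * q) *\<^sub>C omega_left (pos_part r) (form x y) \<in> W1"
    by (intro cspan_base) blast
  then show ?thesis using assms(4,5) by (simp add: omega_right_form omega_left_form)
qed

lemma form_coinvariant: "sws (\<lambda>a b. form (a \<rhd> x) (b \<rhd> y)) h - \<delta> h *\<^sub>C form x y \<in> W1"
proof -
  have "omega_act H R h (form x y) - \<delta> h *\<^sub>C form x y \<in> coinv \<delta> (omega_act H R)"
    unfolding coinv_def by blast
  then have "omega_act H R h (form x y) - \<delta> h *\<^sub>C form x y \<in> W1"
    by (intro cspan_base) blast
  then show ?thesis by (simp add: omega_act_form)
qed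

text \<open>By linearity the relations need to be considered only for forms \<open>x dy\<close> with
  homogeneous \<open>x\<close> and \<open>y\<close>, where commutator and action have explicit
  formulas.\<close>

lemma W1_linear_mem:
  assumes f: "clinear f" and Y: "csubspace Y"
    and comm: "\<And>p m q x y r. x \<in> tpow p \<Longrightarrow> y \<in> tpow m \<Longrightarrow> r \<in> tpow q \<Longrightarrow> coeff0 y = 0 \<Longrightarrow> coeff0 r = 0 \<Longrightarrow>
        f (form x (y * r) - form (x * y) r - (- 1) ^ ((p + m) * q) *\<^sub>C form (r * x) y) \<in> Y"
    and co: "\<And>p q x y h. x \<in> tpow p \<Longrightarrow> y \<in> tpow q \<Longrightarrow> coeff0 y = 0 \<Longrightarrow>
        f (sws (\<lambda>a b. form (a \<rhd> x) (b \<rhd> y)) h - \<delta> h *\<^sub>C form x y) \<in> Y"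
    and \<omega>: "\<omega> \<in> W1"
  shows "f \<omega> \<in> Y"
proof (rule linear_span_mem [OF f Y _ \<omega>])
  note [simp] = clinearD [OF f]
  fix w assume "w \<in> omega_comms R \<union> coinv \<delta> (omega_act H R)"
  then show "f w \<in> Y"
  proof
    assume "w \<in> omega_comms R"
    then obtain \<eta> z p q where w: "w = omega_right \<eta> z - (- 1) ^ (p * q) *\<^sub>C omega_left z \<eta>"
      and \<eta>: "\<eta> \<in> omega_grade R p" and z: "z \<in> grade R q"
      by (auto simp: omega_comms_def)
    define r where "r = Rep_tens_pos z"
    have r: "z = pos_part r" "coeff0 r = 0" "r \<in> tpow q" using z by (simp_all add: r_def grade_R)
    have "f (omega_right \<eta> z - (- 1) ^ (p * q) *\<^sub>C omega_left z \<eta>) \<in> Y"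
    proof (rule omega_grade_linear_mem [OF _ Y _ \<eta>, of "\<lambda>\<eta>. f (omega_right \<eta> z - (- 1) ^ (p * q) *\<^sub>C omega_left z \<eta>)"])
      show "clinear (\<lambda>\<eta>. f (omega_right \<eta> z - (- 1) ^ (p * q) *\<^sub>C omega_left z \<eta>))"
        by (simp add: clinear_iff algebra_simps scaleC_add_right scaleC_diff_right)
      show "f (omega_right (form x y) z - (- 1) ^ (p * q) *\<^sub>C omega_left z (form x y)) \<in> Y"
        if "x \<in> tpow a" "y \<in> tpow m" "coeff0 y = 0" "a + m = p" for a m x y
        using comm [OF that(1,2) r(3) that(3) r(2)] that
        unfolding r(1) omega_right_form [OF r(2) that(3)] omega_left_form [OF r(2)] by simp
    qed
    then show ?thesis unfolding w .
  next
    assume "w \<in> coinv \<delta> (omega_act H R)"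
    then obtain h \<eta> where w: "w = omega_act H R h \<eta> - \<delta> h *\<^sub>C \<eta>" by (auto simp: coinv_def)
    show ?thesis unfolding w
      by (rule form_linear_mem [of "\<lambda>\<eta>. f (omega_act H R h \<eta> - \<delta> h *\<^sub>C \<eta>)", OF _ Y])
        (use co in \<open>auto simp: clinear_iff omega_act_form algebra_simps scaleC_add_right scaleC_diff_right\<close>)
  qed
qed

subsection \<open>A linear invariant of one-forms\<close>

lemmas Lam_pow_simps = clinearD [OF clinear_Lpow]

text \<open>The exponents run from 1 to \<open>p\<close>: these are the rotations that bring a
  letter of \<open>x\<close> to the end. They are subtracted from the full norm, so that only the
  degree of \<open>x\<close> has to be known.\<close>

definition partial_norm :: "nat \<Rightarrow> 'h tens \<Rightarrow> 'h tens"
  where "partial_norm p u = (\<Sum>i<p. (Lam ^^ Suc i) u)"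

lemma partial_norm_linear: "clinear (partial_norm p)"
  unfolding partial_norm_def [abs_def] by (intro clinear_sum_fun clinear_Lpow)

lemmas partial_norm_simps = clinearD [OF partial_norm_linear]

text \<open>On \<open>x dy\<close> with \<open>x\<close> of degree \<open>p\<close> and \<open>y\<close> of degree \<open>m\<close> this is the sum of \<open>Lam ^ i (Phi (x y))\<close>
  over \<open>p < i \<le> p + m\<close>, that is, over the rotations of \<open>x y\<close> that bring a letter of \<open>y\<close> to the end.
  Its kernel turns out to be exactly \<open>W1\<close>.\<close>

definition form_inv :: "'h tens_pos omega1 \<Rightarrow> 'h tens"
  where "form_inv = tensor_lift (\<lambda>z w. N (Phi (deunit z * Rep_tens_pos w))
     - by_degree (\<lambda>p x. partial_norm p (Phi (x * Rep_tens_pos w))) (deunit z))"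

lemma form_inv_linear: "clinear form_inv"
  and form_inv_form: "x \<in> tpow p \<Longrightarrow> coeff0 y = 0 \<Longrightarrow>
     form_inv (form x y) = N (Phi (x * y)) - partial_norm p (Phi (x * y))"
proof -
  define B where "B x y = by_degree (\<lambda>p x. partial_norm p (Phi (x * y))) x" for x y
  have F: "clinear (\<lambda>x. partial_norm p (Phi (x * y)))" "clinear (\<lambda>y. partial_norm p (Phi (x * y)))" for p x y
    by (simp_all add: clinear_iff partial_norm_simps algebra_simps)
  have L: "clinear (\<lambda>x. B x y)" for y unfolding B_def by (rule clinear_by_degree) (rule F)
  have R: "clinear (\<lambda>y. B x y)" for x unfolding B_def by (rule by_degree_clinear_param) (rule F)+
  have bil: "cbilinear (\<lambda>z w. N (Phi (deunit z * Rep_tens_pos w)) - B (deunit z) (Rep_tens_pos w))"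
    by (simp add: cbilinear_iff deunit_simps algebra_simps clinear_add [OF L] clinear_scale [OF L]
        clinear_add [OF R] clinear_scale [OF R] scaleC_diff_right)
  show "clinear form_inv" unfolding form_inv_def B_def [symmetric] by (rule clinear_tensor_lift [OF bil])
  show "form_inv (form x y) = N (Phi (x * y)) - partial_norm p (Phi (x * y))"
    if "x \<in> tpow p" "coeff0 y = 0"
    unfolding form_inv_def B_def [symmetric] form_def tensor_lift_tensor_of [OF bil] using that
    by (simp add: B_def by_degree_tpow [OF F(1) that(1)])
qed

lemmas form_inv_simps [simp] = clinearD [OF form_inv_linear]

lemma N_shift: "z \<in> tpow k \<Longrightarrow> N z = (\<Sum>i<Suc k. (Lam ^^ Suc i) z)"
proof -
  assume z: "z \<in> tpow k"
  then have "Lam z \<in> tpow k" using Lam_degree by (simp add: degree_map_0)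
  then have "N (Lam z) = (\<Sum>i\<le>k. (Lam ^^ i) (Lam z))" by (rule N_tpow)
  then show ?thesis by (simp only: N_L funpow_Suc_right o_apply lessThan_Suc_atMost)
qed

lemma form_inv_form_sum:
  assumes "x \<in> tpow p" "y \<in> tpow m" "coeff0 y = 0"
  shows "form_inv (form x y) = (\<Sum>i\<in>{p..<p + m}. (Lam ^^ Suc i) (Phi (x * y)))"
proof (cases m)
  case 0
  then have "y = coeff0 y *\<^sub>C 1" using assms(2) tpow_0 by blast
  then have "y = 0" using assms(3) by simp
  then show ?thesis by (simp add: 0)
next
  case (Suc k)
  have "x * y \<in> tpow (Suc (p + k))" using tpow_mult [OF assms(1,2)] Suc by simp
  then have "Phi (x * y) \<in> tpow (p + k)" using Phi_degree by (simp add: degree_map_neg1)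
  from N_shift [OF this] have "N (Phi (x * y)) = (\<Sum>i<p + m. (Lam ^^ Suc i) (Phi (x * y)))"
    by (simp add: Suc)
  also have "\<dots> = partial_norm p (Phi (x * y)) + (\<Sum>i\<in>{p..<p + m}. (Lam ^^ Suc i) (Phi (x * y)))"
    unfolding partial_norm_def lessThan_atLeast0 by (rule sum.atLeastLessThan_concat [symmetric]) auto
  finally show ?thesis unfolding form_inv_form [OF assms(1,3)] by simp
qed

lemma form_inv_W1: "\<omega> \<in> W1 \<Longrightarrow> form_inv \<omega> = 0"
proof -
  assume \<omega>: "\<omega> \<in> W1"
  have "form_inv \<omega> \<in> {0}"
  proof (rule W1_linear_mem [OF form_inv_linear _ _ _ \<omega>])
    fix p m q and x y r :: "'h tens"
    assume h: "x \<in> tpow p" "y \<in> tpow m" "r \<in> tpow q" "coeff0 y = 0" "coeff0 r = 0"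
    let ?u = "Phi (x * y * r)" and ?v = "Phi (r * x * y)"
    let ?s = "(- 1) ^ ((p + m) * q) :: complex"
    \<comment> \<open>The rotations for the letters of \<open>y r\<close> are those for
      \<open>y\<close> followed by those for \<open>r\<close>.\<close>
    have 1: "form_inv (form x (y * r)) = (\<Sum>i\<in>{p..<p + m}. (Lam ^^ Suc i) ?u) + form_inv (form (x * y) r)"
      unfolding form_inv_form_sum [OF h(1) tpow_mult [OF h(2,3)] ] form_inv_form_sum [OF tpow_mult [OF h(1,2)] h(3,5)]
      using h(4) form_inv_form_sum [OF h(1) tpow_mult [OF h(2,3)]]
        sum.atLeastLessThan_concat [of p "p + m" "p + m + q" "\<lambda>i. (Lam ^^ Suc i) ?u"]
      by (simp only: coeff0_mult mult_zero_left mult.assoc add.assoc le_add1 le_add2)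
    \<comment> \<open>Rotating the \<open>q\<close> letters of \<open>r\<close> to the end turns
      \<open>r x y\<close> into \<open>x y r\<close> up to sign. This shifts the exponents for the
      letters of \<open>y\<close> by \<open>q\<close>.\<close>
    have "(Lam ^^ q) ?v = ?s *\<^sub>C ?u"
      using Lam_funpow_Phi [OF h(3) tpow_mult [OF h(1,2)]] by (simp add: mult.assoc mult.commute [of q])
    then have 2: "(Lam ^^ Suc (i + q)) ?v = ?s *\<^sub>C (Lam ^^ Suc i) ?u" for i
      by (simp add: funpow_add Lam_pow_simps)
    have "form_inv (form (r * x) y) = (\<Sum>i\<in>{p + q..<p + m + q}. (Lam ^^ Suc i) ?v)"
      using form_inv_form_sum [OF tpow_mult [OF h(3,1)] h(2,4)] by (simp add: add.commute add.left_commute)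
    also have "\<dots> = ?s *\<^sub>C (\<Sum>i\<in>{p..<p + m}. (Lam ^^ Suc i) ?u)"
      unfolding sum.shift_bounds_nat_ivl 2 complex_vector.scale_sum_right ..
    finally show "form_inv (form x (y * r) - form (x * y) r - ?s *\<^sub>C form (r * x) y) \<in> {0}"
      using 1 by (simp add: power_mult_distrib [symmetric] del: funpow.simps)
  next
    fix p q and x y :: "'h tens" and h
    assume a: "x \<in> tpow p" "y \<in> tpow q" "coeff0 y = 0"
    have ax: "h \<rhd> x \<in> tpow p" for h using a(1) act_degree by (simp add: degree_map_0)
    let ?l = "\<lambda>z. N (Phi z) - partial_norm p (Phi z)"
    have l: "clinear ?l" by (simp add: clinear_iff partial_norm_simps algebra_simps scaleC_diff_right)
    have "form_inv (sws (\<lambda>a b. form (a \<rhd> x) (b \<rhd> y)) h) = sws (\<lambda>a b. ?l ((a \<rhd> x) * (b \<rhd> y))) h"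
      unfolding sws_linear [OF form_inv_linear] by (simp add: form_inv_form [OF ax] a(3))
    also have "\<dots> = ?l (h \<rhd> (x * y))" unfolding act_mult sws_linear [OF l] ..
    also have "\<dots> = \<delta> h *\<^sub>C form_inv (form x y)"
      by (simp add: Phi_act partial_norm_simps form_inv_form [OF a(1,3)] scaleC_diff_right)
    finally show "form_inv (sws (\<lambda>a b. form (a \<rhd> x) (b \<rhd> y)) h - \<delta> h *\<^sub>C form x y) \<in> {0}" by simp
  qed (rule complex_vector.subspace_single_0)
  then show "form_inv \<omega> = 0" by simp
qed

text \<open>The sign makes the differential of forms correspond to \<open>b\<close>; without it the
  result would be \<open>- b\<close>, as the derivation anticommutes with
  \<open>parity\<close>.\<close>

definition G :: "'h tens \<Rightarrow> 'h tens_pos omega1" where "G z = form (parity z) e"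

lemma G_linear: "clinear G" by (simp add: clinear_iff G_def)

lemmas G_simps = clinearD [OF G_linear]

lemma form_inv_G: "z \<in> tpow n \<Longrightarrow> form_inv (G z) = Lam z"
proof -
  assume z: "z \<in> tpow n"
  have "parity z \<in> tpow n" using z parity_degree by (simp add: degree_map_0)
  from form_inv_form_sum [OF this e_tpow coeff0_e]
  have "form_inv (G z) = (Lam ^^ Suc n) (Phi (parity z * e))" by (simp add: G_def)
  also have "\<dots> = Lam ((- 1) ^ n *\<^sub>C (Lam ^^ n) (Phi (z * e)))"
    by (simp add: parity_tpow [OF z] Lam_pow_simps)
  also have "\<dots> = Lam z" unfolding Lam_funpow_Phi [OF z e_tpow] by (simp add: power_mult_distrib [symmetric])
  finally show ?thesis .
qed

text \<open>The sum of the homogeneous inverses \<open>Lam ^ n\<close> in degree \<open>n\<close> is an inverse of \<open>Lam\<close>.\<close>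

lemma Lam_0: "z = 0" if "Lam z = 0"
proof -
  let ?I = "by_degree (\<lambda>n. Lam ^^ n)"
  have I: "clinear ?I" by (rule clinear_by_degree) (rule clinear_Lpow)
  have "?I (Lam z) = z"
  proof (rule tens_linear_eq_tpow [of "\<lambda>z. ?I (Lam z)" "\<lambda>z. z" z])
    show "clinear (\<lambda>z. ?I (Lam z))" by (rule clinear_compose [OF clinear_L I])
    show "?I (Lam z) = z" if "z \<in> tpow n" for n z
    proof -
      have "Lam z \<in> tpow n" using that Lam_degree by (simp add: degree_map_0)
      then show ?thesis
        using Lam_period [OF that] by (simp add: by_degree_tpow [OF clinear_Lpow] funpow_Suc_right del: funpow.simps)
    qed
  qed (rule clinear_id)
  then show ?thesis using that clinear_zero [OF I] by simp
qed

text \<open>The involution writes the letter \<open>v\<close> as \<open>Sd (Sd v) \<rhd> e\<close>,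
  and the outer \<open>Sd\<close> is what moving \<open>Sd v\<close> across the form
  produces.\<close>

lemma form_move: "form x (pure [v]) - form (Sd v \<rhd> x) e \<in> W1"
proof -
  have "form (Sd v \<rhd> x) e - form x (Sd (Sd v) \<rhd> e) \<in> W1"
    by (rule coinvariant_move [OF cbilinear_form subspace_cspan form_coinvariant])
  then have "- (form (Sd v \<rhd> x) e - form x (Sd (Sd v) \<rhd> e)) \<in> W1" by (rule complex_vector.span_neg)
  then show ?thesis by (simp add: twisted_involution act_e)
qed

text \<open>The commutator relation acts as a Leibniz rule: \<open>x d(y v)\<close> is congruent to
  \<open>(x y) dv\<close> plus or minus \<open>(v x) dy\<close>. By induction only single letters
  remain under \<open>d\<close>, and these can be moved to the coefficient.\<close>

lemma G_representative:
  assumes "\<omega> \<in> omega_grade R (Suc n)"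
  obtains z where "z \<in> tpow n" "\<omega> - G z \<in> W1"
proof -
  define Y where "Y n = {\<omega>. \<exists>z\<in>tpow n. \<omega> - G z \<in> W1}" for n
  have Y: "csubspace (Y n)" for n
  proof (rule complex_vector.subspaceI)
    show "0 \<in> Y n"
      unfolding Y_def by (auto intro!: bexI [of _ 0] simp: G_simps tpow_closed complex_vector.span_zero)
    show "\<omega> + \<omega>' \<in> Y n" if a: "\<omega> \<in> Y n" "\<omega>' \<in> Y n" for \<omega> \<omega>'
    proof -
      obtain z z' where z: "z \<in> tpow n" "\<omega> - G z \<in> W1" "z' \<in> tpow n" "\<omega>' - G z' \<in> W1"
        using a unfolding Y_def by blast
      then have "(\<omega> + \<omega>') - G (z + z') \<in> W1"
        using W_closed(1) [OF z(2,4)] by (simp add: G_simps algebra_simps)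
      then show ?thesis unfolding Y_def using tpow_closed(2) [OF z(1,3)] by blast
    qed
    show "c *\<^sub>C \<omega> \<in> Y n" if a: "\<omega> \<in> Y n" for c \<omega>
    proof -
      obtain z where z: "z \<in> tpow n" "\<omega> - G z \<in> W1" using a unfolding Y_def by blast
      then have "c *\<^sub>C \<omega> - G (c *\<^sub>C z) \<in> W1"
        using W_closed(3) [OF z(2), of c] by (simp add: G_simps scaleC_diff_right)
      then show ?thesis unfolding Y_def using tpow_closed(5) [OF z(1)] by blast
    qed
  qed
  have W1_Y: "\<omega> \<in> Y n" if a: "\<omega> - \<eta> \<in> W1" "\<eta> \<in> Y n" for \<omega> \<eta> n
  proof -
    obtain z where z: "z \<in> tpow n" "\<eta> - G z \<in> W1" using a(2) unfolding Y_def by blast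
    then show ?thesis using W_closed(1) [OF a(1) z(2)] by (auto simp: Y_def)
  qed
  have step: "form x (pure ys) \<in> Y (p + m)" if "x \<in> tpow p" "length ys = Suc m" for x p ys m
    using that
  proof (induction m arbitrary: x p ys)
    case 0
    then obtain v where v: "ys = [v]" by (auto simp: length_Suc_conv)
    have "Sd v \<rhd> x \<in> tpow p" using 0 act_degree by (simp add: degree_map_0)
    then have "parity (Sd v \<rhd> x) \<in> tpow p" using parity_degree by (simp add: degree_map_0)
    moreover have "form x (pure ys) - G (parity (Sd v \<rhd> x)) \<in> W1" unfolding v G_def parity_parity by (rule form_move)
    ultimately show ?case unfolding Y_def by auto
  next
    case (Suc m)
    obtain zs v where ys: "ys = zs @ [v]" "length zs = Suc m"
      using Suc.prems(2) by (metis length_Suc_conv_rev)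
    let ?s = "(- 1) ^ ((p + Suc m) * 1) :: complex"
    have v: "pure [v] \<in> tpow 1" and zs: "pure zs \<in> tpow (Suc m)" using ys(2) by (simp_all add: pure_tpow)
    have c: "coeff0 (pure zs) = 0" "coeff0 (pure [v]) = 0" using ys(2) by (auto simp: coeff0_pure)
    have "form x (pure zs * pure [v]) - form (x * pure zs) (pure [v]) - ?s *\<^sub>C form (pure [v] * x) (pure zs) \<in> W1"
      by (rule form_commutator [OF Suc.prems(1) zs v c])
    then have "form x (pure ys) - (form (x * pure zs) (pure [v]) + ?s *\<^sub>C form (pure [v] * x) (pure zs)) \<in> W1"
      unfolding ys(1) diff_diff_eq pure_mult .
    moreover have "form (x * pure zs) (pure [v]) \<in> Y (p + Suc m)"
    proof -
      have xz: "x * pure zs \<in> tpow (p + Suc m)" by (rule tpow_mult [OF Suc.prems(1) zs])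
      have "Sd v \<rhd> (x * pure zs) \<in> tpow (p + Suc m)" using xz act_degree unfolding degree_map_0 by blast
      then have "parity (Sd v \<rhd> (x * pure zs)) \<in> tpow (p + Suc m)" using parity_degree unfolding degree_map_0 by blast
      moreover have "form (x * pure zs) (pure [v]) - G (parity (Sd v \<rhd> (x * pure zs))) \<in> W1"
        unfolding G_def parity_parity by (rule form_move)
      ultimately show ?thesis unfolding Y_def by blast
    qed
    moreover have "form (pure [v] * x) (pure zs) \<in> Y (p + Suc m)"
      using Suc.IH [OF tpow_mult [OF v Suc.prems(1)] ys(2)] by simp
    ultimately show ?case
      by (rule W1_Y [OF _ complex_vector.subspace_add [OF Y _ complex_vector.subspace_scale [OF Y]]])
  qed
  have "\<omega> \<in> Y n"
  proof (rule omega_grade_linear_mem [of "\<lambda>\<omega>. \<omega>", OF clinear_id Y _ assms])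
    fix p q and x y :: "'h tens"
    assume h: "x \<in> tpow p" "y \<in> tpow q" "coeff0 y = 0" "p + q = Suc n"
    show "form x y \<in> Y n"
    proof (cases q)
      case 0
      then have "y = coeff0 y *\<^sub>C 1" using h(2) tpow_0 by blast
      then have "form x y = 0" using h(3) by simp
      then show ?thesis using complex_vector.subspace_0 [OF Y] by simp
    next
      case (Suc m)
      then have n: "n = p + m" using h(4) by simp
      show ?thesis
        by (rule tpow_linear_mem [OF form_linear_right Y _ h(2)]) (use step [OF h(1)] Suc n in auto)
    qed
  qed
  then show ?thesis using that by (auto simp: Y_def)
qed

text \<open>A form with invariant zero is congruent to some \<open>G z\<close>, whose invariant is
  \<open>Lam z\<close>; injectivity of \<open>Lam\<close> then gives \<open>z = 0\<close>.\<close>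

lemma W1_iff:
  assumes "\<omega> \<in> omega_grade R (Suc n)"
  shows "\<omega> \<in> W1 \<longleftrightarrow> form_inv \<omega> = 0"
proof
  assume 0: "form_inv \<omega> = 0"
  obtain z where z: "z \<in> tpow n" "\<omega> - G z \<in> W1" using G_representative [OF assms] .
  have "Lam z = 0" using form_inv_W1 [OF z(2)] 0 by (simp add: form_inv_G [OF z(1)])
  then have "z = 0" by (rule Lam_0)
  then show "\<omega> \<in> W1" using z(2) by (simp add: G_simps)
qed (rule form_inv_W1)

lemma G_inj: "z \<in> tpow n \<Longrightarrow> G z \<in> W1 \<Longrightarrow> z = 0"
  using form_inv_W1 form_inv_G Lam_0 by metis

subsection \<open>The maps of the localized X-complex\<close>

lemma sign_mult_self: "(- 1) ^ n * (- 1) ^ n = (1::complex)"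
  by (simp add: power_mult_distrib [symmetric])

text \<open>The differential of a commutator relation is a signed sum of three such relations, in
  which one of \<open>x\<close>, \<open>y\<close>, \<open>r\<close> has been differentiated. A
  coinvariance relation gives two in the same way.\<close>

lemma omega_dif_W1:
  assumes "\<omega> \<in> W1"
  shows "omega_dif R \<omega> \<in> W1"
proof (rule W1_linear_mem [OF omega_dif_linear subspace_cspan _ _ assms])
  fix p m q and x y r :: "'h tens"
  assume h: "x \<in> tpow p" "y \<in> tpow m" "r \<in> tpow q" "coeff0 y = 0" "coeff0 r = 0"
  have Dd: "D x \<in> tpow (Suc p)" "D y \<in> tpow (Suc m)" "D r \<in> tpow (Suc q)"
    using h(1-3) D_degree by (simp_all add: degree_map_1)
  let ?a = "(- 1) ^ p :: complex" and ?b = "(- 1) ^ m :: complex" and ?c = "(- 1) ^ q :: complex"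
  let ?s = "(- 1) ^ ((p + m) * q) :: complex"
  have s: "(- 1) ^ ((Suc p + m) * q) = ?s * ?c" "(- 1) ^ ((p + Suc m) * q) = ?s * ?c"
    "(- 1) ^ ((p + m) * Suc q) = ?a * ?b * ?s"
    by (simp_all add: power_add algebra_simps)
  note 1 = form_commutator [OF Dd(1) h(2,3,4,5), unfolded s]
    complex_vector.span_scale [OF form_commutator [OF h(1) Dd(2) h(3) coeff0_D h(5), unfolded s], of ?a]
    complex_vector.span_scale [OF form_commutator [OF h(1,2) Dd(3) h(4) coeff0_D, unfolded s], of "?a * ?b"]
  have sq: "?a * (?a * z) = z" "?b * (?b * z) = z" for z
    by (simp_all add: mult.assoc [symmetric] sign_mult_self)
  have "omega_dif R (form x (y * r) - form (x * y) r - ?s *\<^sub>C form (r * x) y)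
    = (form (D x) (y * r) - form (D x * y) r - (?s * ?c) *\<^sub>C form (r * D x) y)
      + ?a *\<^sub>C (form x (D y * r) - form (x * D y) r - (?s * ?c) *\<^sub>C form (r * x) (D y))
      + (?a * ?b) *\<^sub>C (form x (y * D r) - form (x * y) (D r) - (?a * ?b * ?s) *\<^sub>C form (D r * x) y)"
    by (simp add: omega_dif_form D_mult parity_mult parity_tpow [OF h(1)] parity_tpow [OF h(2)] parity_tpow [OF h(3)]
        scaleC_diff_right scaleC_add_right algebra_simps sq)
  also have "\<dots> \<in> W1" by (intro complex_vector.span_add 1)
  finally show "omega_dif R (form x (y * r) - form (x * y) r - ?s *\<^sub>C form (r * x) y) \<in> W1" .
next
  fix p q and x y :: "'h tens" and h
  assume a: "x \<in> tpow p" "y \<in> tpow q" "coeff0 y = 0"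
  let ?a = "(- 1) ^ p :: complex"
  have "h \<rhd> x \<in> tpow p" for h using a(1) act_degree by (simp add: degree_map_0)
  then have ax: "parity (h \<rhd> x) = ?a *\<^sub>C (h \<rhd> x)" for h by (rule parity_tpow)
  have "omega_dif R (sws (\<lambda>a b. form (a \<rhd> x) (b \<rhd> y)) h - \<delta> h *\<^sub>C form x y)
     = (sws (\<lambda>a b. form (a \<rhd> D x) (b \<rhd> y)) h - \<delta> h *\<^sub>C form (D x) y)
      + ?a *\<^sub>C (sws (\<lambda>a b. form (a \<rhd> x) (b \<rhd> D y)) h - \<delta> h *\<^sub>C form x (D y))"
    by (simp add: sws_linear [OF omega_dif_linear] omega_dif_form act_D ax parity_tpow [OF a(1)]
      scaleC_diff_right scaleC_add_right algebra_simps)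
  also have "\<dots> \<in> W1" by (intro complex_vector.span_add complex_vector.span_scale form_coinvariant)
  finally show "omega_dif R (sws (\<lambda>a b. form (a \<rhd> x) (b \<rhd> y)) h - \<delta> h *\<^sub>C form x y) \<in> W1" .
qed

text \<open>Put \<open>u = Phi (x y)\<close>. The commutator maps to \<open>u - Lam^p u\<close>,
  while \<open>Lam - 1\<close> telescopes on the sum of rotations and leaves
  \<open>Lam^(p+q+1) u - Lam^(p+1) u\<close>. These agree after one more \<open>Lam\<close>, because
  \<open>Lam^(p+q) u = u\<close> for a word of length \<open>p + q\<close>. The extra
  \<open>Lam\<close> avoids negative powers.\<close>

lemma Lam_Phi_omega_b: "Lam (Phi (Rep_tens_pos (omega_b R \<omega>))) = Lam (form_inv \<omega>) - form_inv \<omega>"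
proof (rule form_linear_eq)
  show "clinear (\<lambda>\<omega>. Lam (Phi (Rep_tens_pos (omega_b R \<omega>))))" "clinear (\<lambda>\<omega>. Lam (form_inv \<omega>) - form_inv \<omega>)"
    by (simp_all add: clinear_iff scaleC_diff_right)
  fix p q and x y :: "'h tens"
  assume h: "x \<in> tpow p" "y \<in> tpow q" "coeff0 y = 0"
  let ?u = "Phi (x * y)"
  have "Rep_tens_pos (omega_b R (form x y)) = x * y - (- 1) ^ (p * q) *\<^sub>C (y * x)"
    using h(3) by (simp add: omega_b_form [OF h])
  then have 1: "Phi (Rep_tens_pos (omega_b R (form x y))) = ?u - (Lam ^^ p) ?u"
    by (simp add: Lam_funpow_Phi [OF h(1,2)])
  have tel: "Lam (\<Sum>i\<in>{p..<p + k}. (Lam ^^ Suc i) ?u) - (\<Sum>i\<in>{p..<p + k}. (Lam ^^ Suc i) ?u)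
     = (Lam ^^ Suc (p + k)) ?u - (Lam ^^ Suc p) ?u" for k
    by (induction k) (simp_all add: algebra_simps)
  have 2: "Lam (form_inv (form x y)) - form_inv (form x y) = (Lam ^^ Suc (p + q)) ?u - (Lam ^^ Suc p) ?u"
    unfolding form_inv_form_sum [OF h] by (rule tel)
  show "Lam (Phi (Rep_tens_pos (omega_b R (form x y)))) = Lam (form_inv (form x y)) - form_inv (form x y)"
  proof (cases "p + q")
    case 0
    then have "y = coeff0 y *\<^sub>C 1" using h(2) tpow_0 by simp
    then have "y = 0" using h(3) by simp
    then show ?thesis by simp
  next
    case (Suc k)
    have "x * y \<in> tpow (Suc k)" using tpow_mult [OF h(1,2)] Suc by simp
    then have "?u \<in> tpow k" using Phi_degree by (simp add: degree_map_neg1)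
    then have "(Lam ^^ (p + q)) ?u = ?u" unfolding Suc by (rule Lam_period)
    then show ?thesis unfolding 1 2 by simp
  qed
qed

lemma omega_b_W1: "\<omega> \<in> W1 \<Longrightarrow> omega_b R \<omega> \<in> W0"
  unfolding W0_iff by (rule Lam_0) (simp add: Lam_Phi_omega_b form_inv_W1)

lemma omega_b_G:
  assumes "z \<in> tpow n"
  shows "omega_b R (G z) + pos_part (e * (z - Lam z)) \<in> W0"
proof -
  have "Lam (Phi (Rep_tens_pos (omega_b R (G z)))) = Lam (Lam z - z)"
    by (simp add: Lam_Phi_omega_b form_inv_G [OF assms])
  then have "Lam (Phi (Rep_tens_pos (omega_b R (G z))) - (Lam z - z)) = 0" by simp
  then have "Phi (Rep_tens_pos (omega_b R (G z))) - (Lam z - z) = 0" by (rule Lam_0)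
  then show ?thesis by (simp add: W0_iff algebra_simps)
qed

lemma form_inv_d: "coeff0 v = 0 \<Longrightarrow> form_inv (omega_d (pos_part v)) = N (Phi v)"
proof -
  assume v: "coeff0 v = 0"
  have "(1 :: 'h tens) \<in> tpow 0" by (simp add: pure_Nil [symmetric] pure_tpow)
  from form_inv_form [OF this v] show ?thesis by (simp add: omega_d_form v partial_norm_def)
qed

lemma omega_d_grade:
  assumes "z \<in> grade R n"
  shows "omega_d z \<in> omega_grade R n"
proof -
  have "(1 :: 'h tens) \<in> tpow 0" by (simp add: pure_Nil [symmetric] pure_tpow)
  from form_omega_grade [OF this assms [unfolded grade_R]] show ?thesis
    using omega_d_form [of "Rep_tens_pos z"] by simp
qed

text \<open>\<open>H\<close> acts on the adjoined unit through the counit, so the coinvariance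
  relation of \<open>1 dv\<close> is \<open>d\<close> of that of \<open>v\<close>.\<close>

lemma omega_d_W0: "z \<in> W0 \<Longrightarrow> omega_d z \<in> W1"
proof (rule linear_span_mem [OF omega_d_linear subspace_cspan])
  fix w assume "w \<in> coinv \<delta> (dga.act R)"
  then obtain h v where w: "w = dga.act R h (pos_part (Rep_tens_pos v)) - \<delta> h *\<^sub>C pos_part (Rep_tens_pos v)"
    by (auto simp: coinv_def)
  let ?v = "Rep_tens_pos v"
  have "sws (\<lambda>a b. form (a \<rhd> 1) (b \<rhd> ?v)) h = form 1 (h \<rhd> ?v)"
    using counit_left_sws [OF clinear_compose [OF act_linear_left form_linear_right], of 1 ?v h] by simp
  then show "omega_d w \<in> W1"
    using form_coinvariant [of 1 ?v h] unfolding w act_R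
    by (simp add: omega_d_form omega_d_form [of ?v, simplified])
qed

lemma G_grade: "z \<in> tpow n \<Longrightarrow> G z \<in> omega_grade R (Suc n)"
proof -
  assume "z \<in> tpow n"
  then have "parity z \<in> tpow n" using parity_degree by (simp add: degree_map_0)
  from form_omega_grade [OF this e_tpow] show "G z \<in> omega_grade R (Suc n)" by (simp add: G_def)
qed

lemma omega_d_G:
  assumes "z \<in> tpow n"
  shows "omega_d (pos_part (e * z)) - G (N z) \<in> W1"
proof -
  have ez: "e * z \<in> tpow (Suc n)" using tpow_mult [OF e_tpow assms] by simp
  have Nz: "N z \<in> tpow n" using assms N_degree by (simp add: degree_map_0)
  have mem: "omega_d (pos_part (e * z)) - G (N z) \<in> omega_grade R (Suc n)"
    using omega_d_grade [OF pos_part_grade [OF ez]] G_grade [OF Nz] unfolding omega_grade_def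
    by (rule complex_vector.span_diff)
  show ?thesis unfolding W1_iff [OF mem] by (simp add: form_inv_d form_inv_G [OF Nz])
qed

lemma omega_dif_G:
  assumes "z \<in> tpow n"
  shows "omega_dif R (G z) - G (b z) \<in> W1"
proof -
  have "form z (e * e) - form (z * e) e - (- 1) ^ ((n + 1) * 1) *\<^sub>C form (e * z) e \<in> W1"
    by (rule form_commutator [OF assms e_tpow e_tpow coeff0_e coeff0_e])
  then show ?thesis
    by (simp add: G_def b_def omega_dif_form D_e parity_D parity_mult parity_e parity_tpow [OF assms] algebra_simps)
qed

text \<open>The universal \<open>d\<close> commutes with the differentials induced by the
  derivation. In the coordinates given by \<open>e\<close> and \<open>G\<close> it is
  \<open>N\<close>, and the differentials are \<open>b'\<close> and \<open>b\<close>; injectivity of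
  \<open>G\<close> modulo the relations turns the congruence into an equation.\<close>

lemma b_N: "b (N z) = N (b' z)"
proof (rule tens_linear_eq_tpow [of "\<lambda>z. b (N z)" "\<lambda>z. N (b' z)"])
  show "clinear (\<lambda>z. b (N z))" "clinear (\<lambda>z. N (b' z))"
    by (simp_all add: clinear_iff b_simps b'_simps)
  fix n and z :: "'h tens" assume z: "z \<in> tpow n"
  have Nz: "N z \<in> tpow n" and bNz: "b (N z) \<in> tpow (Suc n)" and b'z: "b' z \<in> tpow (Suc n)"
    using z N_degree b_degree b'_degree by (simp_all add: degree_map_0 degree_map_1)
  have "omega_dif R (omega_d (pos_part (e * z))) = omega_d (pos_part (e * b' z))"
    by (simp add: omega_d_form omega_dif_form D_mult D_e parity_e b'_def algebra_simps)
  then have 1: "omega_d (pos_part (e * b' z)) - omega_dif R (G (N z)) \<in> W1"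
    using omega_dif_W1 [OF omega_d_G [OF z]] by simp
  have "(omega_d (pos_part (e * b' z)) - omega_dif R (G (N z))) + (omega_dif R (G (N z)) - G (b (N z)))
      - (omega_d (pos_part (e * b' z)) - G (N (b' z))) \<in> W1"
    by (rule W_closed(2) [OF W_closed(1) [OF 1 omega_dif_G [OF Nz]] omega_d_G [OF b'z]])
  then have "G (N (b' z) - b (N z)) \<in> W1" by (simp add: G_simps)
  then have "N (b' z) - b (N z) = 0"
    using b'z bNz N_degree by (intro G_inj [of _ "Suc n"]) (auto simp: degree_map_0 tpow_closed)
  then show "b (N z) = N (b' z)" by simp
qed

lemma sign_twist: "sign_twist Lam b b' s"
  by (rule sign_twist.intro [OF cyclic_operator_axioms], unfold_locales)
    (rule b_degree b'_degree s_degree b_b b'_b' M_b b_N contraction)+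

end

section \<open>Maps into quotient spaces\<close>

lemma coset_eq_iff:
  assumes "csubspace W"
  shows "coset W x = coset W y \<longleftrightarrow> x - y \<in> W"
proof
  assume "coset W x = coset W y"
  moreover have "x \<in> coset W x" unfolding coset_def using complex_vector.subspace_0 [OF assms] by force
  ultimately obtain w where "w \<in> W" "x = y + w" by (auto simp: coset_def)
  then show "x - y \<in> W" by simp
next
  assume d: "x - y \<in> W"
  have "x + w = y + ((x - y) + w)" "y + w = x + (w - (x - y))" for w by simp_all
  then show "coset W x = coset W y"
    unfolding coset_def using complex_vector.subspace_add [OF assms d] complex_vector.subspace_diff [OF assms _ d]
    by (blast intro: image_eqI)
qed

lemma coset_0: "coset W 0 = W"
  by (simp add: coset_def)

lemma coset_add:
  assumes "csubspace W"
  shows "{a + c | a c. a \<in> coset W x \<and> c \<in> coset W y} = coset W (x + y)"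
proof (intro equalityI subsetI)
  fix z assume "z \<in> {a + c | a c. a \<in> coset W x \<and> c \<in> coset W y}"
  then obtain v w where "v \<in> W" "w \<in> W" "z = (x + y) + (v + w)" by (auto simp: coset_def algebra_simps)
  then show "z \<in> coset W (x + y)" using complex_vector.subspace_add [OF assms] by (auto simp: coset_def)
next
  fix z assume "z \<in> coset W (x + y)"
  then obtain w where "w \<in> W" "z = (x + w) + (y + 0)" by (auto simp: coset_def algebra_simps)
  then show "z \<in> {a + c | a c. a \<in> coset W x \<and> c \<in> coset W y}"
    using complex_vector.subspace_0 [OF assms] unfolding coset_def by blast
qed

lemma quot_map_coset:
  assumes W: "csubspace W" and W': "csubspace W'"
    and f: "clinear f" "f ` W \<subseteq> W'"
  shows "quot_map W' f (coset W x) = coset W' (f x)"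
proof (intro equalityI subsetI)
  fix z assume "z \<in> quot_map W' f (coset W x)"
  then obtain v w where "v \<in> W" "w \<in> W'" "z = f x + (f v + w)"
    by (auto simp: quot_map_def coset_def clinear_add [OF f(1)] algebra_simps)
  then show "z \<in> coset W' (f x)" using complex_vector.subspace_add [OF W'] f(2) by (auto simp: coset_def)
next
  fix z assume "z \<in> coset W' (f x)"
  then obtain w where "w \<in> W'" "z = f (x + 0) + w" by (auto simp: coset_def)
  then show "z \<in> quot_map W' f (coset W x)"
    unfolding quot_map_def coset_def using complex_vector.subspace_0 [OF W] by blast
qed

lemma coset_scale:
  assumes "csubspace W"
  shows "{c *\<^sub>C a + w | a w. a \<in> coset W x \<and> w \<in> W} = coset W (c *\<^sub>C x)"
  using quot_map_coset [OF assms assms, of "\<lambda>x. c *\<^sub>C x" x] complex_vector.subspace_scale [OF assms]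
  by (force simp: quot_map_def clinear_scale_fun clinear_id)

lemma lin_map_sub_space:
  assumes "clinear f" "\<And>x. x \<in> A \<Longrightarrow> f x \<in> B"
    and "csubspace A" "\<And>x. x \<in> A \<Longrightarrow> g x = f x"
  shows "lin_map (sub_space A) (sub_space B) g"
  using assms(2,4) complex_vector.subspace_add [OF assms(3)] complex_vector.subspace_scale [OF assms(3)]
  by (simp add: lin_map_def sub_space_def clinear_add [OF assms(1)] clinear_scale [OF assms(1)])

lemma lin_map_quot_space:
  assumes W: "csubspace W" "csubspace W'"
    and f: "clinear f" "f ` W \<subseteq> W'" "\<And>x. x \<in> A \<Longrightarrow> f x \<in> B"
  shows "lin_map (quot_space A W) (quot_space B W') (quot_map W' f)"
  using f(3)
  by (auto simp: lin_map_def quot_space_def coset_add [OF W(1)] coset_add [OF W(2)] coset_scale [OF W(1)]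
      coset_scale [OF W(2)] quot_map_coset [OF W f(1,2)] clinear_add [OF f(1)] clinear_scale [OF f(1)])

lemma lin_iso_coset:
  assumes W: "csubspace W" and A: "csubspace A"
    and f: "clinear f" "\<And>x. x \<in> A \<Longrightarrow> f x \<in> B"
    and inj: "\<And>x. x \<in> A \<Longrightarrow> f x \<in> W \<Longrightarrow> x = 0"
    and surj: "\<And>y. y \<in> B \<Longrightarrow> \<exists>x\<in>A. y - f x \<in> W"
  shows "lin_iso (sub_space A) (quot_space B W) (\<lambda>x. coset W (f x))"
  unfolding lin_iso_def
proof
  show "lin_map (sub_space A) (quot_space B W) (\<lambda>x. coset W (f x))"
    using f(2) by (simp add: lin_map_def sub_space_def quot_space_def coset_add [OF W] coset_scale [OF W]
        clinear_add [OF f(1)] clinear_scale [OF f(1)])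
  have "inj_on (\<lambda>x. coset W (f x)) A"
  proof (rule inj_onI)
    fix x y assume a: "x \<in> A" "y \<in> A" "coset W (f x) = coset W (f y)"
    then have "f (x - y) \<in> W" by (simp add: coset_eq_iff [OF W] clinear_diff [OF f(1)])
    then have "x - y = 0" using a complex_vector.subspace_diff [OF A] by (intro inj)
    then show "x = y" by simp
  qed
  moreover have "(\<lambda>x. coset W (f x)) ` A = coset W ` B"
  proof (intro equalityI subsetI)
    fix c assume "c \<in> coset W ` B"
    then obtain y where y: "y \<in> B" "c = coset W y" by blast
    then obtain x where "x \<in> A" "y - f x \<in> W" using surj by blast
    then show "c \<in> (\<lambda>x. coset W (f x)) ` A" using y coset_eq_iff [OF W] by blast
  qed (use f(2) in blast)
  ultimately show "bij_betw (\<lambda>x. coset W (f x)) (carrier (sub_space A)) (carrier (quot_space B W))"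
    by (simp add: bij_betw_def sub_space_def quot_space_def)
qed

text \<open>An isomorphism transports the relation \<open>d d = 0\<close>, so it need not be checked in the quotients.\<close>

lemma cochain_complex_transfer:
  assumes K: "cochain_complex K" and f: "cochain_iso K L f"
    and zero: "\<And>n. f n (vzero (obj K n)) = vzero (obj L n)"
    and lin: "\<And>n. lin_map (obj L n) (obj L (Suc n)) (dif L n)"
  shows "cochain_complex L"
  unfolding cochain_complex_def
proof (intro conjI allI ballI lin)
  fix n y assume "y \<in> carrier (obj L n)"
  then obtain x where x: "x \<in> carrier (obj K n)" "y = f n x"
    using f unfolding cochain_iso_def lin_iso_def bij_betw_def by blast
  have dx: "dif K n x \<in> carrier (obj K (Suc n))"
    using K x(1) unfolding cochain_complex_def lin_map_def by blast
  have "dif L (Suc n) (dif L n y) = f (Suc (Suc n)) (dif K (Suc n) (dif K n x))"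
    using f x dx unfolding cochain_iso_def by metis
  also have "dif K (Suc n) (dif K n x) = vzero (obj K (Suc (Suc n)))"
    using K x(1) unfolding cochain_complex_def by blast
  finally show "dif L (Suc n) (dif L n y) = vzero (obj L (Suc (Suc n)))" by (simp add: zero)
qed

lemma lin_map_carrier: "lin_map A B f \<Longrightarrow> x \<in> carrier A \<Longrightarrow> f x \<in> carrier B"
  by (simp add: lin_map_def)

text \<open>All relations are pulled back along the two column isomorphisms. Preservation of zero is
  a separate hypothesis because \<open>lin_map\<close> does not mention
  \<open>vzero\<close>.\<close>

lemma super_complex_transfer:
  assumes X: "super_complex X"
    and f: "cochain_iso (col0 X) (col0 Y) f" and g: "cochain_iso (col1 X) (col1 Y) g"
    and h01: "\<And>n x. x \<in> carrier (obj (col0 X) n) \<Longrightarrow> g n (hor01 X n x) = hor01 Y n (f n x)"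
    and h10: "\<And>n y. y \<in> carrier (obj (col1 X) n) \<Longrightarrow> f n (hor10 X n y) = hor10 Y n (g n y)"
    and zero: "\<And>n. f n (vzero (obj (col0 X) n)) = vzero (obj (col0 Y) n)"
      "\<And>n. g n (vzero (obj (col1 X) n)) = vzero (obj (col1 Y) n)"
    and lin: "\<And>n. lin_map (obj (col0 Y) n) (obj (col0 Y) (Suc n)) (dif (col0 Y) n)"
      "\<And>n. lin_map (obj (col1 Y) n) (obj (col1 Y) (Suc n)) (dif (col1 Y) n)"
      "\<And>n. lin_map (obj (col0 Y) n) (obj (col1 Y) n) (hor01 Y n)"
      "\<And>n. lin_map (obj (col1 Y) n) (obj (col0 Y) n) (hor10 Y n)"
  shows "super_complex Y"
proof -
  have f_add: "f n (vadd (obj (col0 X) n) x y) = vadd (obj (col0 Y) n) (f n x) (f n y)"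
    if "x \<in> carrier (obj (col0 X) n)" "y \<in> carrier (obj (col0 X) n)" for n x y
    using f that unfolding cochain_iso_def lin_iso_def lin_map_def by blast
  have g_add: "g n (vadd (obj (col1 X) n) x y) = vadd (obj (col1 Y) n) (g n x) (g n y)"
    if "x \<in> carrier (obj (col1 X) n)" "y \<in> carrier (obj (col1 X) n)" for n x y
    using g that unfolding cochain_iso_def lin_iso_def lin_map_def by blast
  have f_dif: "f (Suc n) (dif (col0 X) n x) = dif (col0 Y) n (f n x)" if "x \<in> carrier (obj (col0 X) n)" for n x
    using f that unfolding cochain_iso_def by blast
  have g_dif: "g (Suc n) (dif (col1 X) n x) = dif (col1 Y) n (g n x)" if "x \<in> carrier (obj (col1 X) n)" for n x
    using g that unfolding cochain_iso_def by blast
  have lm: "lin_map (obj (col0 X) n) (obj (col0 X) (Suc n)) (dif (col0 X) n)"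
    "lin_map (obj (col1 X) n) (obj (col1 X) (Suc n)) (dif (col1 X) n)"
    "lin_map (obj (col0 X) n) (obj (col1 X) n) (hor01 X n)"
    "lin_map (obj (col1 X) n) (obj (col0 X) n) (hor10 X n)" for n
    using X by (simp_all add: super_complex_def cochain_complex_def)
  note d = lin_map_carrier [OF lm(1)] lin_map_carrier [OF lm(3)]
  note d' = lin_map_carrier [OF lm(2)] lin_map_carrier [OF lm(4)]
  have XX: "cochain_complex (col0 X)" "cochain_complex (col1 X)"
    "\<And>n x. x \<in> carrier (obj (col0 X) n) \<Longrightarrow> hor10 X n (hor01 X n x) = vzero (obj (col0 X) n)"
    "\<And>n y. y \<in> carrier (obj (col1 X) n) \<Longrightarrow> hor01 X n (hor10 X n y) = vzero (obj (col1 X) n)"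
    "\<And>n x. x \<in> carrier (obj (col0 X) n) \<Longrightarrow>
        vadd (obj (col1 X) (Suc n)) (hor01 X (Suc n) (dif (col0 X) n x)) (dif (col1 X) n (hor01 X n x))
          = vzero (obj (col1 X) (Suc n))"
    "\<And>n y. y \<in> carrier (obj (col1 X) n) \<Longrightarrow>
        vadd (obj (col0 X) (Suc n)) (hor10 X (Suc n) (dif (col1 X) n y)) (dif (col0 X) n (hor10 X n y))
          = vzero (obj (col0 X) (Suc n))"
    using X by (simp_all add: super_complex_def)
  show ?thesis
    unfolding super_complex_def
  proof (intro conjI allI ballI lin(3,4))
    show "cochain_complex (col0 Y)" by (rule cochain_complex_transfer [OF XX(1) f zero(1) lin(1)])
    show "cochain_complex (col1 Y)" by (rule cochain_complex_transfer [OF XX(2) g zero(2) lin(2)])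
  next
    fix n y assume "y \<in> carrier (obj (col0 Y) n)"
    then obtain x where x: "x \<in> carrier (obj (col0 X) n)" and y: "y = f n x"
      using f unfolding cochain_iso_def lin_iso_def bij_betw_def by blast
    note dx = d(1) [OF x] d(2) [OF x]
    show "hor10 Y n (hor01 Y n y) = vzero (obj (col0 Y) n)"
      unfolding y h01 [OF x, symmetric] h10 [OF dx(2), symmetric] XX(3) [OF x] zero ..
    show "vadd (obj (col1 Y) (Suc n)) (hor01 Y (Suc n) (dif (col0 Y) n y)) (dif (col1 Y) n (hor01 Y n y))
          = vzero (obj (col1 Y) (Suc n))"
      unfolding y h01 [OF x, symmetric] f_dif [OF x, symmetric] h01 [OF dx(1), symmetric] g_dif [OF dx(2), symmetric]
        g_add [OF d(2) [OF dx(1)] d'(1) [OF dx(2)], symmetric]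
        XX(5) [OF x] zero ..
  next
    fix n y assume "y \<in> carrier (obj (col1 Y) n)"
    then obtain x where x: "x \<in> carrier (obj (col1 X) n)" and y: "y = g n x"
      using g unfolding cochain_iso_def lin_iso_def bij_betw_def by blast
    note d'' = d'(1) [OF x] d'(2) [OF x]
    show "hor01 Y n (hor10 Y n y) = vzero (obj (col1 Y) n)"
      unfolding y h10 [OF x, symmetric] h01 [OF d''(2), symmetric] XX(4) [OF x] zero ..
    show "vadd (obj (col0 Y) (Suc n)) (hor10 Y (Suc n) (dif (col1 Y) n y)) (dif (col0 Y) n (hor10 Y n y))
          = vzero (obj (col0 Y) (Suc n))"
      unfolding y h10 [OF x, symmetric] g_dif [OF x, symmetric] h10 [OF d''(1), symmetric] f_dif [OF d''(2), symmetric]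
        f_add [OF d'(2) [OF d''(1)] d(1) [OF d''(2)], symmetric]
        XX(6) [OF x] zero ..
  qed
qed

context hopf_character
begin

section \<open>The two isomorphisms\<close>

abbreviation C where "C \<equiv> hopf_cocyclic H \<delta>"
abbreviation Wn where "Wn \<equiv> cspan (graded_comms R \<union> coinv \<delta> (dga.act R))"
abbreviation K where "K n \<equiv> {x \<in> tpow n. Lam x = x}"

lemma W0_subset: "z \<in> W0 \<Longrightarrow> z \<in> Wn"
  using complex_vector.span_mono [of "coinv \<delta> (dga.act R)" "graded_comms R \<union> coinv \<delta> (dga.act R)"] by blast

lemma N_Lam_pow: "N ((Lam ^^ p) u) = N u"
  by (induction p) simp_all

text \<open>Commutators become \<open>u - Lam^p u\<close>, which \<open>N\<close> kills. Conversely
  the kernel of \<open>N\<close> is the image of \<open>1 - Lam\<close>, and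
  \<open>e (w - Lam w)\<close> is, modulo coinvariants, the graded commutator of \<open>e\<close>
  and \<open>w\<close>.\<close>

lemma Wn_iff: "z \<in> Wn \<longleftrightarrow> N (Phi (Rep_tens_pos z)) = 0"
proof
  assume z: "z \<in> Wn"
  have lin: "clinear (\<lambda>z. N (Phi (Rep_tens_pos z)))" by (simp add: clinear_iff)
  show "N (Phi (Rep_tens_pos z)) = 0"
  proof (rule clinear_zero_on_span [OF lin _ z])
    fix w assume "w \<in> graded_comms R \<union> coinv \<delta> (dga.act R)"
    then show "N (Phi (Rep_tens_pos w)) = 0"
    proof
      assume "w \<in> graded_comms R"
      then obtain x y p q where w: "w = x * y - (- 1) ^ (p * q) *\<^sub>C (y * x)" "x \<in> grade R p" "y \<in> grade R q"
        by (auto simp: graded_comms_def)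
      have "Phi (Rep_tens_pos w) = Phi (Rep_tens_pos x * Rep_tens_pos y)
          - (Lam ^^ p) (Phi (Rep_tens_pos x * Rep_tens_pos y))"
        using w(2,3) by (simp add: w(1) Lam_funpow_Phi grade_R)
      then show ?thesis by (simp add: N_Lam_pow)
    next
      assume "w \<in> coinv \<delta> (dga.act R)"
      then have "Phi (Rep_tens_pos w) = 0" using W0_iff cspan_base by blast
      then show ?thesis by simp
    qed
  qed
next
  have M: "pos_part (e * (w - Lam w)) \<in> Wn" for w
  proof (rule linear_span_mem [of "\<lambda>w. pos_part (e * (w - Lam w))", OF _ subspace_cspan _ tens_span])
    show "clinear (\<lambda>w. pos_part (e * (w - Lam w)))"
      by (simp add: clinear_iff algebra_simps scaleC_diff_right)
    fix w :: "'h tens" assume "w \<in> range pure"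
    then obtain xs where xs: "w = pure xs" by blast
    define n where "n = length xs"
    have w: "w \<in> tpow n" unfolding xs n_def by (rule pure_tpow) simp
    show "pos_part (e * (w - Lam w)) \<in> Wn"
    proof (cases n)
      \<comment> \<open>The commutator argument needs a \<open>w\<close> without scalar part. In
        degree 0 it is replaced by the fact that \<open>Lam\<close> is the identity there.\<close>
      case 0
      then have "Lam w = w" using Lam_period [OF w] by simp
      then show ?thesis by (simp add: complex_vector.span_zero)
    next
      case (Suc m)
      then have cw: "coeff0 w = 0" using coeff0_tpow [OF w] by simp
      have "pos_part e * pos_part w - (- 1) ^ (1 * n) *\<^sub>C (pos_part w * pos_part e) \<in> graded_comms R"
        unfolding graded_comms_def using pos_part_grade [OF e_tpow] pos_part_grade [OF w] by blast
      then have "pos_part e * pos_part w - (- 1) ^ (1 * n) *\<^sub>C (pos_part w * pos_part e) \<in> Wn"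
        by (intro cspan_base) blast
      then have 1: "pos_part (e * w) - (- 1) ^ n *\<^sub>C pos_part (w * e) \<in> Wn" by (simp add: pos_part_mult cw)
      have "w * e \<in> tpow (Suc n)" using tpow_mult [OF w e_tpow] by simp
      then have "Phi (w * e) \<in> tpow n" using Phi_degree by (simp add: degree_map_neg1)
      then have L: "Lam w = (- 1) ^ n *\<^sub>C Phi (w * e)" unfolding Lam_def by (rule parity_tpow)
      have "(- 1) ^ n *\<^sub>C (pos_part (w * e) - pos_part (e * Phi (w * e))) \<in> Wn"
        by (intro complex_vector.span_scale W0_subset pos_part_W0)
      from complex_vector.span_add [OF 1 this] show ?thesis
        by (simp add: L scaleC_diff_right algebra_simps)
    qed
  qed
  assume "N (Phi (Rep_tens_pos z)) = 0"
  then have "E (Phi (Rep_tens_pos z)) = 0" by (simp add: N_0_iff)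
  then have "pos_part (e * Phi (Rep_tens_pos z)) \<in> Wn"
    using M [of "J (Phi (Rep_tens_pos z))"] unfolding M_J by simp
  moreover have "z - pos_part (e * Phi (Rep_tens_pos z)) \<in> Wn"
    using W0_subset [OF pos_part_W0 [of "Rep_tens_pos z"]] by simp
  ultimately have "(z - pos_part (e * Phi (Rep_tens_pos z))) + pos_part (e * Phi (Rep_tens_pos z)) \<in> Wn"
    by (intro complex_vector.span_add)
  then show "z \<in> Wn" by simp
qed

lemma E_tpow: "x \<in> tpow n \<Longrightarrow> E x = (1 / of_nat (Suc n)) *\<^sub>C N x"
  using N_degree unfolding E_def V_def by (simp add: wt_tpow [of _ n] degree_map_0)

lemma N_K: "x \<in> K n \<Longrightarrow> N x = of_nat (Suc n) *\<^sub>C x"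
proof -
  assume x: "x \<in> K n"
  then have "of_nat (Suc n) *\<^sub>C E x = N x" by (simp add: E_tpow [of x n] del: of_nat_Suc)
  then show ?thesis using E_fixed [of x] x by simp
qed

lemma b_K: "x \<in> K n \<Longrightarrow> b x \<in> K (Suc n)"
  using M_b [of x] b_degree by (simp add: degree_map_1 b'_simps)

lemma subspace_K: "csubspace (K n)"
  by (rule complex_vector.subspaceI) (auto simp: tpow_closed)

lemma obj_cyclic_complex: "obj (cyclic_complex C) n = sub_space (K n)"
proof -
  have "{x \<in> cdeg C n. x - cyc_lambda C n x = 0} = K n"
    by (auto simp: hopf_cocyclic_def cocyclic.simps cyc_lambda_eq [unfolded hopf_cocyclic_def])
  then show ?thesis by (simp add: cyclic_complex_def)
qed

lemma pos_part_e_grade: "x \<in> tpow n \<Longrightarrow> pos_part (e * x) \<in> grade R (Suc n)"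
  using pos_part_grade [OF tpow_mult [OF e_tpow, of x n]] by simp

lemma Phi_grade: "z \<in> grade R (Suc n) \<Longrightarrow> Phi (Rep_tens_pos z) \<in> tpow n"
  using Phi_degree by (simp add: degree_map_neg1 grade_R)

lemma ddif_grade: "z \<in> grade R n \<Longrightarrow> ddif R z \<in> grade R (Suc n)"
  using ddif_R [of "Rep_tens_pos z"] D_degree by (simp add: grade_R degree_map_1)

lemma Rep_ddif: "Rep_tens_pos (ddif R z) = D (Rep_tens_pos z)"
  using ddif_R [of "Rep_tens_pos z"] by simp

lemma D_e_mult: "D (e * x) = e * b' x"
  by (simp add: D_mult D_e parity_e b'_def algebra_simps)

lemma cyclic_complex_isomorphic:
  "isomorphic_complexes (cyclic_complex C) (shift (natural_complex \<delta> R))"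
proof -
  let ?K = "cyclic_complex C" and ?L = "shift (natural_complex \<delta> R)"
  \<comment> \<open>On invariants of degree \<open>n\<close> the norm is multiplication by
    \<open>n + 1\<close>, so the weight gives \<open>N (Phi (h n x)) = x\<close>. Compatibility with
    the differentials is then \<open>N b' = b N\<close>.\<close>
  define h where "h n x = pos_part (e * ((1 / of_nat (Suc n)) *\<^sub>C x))" for n x
  let ?f = "\<lambda>n x. coset Wn (h n x)"
  have h: "clinear (h n)" for n unfolding h_def by (simp add: clinear_iff algebra_simps scaleC_add_right mult.commute)
  have L_obj: "obj ?L n = quot_space (grade R (Suc n)) Wn" and L_dif: "dif ?L n = quot_map Wn (ddif R)" for n
    by (simp_all add: shift_def natural_complex_def Let_def)
  have K_dif: "dif ?K n = cyc_b C n" for n by (simp add: cyclic_complex_def)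
  have K_eq: "cyc_b C n x = b x" if "x \<in> K n" for n x using that by (simp add: cyc_b_eq)
  have Wn: "csubspace Wn" by (rule subspace_cspan)
  have dW: "ddif R ` Wn \<subseteq> Wn"
    by (auto simp: Wn_iff Rep_ddif Phi_D b_N [symmetric] b_simps)
  have K: "cochain_complex ?K"
    unfolding cochain_complex_def obj_cyclic_complex K_dif
  proof (intro conjI allI ballI)
    show "lin_map (sub_space (K n)) (sub_space (K (Suc n))) (cyc_b C n)" for n
      by (rule lin_map_sub_space [OF degree_map_linear [OF b_degree] b_K subspace_K K_eq])
    fix n x assume "x \<in> carrier (sub_space (K n))"
    then have x: "x \<in> K n" by (simp add: sub_space_def)
    show "cyc_b C (Suc n) (cyc_b C n x) = vzero (sub_space (K (Suc (Suc n))))"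
      by (simp add: K_eq [OF x] K_eq [OF b_K [OF x]] b_b sub_space_def)
  qed
  have iso: "cochain_iso ?K ?L ?f"
    unfolding cochain_iso_def obj_cyclic_complex L_obj K_dif L_dif
  proof (intro conjI allI ballI)
    fix n
    show "lin_iso (sub_space (K n)) (quot_space (grade R (Suc n)) Wn) (?f n)"
    proof (rule lin_iso_coset [OF Wn subspace_K h])
      show "h n x \<in> grade R (Suc n)" if "x \<in> K n" for x
        unfolding h_def by (rule pos_part_e_grade) (use that in \<open>simp add: tpow_closed\<close>)
      show "x = 0" if x: "x \<in> K n" "h n x \<in> Wn" for x
        using x(2) N_K [OF x(1)] by (simp add: Wn_iff h_def del: of_nat_Suc)
      show "\<exists>x\<in>K n. y - h n x \<in> Wn" if y: "y \<in> grade R (Suc n)" for y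
      proof
        \<comment> \<open>The weight in \<open>h\<close> turns the norm of \<open>?z\<close> into
          its average, and \<open>N\<close> does not distinguish \<open>?z\<close> from the
          average.\<close>
        let ?z = "Phi (Rep_tens_pos y)"
        have z: "?z \<in> tpow n" by (rule Phi_grade [OF y])
        show "N ?z \<in> K n" using z N_degree by (simp add: degree_map_0)
        have "h n (N ?z) = pos_part (e * E ?z)" by (simp add: h_def E_tpow [OF z])
        then show "y - h n (N ?z) \<in> Wn" by (simp add: Wn_iff)
      qed
    qed
    fix x assume "x \<in> carrier (sub_space (K n))"
    then have x: "x \<in> K n" by (simp add: sub_space_def)
    have "N (Phi (Rep_tens_pos (h (Suc n) (b x) - ddif R (h n x)))) = 0"
    proof -
      have "N (Phi (Rep_tens_pos (ddif R (h n x)))) = (1 / of_nat (Suc n)) *\<^sub>C b (N x)"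
        by (simp add: Rep_ddif h_def Phi_D b_N b'_simps del: of_nat_Suc)
      also have "\<dots> = b x" unfolding N_K [OF x] by (simp add: b_simps del: of_nat_Suc)
      moreover have "N (Phi (Rep_tens_pos (h (Suc n) (b x)))) = b x"
        using N_K [OF b_K [OF x]] by (simp add: h_def del: of_nat_Suc)
      ultimately show ?thesis by simp
    qed
    then show "?f (Suc n) (cyc_b C n x) = quot_map Wn (ddif R) (?f n x)"
      unfolding K_eq [OF x] quot_map_coset [OF Wn Wn ddif_R_linear dW] coset_eq_iff [OF Wn] Wn_iff .
  qed
  have "cochain_complex ?L"
  proof (rule cochain_complex_transfer [OF K iso])
    show "?f n (vzero (obj ?K n)) = vzero (obj ?L n)" for n
      unfolding obj_cyclic_complex L_obj by (simp add: sub_space_def quot_space_def clinear_zero [OF h] coset_0)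
    show "lin_map (obj ?L n) (obj ?L (Suc n)) (dif ?L n)" for n
      unfolding L_obj L_dif by (rule lin_map_quot_space [OF Wn Wn ddif_R_linear dW ddif_grade])
  qed
  then show ?thesis unfolding isomorphic_complexes_def using K iso by blast
qed

lemma cyclic_bicomplex_isomorphic:
  "isomorphic_super (cyclic_bicomplex C) (shift_super (X_complex H \<delta> R))"
proof -
  let ?X = "cyclic_bicomplex C" and ?Y = "shift_super (X_complex H \<delta> R)"
  obtain al be where degs: "degree_map 0 al" "degree_map 0 be"
    and al_b': "\<And>x. al (b' x) = b' (al x)" and be_b: "\<And>x. be (b x) = b (be x)"
    and be_N: "\<And>x. be (N x) = N (al x)" and al_M: "\<And>x. al (x - Lam x) = - (be x - Lam (be x))"
    and al_al: "\<And>x. al (al x) = x" and be_0: "\<And>x. be x = 0 \<Longrightarrow> x = 0"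
    and be_surj: "\<And>n y. y \<in> tpow n \<Longrightarrow> \<exists>x\<in>tpow n. be x = y"
    using sign_twist.sign_twist_exists [OF sign_twist] by metis
  have lin: "clinear al" "clinear be" using degs degree_map_linear by blast+
  have al_t: "al x \<in> tpow n" and be_t: "be x \<in> tpow n" if "x \<in> tpow n" for x n
    using degs that by (simp_all add: degree_map_0)
  have S0: "csubspace W0" and S1: "csubspace W1"
    by (rule subspace_cspan)+
  define dm where "dm z = - ddif R z" for z
  have dm_lin: "clinear dm" by (simp add: clinear_iff dm_def)
  have X: "obj (col0 ?X) n = sub_space (tpow n)" "obj (col1 ?X) n = sub_space (tpow n)"
    "dif (col0 ?X) n = (\<lambda>x. - cyc_b' C n x)" "dif (col1 ?X) n = cyc_b C n"
    "hor01 ?X n = cyc_N C n" "hor10 ?X n = (\<lambda>x. x - cyc_lambda C n x)" for n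
    by (simp_all add: cyclic_bicomplex_def hopf_cocyclic_def)
  have Y: "obj (col0 ?Y) n = quot_space (grade R (Suc n)) W0"
    "obj (col1 ?Y) n = quot_space (omega_grade R (Suc n)) W1"
    "dif (col0 ?Y) n = quot_map W0 dm" "dif (col1 ?Y) n = quot_map W1 (omega_dif R)"
    "hor01 ?Y n = quot_map W1 omega_d" "hor10 ?Y n = quot_map W0 (omega_b R)" for n
    by (simp_all add: shift_super_def shift_def X_complex_def Let_def dm_def [abs_def])
  have dm_W0: "dm ` W0 \<subseteq> W0"
    by (auto simp: dm_def W0_iff Rep_ddif Phi_D b'_simps)
  have dif_W1: "omega_dif R ` W1 \<subseteq> W1" and d_W0: "omega_d ` W0 \<subseteq> W1" and b_W1: "omega_b R ` W1 \<subseteq> W0"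
    using omega_dif_W1 omega_d_W0 omega_b_W1 by blast+
  have dm_grade: "dm z \<in> grade R (Suc n)" if "z \<in> grade R n" for z n
    using ddif_grade [OF that] by (simp add: dm_def grade_R tpow_closed)
  note q0 = quot_map_coset [OF S0 S0 dm_lin dm_W0]
  note q1 = quot_map_coset [OF S1 S1 omega_dif_linear dif_W1]
  note q01 = quot_map_coset [OF S0 S1 omega_d_linear d_W0]
  note q10 = quot_map_coset [OF S1 S0 omega_b_linear b_W1]
  have omega_dif_grade: "omega_dif R \<omega> \<in> omega_grade R (Suc n)" if "\<omega> \<in> omega_grade R n" for \<omega> n
  proof (rule omega_grade_linear_mem [OF omega_dif_linear _ _ that])
    show "csubspace (omega_grade R (Suc n))"
      unfolding omega_grade_def by (rule subspace_cspan)
    fix p q and x y :: "'h tens" assume a: "x \<in> tpow p" "y \<in> tpow q" "coeff0 y = 0" "p + q = n"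
    have "D x \<in> tpow (Suc p)" "D y \<in> tpow (Suc q)" "parity x \<in> tpow p"
      using a(1,2) D_degree parity_degree by (simp_all add: degree_map_1 degree_map_0)
    from form_omega_grade [OF this(1) a(2)] form_omega_grade [OF this(3,2)]
    show "omega_dif R (form x y) \<in> omega_grade R (Suc n)"
      unfolding omega_dif_form omega_grade_def using a(4) by (simp add: complex_vector.span_add)
  qed
  have omega_b_grade: "omega_b R \<omega> \<in> grade R n" if "\<omega> \<in> omega_grade R n" for \<omega> n
  proof (rule omega_grade_linear_mem [OF omega_b_linear _ _ that])
    show "csubspace (grade R n)"
      by (rule complex_vector.subspaceI) (auto simp: grade_R tpow_closed)
    fix p q and x y :: "'h tens" assume a: "x \<in> tpow p" "y \<in> tpow q" "coeff0 y = 0" "p + q = n"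
    show "omega_b R (form x y) \<in> grade R n"
      unfolding omega_b_form [OF a(1-3)]
      using tpow_mult [OF a(1,2)] tpow_mult [OF a(2,1)] a(4)
      by (intro pos_part_grade tpow_closed) (simp_all add: add.commute)
  qed
  \<comment> \<open>Without \<open>al\<close> and \<open>be\<close> these maps respect everything
    except the sign of \<open>hor10\<close>; the two automorphisms absorb it.\<close>
  let ?f = "\<lambda>n x. coset W0 (pos_part (e * al x))" and ?g = "\<lambda>n x. coset W1 (G (be x))"
  have f_lin: "clinear (\<lambda>x. pos_part (e * al x))" and g_lin: "clinear (\<lambda>x. G (be x))"
    by (simp_all add: clinear_iff G_simps clinearD [OF lin(1)] clinearD [OF lin(2)] algebra_simps)
  have car: "carrier (sub_space (tpow n)) = (tpow n :: 'h tens set)" for n by (simp add: sub_space_def)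
  have b_t: "b x \<in> tpow (Suc n)" and b'_t: "b' x \<in> tpow (Suc n)" and N_t: "N x \<in> tpow n" and L_t: "Lam x \<in> tpow n"
    if "x \<in> tpow n" for x n
    using that b_degree b'_degree N_degree Lam_degree by (simp_all add: degree_map_0 degree_map_1)
  have X_super: "super_complex ?X"
    unfolding super_complex_def cochain_complex_def X car
  proof (intro conjI allI ballI)
    have l: "clinear (\<lambda>x. - b' x)" "clinear (\<lambda>x. x - Lam x)"
      by (simp_all add: clinear_iff b'_simps scaleC_diff_right)
    fix n
    show "lin_map (sub_space (tpow n)) (sub_space (tpow (Suc n))) (\<lambda>x. - cyc_b' C n x)"
      by (rule lin_map_sub_space [OF l(1) _ subspace_tpow]) (simp_all add: cyc_b'_eq b'_t tpow_closed)
    show "lin_map (sub_space (tpow n)) (sub_space (tpow (Suc n))) (cyc_b C n)"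
      by (rule lin_map_sub_space [OF degree_map_linear [OF b_degree] _ subspace_tpow]) (simp_all add: cyc_b_eq b_t)
    show "lin_map (sub_space (tpow n)) (sub_space (tpow n)) (cyc_N C n)"
      by (rule lin_map_sub_space [OF degree_map_linear [OF N_degree] _ subspace_tpow]) (simp_all add: cyc_N_eq N_t)
    show "lin_map (sub_space (tpow n)) (sub_space (tpow n)) (\<lambda>x. x - cyc_lambda C n x)"
      by (rule lin_map_sub_space [OF l(2) _ subspace_tpow]) (simp_all add: cyc_lambda_eq L_t tpow_closed)
  next
    fix n and x :: "'h tens" assume x: "x \<in> tpow n"
    note eqs = cyc_b_eq [OF x] cyc_b'_eq [OF x] cyc_N_eq [OF x] cyc_lambda_eq [OF x]
      cyc_b_eq [OF b_t [OF x]] cyc_b'_eq [OF tpow_closed(4) [OF b'_t [OF x]]] cyc_lambda_eq [OF N_t [OF x]]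
      cyc_N_eq [OF tpow_closed(3) [OF x L_t [OF x]]] cyc_N_eq [OF tpow_closed(4) [OF b'_t [OF x]]]
      cyc_b_eq [OF N_t [OF x]] cyc_lambda_eq [OF b_t [OF x]] cyc_b'_eq [OF tpow_closed(3) [OF x L_t [OF x]]]
    show "- cyc_b' C (Suc n) (- cyc_b' C n x) = vzero (sub_space (tpow (Suc (Suc n))))"
      by (simp add: eqs sub_space_def b'_simps b'_b')
    show "cyc_b C (Suc n) (cyc_b C n x) = vzero (sub_space (tpow (Suc (Suc n))))"
      by (simp add: eqs sub_space_def b_b)
    show "cyc_N C n x - cyc_lambda C n (cyc_N C n x) = vzero (sub_space (tpow n))"
      by (simp add: eqs sub_space_def)
    show "cyc_N C n (x - cyc_lambda C n x) = vzero (sub_space (tpow n))"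
      by (simp add: eqs sub_space_def)
    show "vadd (sub_space (tpow (Suc n))) (cyc_N C (Suc n) (- cyc_b' C n x)) (cyc_b C n (cyc_N C n x))
        = vzero (sub_space (tpow (Suc n)))"
      by (simp add: eqs sub_space_def b_N)
    show "vadd (sub_space (tpow (Suc n))) (cyc_b C n x - cyc_lambda C (Suc n) (cyc_b C n x))
        (- cyc_b' C n (x - cyc_lambda C n x)) = vzero (sub_space (tpow (Suc n)))"
      unfolding eqs M_b by (simp add: sub_space_def)
  qed
  have iso0: "cochain_iso (col0 ?X) (col0 ?Y) ?f"
    unfolding cochain_iso_def X Y car
  proof (intro conjI allI ballI)
    fix n
    show "lin_iso (sub_space (tpow n)) (quot_space (grade R (Suc n)) W0) (?f n)"
    proof (rule lin_iso_coset [OF S0 subspace_tpow f_lin])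
      show "pos_part (e * al x) \<in> grade R (Suc n)" if "x \<in> tpow n" for x
        using al_t [OF that] by (rule pos_part_e_grade)
      show "x = 0" if "pos_part (e * al x) \<in> W0" for x
        using that al_al [of x] by (simp add: W0_iff clinear_zero [OF lin(1)])
      show "\<exists>x\<in>tpow n. y - pos_part (e * al x) \<in> W0" if "y \<in> grade R (Suc n)" for y
        using pos_part_W0 [of "Rep_tens_pos y"] al_t [OF Phi_grade [OF that]]
        by (intro bexI [of _ "al (Phi (Rep_tens_pos y))"]) (simp_all add: al_al)
    qed
    fix x :: "'h tens" assume x: "x \<in> tpow n"
    have "dm (pos_part (e * al x)) = pos_part (e * al (- b' x))"
      by (simp add: dm_def ddif_R D_e_mult al_b' clinearD [OF lin(1)])
    then show "?f (Suc n) (- cyc_b' C n x) = quot_map W0 dm (?f n x)"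
      by (simp add: q0 cyc_b'_eq [OF x])
  qed
  have iso1: "cochain_iso (col1 ?X) (col1 ?Y) ?g"
    unfolding cochain_iso_def X Y car
  proof (intro conjI allI ballI)
    fix n
    show "lin_iso (sub_space (tpow n)) (quot_space (omega_grade R (Suc n)) W1) (?g n)"
    proof (rule lin_iso_coset [OF S1 subspace_tpow g_lin])
      show "G (be x) \<in> omega_grade R (Suc n)" if "x \<in> tpow n" for x
        using be_t [OF that] by (rule G_grade)
      show "x = 0" if "x \<in> tpow n" "G (be x) \<in> W1" for x
        using G_inj [OF be_t [OF that(1)] that(2)] by (rule be_0)
      show "\<exists>x\<in>tpow n. y - G (be x) \<in> W1" if y: "y \<in> omega_grade R (Suc n)" for y
      proof -
        obtain z where z: "z \<in> tpow n" "y - G z \<in> W1" using G_representative [OF y] .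
        obtain x where "x \<in> tpow n" "be x = z" using be_surj [OF z(1)] by blast
        then show ?thesis using z(2) by blast
      qed
    qed
    fix x :: "'h tens" assume x: "x \<in> tpow n"
    have "- (omega_dif R (G (be x)) - G (b (be x))) \<in> W1"
      by (intro complex_vector.span_neg omega_dif_G [OF be_t [OF x]])
    then show "?g (Suc n) (cyc_b C n x) = quot_map W1 (omega_dif R) (?g n x)"
      by (simp add: q1 cyc_b_eq [OF x] be_b coset_eq_iff [OF S1])
  qed
  have hor01: "?g n (hor01 ?X n x) = hor01 ?Y n (?f n x)" if "x \<in> carrier (obj (col0 ?X) n)" for n x
  proof -
    have x: "x \<in> tpow n" using that by (simp add: X car)
    have "- (omega_d (pos_part (e * al x)) - G (N (al x))) \<in> W1"
      by (intro complex_vector.span_neg omega_d_G [OF al_t [OF x]])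
    then show ?thesis unfolding X Y q01 cyc_N_eq [OF x] be_N coset_eq_iff [OF S1] by simp
  qed
  have hor10: "?f n (hor10 ?X n y) = hor10 ?Y n (?g n y)" if "y \<in> carrier (obj (col1 ?X) n)" for n y
  proof -
    have y: "y \<in> tpow n" using that by (simp add: X car)
    have "- (omega_b R (G (be y)) + pos_part (e * (be y - Lam (be y)))) \<in> W0"
      by (intro complex_vector.span_neg omega_b_G [OF be_t [OF y]])
    then show ?thesis unfolding X Y q10 cyc_lambda_eq [OF y] al_M coset_eq_iff [OF S0]
      by (simp add: algebra_simps)
  qed
  have Y_lin: "lin_map (obj (col0 ?Y) n) (obj (col0 ?Y) (Suc n)) (dif (col0 ?Y) n)"
    "lin_map (obj (col1 ?Y) n) (obj (col1 ?Y) (Suc n)) (dif (col1 ?Y) n)"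
    "lin_map (obj (col0 ?Y) n) (obj (col1 ?Y) n) (hor01 ?Y n)"
    "lin_map (obj (col1 ?Y) n) (obj (col0 ?Y) n) (hor10 ?Y n)" for n
    unfolding Y
    by (rule lin_map_quot_space [OF S0 S0 dm_lin dm_W0 dm_grade]
        lin_map_quot_space [OF S1 S1 omega_dif_linear dif_W1 omega_dif_grade]
        lin_map_quot_space [OF S0 S1 omega_d_linear d_W0 omega_d_grade]
        lin_map_quot_space [OF S1 S0 omega_b_linear b_W1 omega_b_grade]; assumption)+
  have "super_complex ?Y"
  proof (rule super_complex_transfer [where f = ?f and g = ?g, OF X_super iso0 iso1 _ _ _ _ Y_lin])
    show "?g n (hor01 ?X n x) = hor01 ?Y n (?f n x)" if "x \<in> carrier (obj (col0 ?X) n)" for n x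
      using that by (rule hor01)
    show "?f n (hor10 ?X n y) = hor10 ?Y n (?g n y)" if "y \<in> carrier (obj (col1 ?X) n)" for n y
      using that by (rule hor10)
    show "?f n (vzero (obj (col0 ?X) n)) = vzero (obj (col0 ?Y) n)"
      "?g n (vzero (obj (col1 ?X) n)) = vzero (obj (col1 ?Y) n)" for n
      unfolding X Y by (simp_all add: sub_space_def quot_space_def coset_0 clinear_zero [OF lin(1)]
        clinear_zero [OF lin(2)] G_simps)
  qed
  then show ?thesis
    unfolding isomorphic_super_def using X_super iso0 iso1 hor01 hor10
    by (intro conjI exI [of _ ?f] exI [of _ ?g] ballI allI) simp_all
qed

end

theorem theorem4p7:
  fixes H :: "'h::complex_algebra_1 hopf" and \<delta> :: "'h \<Rightarrow> complex"
  assumes "hopf_algebra H"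
    and "character \<delta>"
    and "\<forall>h. twisted_antipode H \<delta> (twisted_antipode H \<delta> h) = h"
  shows "isomorphic_complexes
           (cyclic_complex (hopf_cocyclic H \<delta>))
           (shift (natural_complex \<delta> (tensor_dga H)))
       \<and> isomorphic_super
           (cyclic_bicomplex (hopf_cocyclic H \<delta>))
           (shift_super (X_complex H \<delta> (tensor_dga H)))"
proof -
  interpret hopf_character H \<delta>
    using assms by (intro hopf_character.intro hopf_character_axioms.intro) auto
  show ?thesis using cyclic_complex_isomorphic cyclic_bicomplex_isomorphic by blast
qed

end
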